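(* Let $\{p:(L,h)\to(M,g_M),\ I\}$ be horizontal data with $I=[0,\varepsilon)$ for some $\varepsilon>0$, and assume there exist distinct momentum profiles $\varphi_1$ and $\varphi_2$ on $I$, equal at $0$ and inducing bundle-adapted metrics of constant scalar curvature $c_1$ and $c_2$, respectively (not necessarily with $c_1\neq c_2$). Then the horizontal data are $\sigma$-constant.
   Context: Conventions: a Kähler metric with local components $g_{i\bar\jmath}$ has Kähler form $\omega=\frac{\sqrt{-1}}2\sum g_{i\bar\jmath}\,dz^i\wedge d\bar z^j$ and Ricci form $\rho=-\sqrt{-1}\,\partial\bar\partial\log\det(g_{i\bar\jmath})$. Its scalar curvature is the trace of the endomorphism $\omega^{-1}\rho$ of $T^{1,0}$. $p:(L,h)\to(M,g_M)$ is an Hermitian holomorphic line bundle over a Kähler manifold with Kähler form $\omega_M$. Its curvature form is $\gamma=-\sqrt{-1}\,\partial\bar\partial\log h$, where $h$ also denotes the local function such that the squared norm on $L$ is $r=|z^0|^2h(z)$, $z^0$ being a linear fibre coordinate. Horizontal data $\{p:(L,h)\to(M,g_M),I\}$ consist of such a bundle together with an interval $I\subset\mathbf R$ such that $\omega_M(\tau):=\omega_M-\tau\gamma$ is positive for every $\tau\in I$; the corresponding metric is $g_M(\tau)$. The data are $\sigma$-constant if (i) the curvature endomorphism $\omega_M^{-1}\gamma$ of $T^{1,0}M$ has constant eigenvalues on $M$, and (ii) $g_M(\tau)$ has constant scalar curvature for each $\tau\in I$. A momentum profile is a function $\varphi$ that is smooth on the closure of $I$ and positive on the interior of $I$. Metric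 induced by a profile: with $(a,b)$ the interior of $I$ and $\tau_0\in(a,b)$ fixed, set $t_1=\lim_{\tau\to a^+}\int_{\tau_0}^\tau dx/\varphi(x)$ and $t_2=\lim_{\tau\to b^-}\int_{\tau_0}^\tau dx/\varphi(x)$. Define $\mu(t)$ and $f(t)$ on $(t_1,t_2)$ by $t=\int_{\tau_0}^{\mu(t)}\frac{dx}{\varphi(x)}$ and $f(t)=\int_{\tau_0}^{\mu(t)}\frac{x\,dx}{\varphi(x)}$. With $t=\frac12\log r$ on $L$ minus its zero section, the induced bundle-adapted metric is the Kähler metric on $\{t_1<t<t_2\}$ with Kähler form $p^*\omega_M+2\sqrt{-1}\,\partial\bar\partial f(t)$. *)

theory Defs
  imports "HOL-Analysis.Analysis" "HOL-Computational_Algebra.Computational_Algebra"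
begin

section \<open>Calculus on open subsets of real and complex coordinate space\<close>

fun Ck_on :: "nat \<Rightarrow> 'a::real_normed_vector set \<Rightarrow> ('a \<Rightarrow> 'b::real_normed_vector) \<Rightarrow> bool" where
  "Ck_on 0 S f \<longleftrightarrow> continuous_on S f"
| "Ck_on (Suc k) S f \<longleftrightarrow>
     (\<forall>x\<in>S. f differentiable (at x)) \<and> (\<forall>v. Ck_on k S (\<lambda>x. frechet_derivative f (at x) v))"

text \<open>Only meaningful for open \<open>S\<close>, because the derivatives are two-sided.\<close>

definition smooth_on :: "'a::real_normed_vector set \<Rightarrow> ('a \<Rightarrow> 'b::real_normed_vector) \<Rightarrow> bool" where
  "smooth_on S f \<longleftrightarrow> (\<forall>k. Ck_on k S f)"

definition holo_on :: "(complex^'n::finite) set \<Rightarrow> (complex^'n \<Rightarrow> complex) \<Rightarrow> bool" where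
  "holo_on S u \<longleftrightarrow>
     (\<forall>z\<in>S. \<exists>D. (u has_derivative D) (at z) \<and> (\<forall>a v. D (a *s v) = a * D v))"

definition wd :: "'n::finite \<Rightarrow> (complex^'n \<Rightarrow> complex) \<Rightarrow> complex^'n \<Rightarrow> complex"  \<comment> \<open>\<open>\<partial>/\<partial>z\<^sup>j\<close>\<close> where
  "wd j u z = (frechet_derivative u (at z) (axis j 1)
                 - \<i> * frechet_derivative u (at z) (axis j \<i>)) / 2"

definition wdbar :: "'n::finite \<Rightarrow> (complex^'n \<Rightarrow> complex) \<Rightarrow> complex^'n \<Rightarrow> complex"  \<comment> \<open>conjugate of \<open>\<partial>/\<partial>z\<^sup>j\<close>\<close> where
  "wdbar j u z = (frechet_derivative u (at z) (axis j 1)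
                    + \<i> * frechet_derivative u (at z) (axis j \<i>)) / 2"

text \<open>
  A (1,1)-form is represented in coordinates by the matrix \<open>B\<close> of its coefficients with respect
  to \<open>(\<i>/2) dz\<^sup>i \<and> d(cnj z\<^sup>j)\<close>.  Thus the Kaehler form of a metric has the metric
  coefficients themselves as its matrix, and the form \<open>\<i> \<partial>\<partial>bar u\<close> has coefficients twice the
  mixed second derivatives of \<open>u\<close>.
\<close>

definition iddbar :: "(complex^'n::finite \<Rightarrow> complex) \<Rightarrow> complex^'n \<Rightarrow> complex^'n^'n" where
  "iddbar u z = (\<chi> i j. 2 * wd i (wdbar j u) z)"

section \<open>Hermitian coefficient matrices and scalar curvature\<close>

definition hermitian_pos :: "complex^'n::finite^'n \<Rightarrow> bool" where
  "hermitian_pos G \<longleftrightarrow>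
     (\<forall>i j. G $ i $ j = cnj (G $ j $ i)) \<and>
     (\<forall>v. v \<noteq> 0 \<longrightarrow> 0 < Re (\<Sum>i\<in>UNIV. \<Sum>j\<in>UNIV. G $ i $ j * v $ i * cnj (v $ j)))"

text \<open>
  The endomorphism \<open>e = \<omega>\<^sup>-\<^sup>1\<beta>\<close> of the (1,0)-vectors, characterised by
  \<open>\<beta>(X, cnj Y) = \<omega>(e X, cnj Y)\<close>: the matrices satisfy \<open>B = transpose e ** G\<close>.
\<close>

definition form_endo :: "complex^'n::finite^'n \<Rightarrow> complex^'n^'n \<Rightarrow> complex^'n^'n" where
  "form_endo G B = transpose (B ** matrix_inv G)"

definition ricci_form :: "(complex^'n::finite \<Rightarrow> complex^'n^'n) \<Rightarrow> complex^'n \<Rightarrow> complex^'n^'n" where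
  "ricci_form G z = - iddbar (\<lambda>w. ln (det (G w))) z"

definition scal :: "(complex^'n::finite \<Rightarrow> complex^'n^'n) \<Rightarrow> complex^'n \<Rightarrow> complex" where
  "scal G z = trace (form_endo (G z) (ricci_form G z))"

definition charpoly :: "complex^'n::finite^'n \<Rightarrow> complex poly" where
  "charpoly E = det (\<chi> i j. (if i = j then [:0, 1:] else 0) - [:E $ i $ j:])"

definition eigenvalues :: "complex^'n::finite^'n \<Rightarrow> complex multiset" where
  "eigenvalues E = proots (charpoly E)"

section \<open>Kaehler manifolds\<close>

text \<open>A chart is a pair of a domain and a coordinate map.\<close>

type_synonym ('a, 'n) chart = "'a set \<times> ('a \<Rightarrow> complex^'n)"

definition chart_inv :: "('a, 'n::finite) chart \<Rightarrow> complex^'n \<Rightarrow> 'a" where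
  "chart_inv c = inv_into (fst c) (snd c)"

record ('a, 'n) kaehler_data =
  mspace :: "'a topology"
  atlas :: "('a, 'n) chart set"
  metric :: "('a, 'n) chart \<Rightarrow> complex^'n \<Rightarrow> complex^'n^'n"
    \<comment> \<open>metric coefficients in a chart, as functions of the coordinates\<close>

definition complex_manifold :: "'a topology \<Rightarrow> ('a, 'n::finite) chart set \<Rightarrow> bool" where
  "complex_manifold X A \<longleftrightarrow>
     Hausdorff_space X \<and> second_countable X \<and> \<Union> (fst ` A) = topspace X \<and>
     (\<forall>c\<in>A. openin X (fst c) \<and> open (snd c ` fst c) \<and>
        homeomorphic_map (subtopology X (fst c)) (top_of_set (snd c ` fst c)) (snd c)) \<and>
     (\<forall>c\<in>A. \<forall>c'\<in>A. \<forall>k.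
        holo_on (snd c ` (fst c \<inter> fst c')) (\<lambda>z. snd c' (chart_inv c z) $ k))"

definition transition_jacobian ::
    "('a, 'n::finite) chart \<Rightarrow> ('a, 'n) chart \<Rightarrow> complex^'n \<Rightarrow> complex^'n^'n" where
  "transition_jacobian c c' z = (\<chi> k i. wd i (\<lambda>w. snd c' (chart_inv c w) $ k) z)"

text \<open>
  The clauses on the metric are, in order: smoothness, positivity, closedness of the Kaehler form
  (its (2,1)-part; the (1,2)-part is the conjugate), and tensoriality under change of chart.
\<close>

definition kaehler_manifold :: "('a, 'n::finite) kaehler_data \<Rightarrow> bool" where
  "kaehler_manifold M \<longleftrightarrow>
     complex_manifold (mspace M) (atlas M) \<and>
     (\<forall>c\<in>atlas M.
        smooth_on (snd c ` fst c) (metric M c) \<and>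
        (\<forall>z\<in>snd c ` fst c. hermitian_pos (metric M c z) \<and>
           (\<forall>i j k. wd k (\<lambda>w. metric M c w $ i $ j) z = wd i (\<lambda>w. metric M c w $ k $ j) z))) \<and>
     (\<forall>c\<in>atlas M. \<forall>c'\<in>atlas M. \<forall>x\<in>fst c \<inter> fst c'. \<forall>i j.
        metric M c (snd c x) $ i $ j =
          (\<Sum>k\<in>UNIV. \<Sum>l\<in>UNIV. metric M c' (snd c' x) $ k $ l *
             transition_jacobian c c' (snd c x) $ k $ i *
             cnj (transition_jacobian c c' (snd c x) $ l $ j)))"

section \<open>Hermitian holomorphic line bundles\<close>

text \<open>
  A local trivialization is a pair of an open set \<open>V\<close> of the base and a fibre coordinate on the
  part of the total space over \<open>V\<close>.  Fibre coordinates are related by multiplication by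
  holomorphic functions, hence they induce the complex line structure of the fibres.
\<close>

type_synonym ('a, 'l) triv = "'a set \<times> ('l \<Rightarrow> complex)"

record ('a, 'l) line_bundle_data =
  total :: "'l topology"
  proj :: "'l \<Rightarrow> 'a"
  trivs :: "('a, 'l) triv set"
  sqnorm :: "'l \<Rightarrow> real"  \<comment> \<open>the function \<open>r\<close>\<close>

definition over :: "('a, 'l) line_bundle_data \<Rightarrow> 'a set \<Rightarrow> 'l set" where
  "over L V = {v \<in> topspace (total L). proj L v \<in> V}"

text \<open>The local function \<open>h\<close>: the squared norm of the frame defined by a fibre coordinate.\<close>

definition local_h :: "('a, 'l) line_bundle_data \<Rightarrow> ('a, 'l) triv \<Rightarrow> 'a \<Rightarrow> real" where
  "local_h L T x = sqnorm L (THE v. v \<in> topspace (total L) \<and> proj L v = x \<and> snd T v = 1)"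

definition holomorphic_line_bundle ::
    "('a, 'n::finite) kaehler_data \<Rightarrow> ('a, 'l) line_bundle_data \<Rightarrow> bool" where
  "holomorphic_line_bundle M L \<longleftrightarrow>
     continuous_map (total L) (mspace M) (proj L) \<and>
     \<Union> (fst ` trivs L) = topspace (mspace M) \<and>
     (\<forall>T\<in>trivs L. openin (mspace M) (fst T) \<and>
        homeomorphic_map (subtopology (total L) (over L (fst T)))
          (prod_topology (subtopology (mspace M) (fst T)) euclidean)
          (\<lambda>v. (proj L v, snd T v))) \<and>
     (\<forall>T\<in>trivs L. \<forall>T'\<in>trivs L. \<exists>\<theta>.
        (\<forall>x\<in>fst T \<inter> fst T'. \<theta> x \<noteq> 0) \<and>
        (\<forall>c\<in>atlas M. holo_on (snd c ` (fst c \<inter> fst T \<inter> fst T')) (\<lambda>z. \<theta> (chart_inv c z))) \<and>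
        (\<forall>v\<in>over L (fst T \<inter> fst T'). snd T' v = \<theta> (proj L v) * snd T v))"

definition hermitian_metric ::
    "('a, 'n::finite) kaehler_data \<Rightarrow> ('a, 'l) line_bundle_data \<Rightarrow> bool" where
  "hermitian_metric M L \<longleftrightarrow>
     (\<forall>T\<in>trivs L.
        (\<forall>x\<in>fst T. 0 < local_h L T x) \<and>
        (\<forall>v\<in>over L (fst T). sqnorm L v = (cmod (snd T v))\<^sup>2 * local_h L T (proj L v)) \<and>
        (\<forall>c\<in>atlas M. smooth_on (snd c ` (fst c \<inter> fst T)) (\<lambda>z. local_h L T (chart_inv c z))))"

text \<open>
  The curvature form \<open>\<gamma>\<close> in the chart \<open>c\<close>, computed from the trivialization \<open>T\<close>.  The value at a
  point does not depend on \<open>T\<close>, so statements below quantify over all \<open>T\<close> around the point.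
\<close>

definition curv_form ::
    "('a, 'l) line_bundle_data \<Rightarrow> ('a, 'n::finite) chart \<Rightarrow> ('a, 'l) triv \<Rightarrow> complex^'n \<Rightarrow> complex^'n^'n" where
  "curv_form L c T z = - iddbar (\<lambda>w. of_real (ln (local_h L T (chart_inv c w)))) z"

section \<open>Horizontal data and momentum profiles\<close>

definition metric_at ::
    "('a, 'n::finite) kaehler_data \<Rightarrow> ('a, 'l) line_bundle_data \<Rightarrow> real
       \<Rightarrow> ('a, 'n) chart \<Rightarrow> ('a, 'l) triv \<Rightarrow> complex^'n \<Rightarrow> complex^'n^'n"  \<comment> \<open>\<open>g\<^sub>M(\<tau>)\<close>\<close> where
  "metric_at M L \<tau> c T z = metric M c z - \<tau> *\<^sub>R curv_form L c T z"

definition horizontal_data ::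
    "('a, 'n::finite) kaehler_data \<Rightarrow> ('a, 'l) line_bundle_data \<Rightarrow> real set \<Rightarrow> bool" where
  "horizontal_data M L I \<longleftrightarrow>
     kaehler_manifold M \<and> holomorphic_line_bundle M L \<and> hermitian_metric M L \<and> is_interval I \<and>
     (\<forall>\<tau>\<in>I. \<forall>c\<in>atlas M. \<forall>T\<in>trivs L. \<forall>x\<in>fst c \<inter> fst T. hermitian_pos (metric_at M L \<tau> c T (snd c x)))"

definition sigma_constant ::
    "('a, 'n::finite) kaehler_data \<Rightarrow> ('a, 'l) line_bundle_data \<Rightarrow> real set \<Rightarrow> bool" where
  "sigma_constant M L I \<longleftrightarrow>
     (\<exists>\<Lambda>. \<forall>c\<in>atlas M. \<forall>T\<in>trivs L. \<forall>x\<in>fst c \<inter> fst T.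
        eigenvalues (form_endo (metric M c (snd c x)) (curv_form L c T (snd c x))) = \<Lambda>) \<and>
     (\<forall>\<tau>\<in>I. \<exists>s::real. \<forall>c\<in>atlas M. \<forall>T\<in>trivs L. \<forall>x\<in>fst c \<inter> fst T.
        scal (metric_at M L \<tau> c T) (snd c x) = of_real s)"

text \<open>Smoothness on the closure means having a smooth extension to a neighbourhood.\<close>

definition momentum_profile :: "real set \<Rightarrow> (real \<Rightarrow> real) \<Rightarrow> bool" where
  "momentum_profile I \<phi> \<longleftrightarrow>
     (\<exists>U \<psi>. open U \<and> closure I \<subseteq> U \<and> smooth_on U \<psi> \<and> (\<forall>x\<in>closure I. \<psi> x = \<phi> x)) \<and>
     (\<forall>x\<in>interior I. 0 < \<phi> x)"

section \<open>The metric induced by a profile\<close>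

definition profile_t :: "(real \<Rightarrow> real) \<Rightarrow> real \<Rightarrow> ereal \<Rightarrow> real" where
  "profile_t \<phi> \<tau>0 \<tau> = (LBINT x=ereal \<tau>0..\<tau>. 1 / \<phi> x)"

definition profile_t1 :: "real set \<Rightarrow> (real \<Rightarrow> real) \<Rightarrow> real \<Rightarrow> ereal" where
  "profile_t1 I \<phi> \<tau>0 =
     Lim (at_right (Inf (ereal ` interior I))) (\<lambda>\<tau>. ereal (profile_t \<phi> \<tau>0 \<tau>))"

definition profile_t2 :: "real set \<Rightarrow> (real \<Rightarrow> real) \<Rightarrow> real \<Rightarrow> ereal" where
  "profile_t2 I \<phi> \<tau>0 =
     Lim (at_left (Sup (ereal ` interior I))) (\<lambda>\<tau>. ereal (profile_t \<phi> \<tau>0 \<tau>))"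

definition profile_mu :: "real set \<Rightarrow> (real \<Rightarrow> real) \<Rightarrow> real \<Rightarrow> real \<Rightarrow> real" where
  "profile_mu I \<phi> \<tau>0 t = (THE m. m \<in> interior I \<and> t = profile_t \<phi> \<tau>0 (ereal m))"

definition profile_f :: "real set \<Rightarrow> (real \<Rightarrow> real) \<Rightarrow> real \<Rightarrow> real \<Rightarrow> real" where
  "profile_f I \<phi> \<tau>0 t = (LBINT x=ereal \<tau>0..ereal (profile_mu I \<phi> \<tau>0 t). x / \<phi> x)"

definition log_norm :: "('a, 'l) line_bundle_data \<Rightarrow> 'l \<Rightarrow> real"  \<comment> \<open>the function \<open>t\<close>\<close> where
  "log_norm L v = ln (sqnorm L v) / 2"

definition induced_domain ::
    "('a, 'l) line_bundle_data \<Rightarrow> real set \<Rightarrow> real \<Rightarrow> (real \<Rightarrow> real) \<Rightarrow> 'l set" where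
  "induced_domain L I \<tau>0 \<phi> =
     {v \<in> topspace (total L). sqnorm L v \<noteq> 0 \<and>
        profile_t1 I \<phi> \<tau>0 < ereal (log_norm L v) \<and> ereal (log_norm L v) < profile_t2 I \<phi> \<tau>0}"

text \<open>
  Charts of the total space: coordinate \<open>None\<close> is the fibre coordinate \<open>z\<^sup>0\<close>, and the
  coordinates \<open>Some i\<close> are those of the base.
\<close>

definition bundle_chart ::
    "('a, 'l) line_bundle_data \<Rightarrow> ('a, 'n::finite) chart \<Rightarrow> ('a, 'l) triv \<Rightarrow> ('l, 'n option) chart" where
  "bundle_chart L c T =
     (over L (fst c \<inter> fst T),
      \<lambda>v. \<chi> A. case A of None \<Rightarrow> snd T v | Some i \<Rightarrow> snd c (proj L v) $ i)"

text \<open>Pullback of a (1,1)-form on the base under the projection, which forgets the coordinate \<open>None\<close>.\<close>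

definition pullback_form ::
    "(complex^'n::finite \<Rightarrow> complex^'n^'n) \<Rightarrow> complex^('n option) \<Rightarrow> complex^('n option)^('n option)" where
  "pullback_form G w =
     (\<chi> A B. case (A, B) of (Some i, Some j) \<Rightarrow> G (\<chi> k. w $ Some k) $ i $ j | _ \<Rightarrow> 0)"

definition induced_metric ::
    "('a, 'n::finite) kaehler_data \<Rightarrow> ('a, 'l) line_bundle_data \<Rightarrow> real set \<Rightarrow> real \<Rightarrow> (real \<Rightarrow> real)
       \<Rightarrow> ('a, 'n) chart \<Rightarrow> ('a, 'l) triv \<Rightarrow> complex^('n option) \<Rightarrow> complex^('n option)^('n option)" where
  "induced_metric M L I \<tau>0 \<phi> c T w =
     pullback_form (metric M c) w +
     2 *\<^sub>R iddbar (\<lambda>w'. of_real (profile_f I \<phi> \<tau>0 (log_norm L (chart_inv (bundle_chart L c T) w')))) w"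

definition induces_constant_scal ::
    "('a, 'n::finite) kaehler_data \<Rightarrow> ('a, 'l) line_bundle_data \<Rightarrow> real set \<Rightarrow> real \<Rightarrow> (real \<Rightarrow> real)
       \<Rightarrow> real \<Rightarrow> bool" where
  "induces_constant_scal M L I \<tau>0 \<phi> s \<longleftrightarrow>
     (\<forall>c\<in>atlas M. \<forall>T\<in>trivs L. \<forall>v\<in>over L (fst c \<inter> fst T) \<inter> induced_domain L I \<tau>0 \<phi>.
        scal (induced_metric M L I \<tau>0 \<phi> c T) (snd (bundle_chart L c T) v) = of_real s)"

section \<open>Consistency check: the multiset of eigenvalues\<close>

lemma poly_charpoly: "poly (charpoly E) a = det (mat a - E)"
  unfolding charpoly_def det_def
  by (auto simp: poly_sum poly_prod mat_def of_int_poly intro!: sum.cong prod.cong)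

lemma charpoly_nonzero: "charpoly E \<noteq> 0"
proof
  assume 0: "charpoly E = 0"
  have "continuous (at 0) (\<lambda>t::complex. det (mat 1 - (\<chi> i j. t * E $ i $ j)))"
    unfolding det_def vector_minus_component vec_lambda_beta by (intro continuous_intros)
  then have "((\<lambda>t. det (mat 1 - (\<chi> i j. t * E $ i $ j))) \<longlongrightarrow> det (mat 1 - (\<chi> i j. 0 * E $ i $ j))) (at 0)"
    by (simp add: isCont_def)
  moreover have "det (mat 1 - (\<chi> i j. t * E $ i $ j)) = 0" if "t \<noteq> 0" for t
  proof -
    have "mat 1 - (\<chi> i j. t * E $ i $ j) = (\<chi> i. t *s (mat (1 / t) - E) $ i)"
      using that by (auto simp: vec_eq_iff mat_def algebra_simps)
    then have "det (mat 1 - (\<chi> i j. t * E $ i $ j)) = (\<Prod>i\<in>(UNIV::'a set). t) * det (\<chi> i. (mat (1 / t) - E) $ i)"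
      using det_rows_mul[of "\<lambda>_. t" "\<lambda>i. (mat (1 / t) - E) $ i"] by simp
    also have "det (\<chi> i. (mat (1 / t) - E) $ i) = poly (charpoly E) (1 / t)"
      by (simp only: poly_charpoly vec_lambda_eta)
    finally show ?thesis by (simp add: 0)
  qed
  then have "((\<lambda>t. det (mat 1 - (\<chi> i j. t * E $ i $ j))) \<longlongrightarrow> 0) (at 0)"
    by (intro tendsto_eventually) (auto simp: eventually_at_filter)
  ultimately have "det (mat 1 - (\<chi> i j. 0 * E $ i $ j)) = 0"
    by (rule tendsto_unique[OF trivial_limit_at])
  moreover have "mat 1 - (\<chi> i j. 0 * E $ i $ j) = mat 1" by (simp add: vec_eq_iff)
  ultimately show False by simp
qed

lemma mem_eigenvalues_iff: "a \<in># eigenvalues E \<longleftrightarrow> (\<exists>v. v \<noteq> 0 \<and> E *v v = a *s v)"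
proof -
  have "a \<in># eigenvalues E \<longleftrightarrow> det (mat a - E) = 0"
    by (simp add: eigenvalues_def charpoly_nonzero poly_charpoly)
  also have "\<dots> \<longleftrightarrow> \<not> invertible (mat a - E)"
    by (simp add: invertible_det_nz)
  also have "\<dots> \<longleftrightarrow> (\<exists>v. v \<noteq> 0 \<and> (mat a - E) *v v = 0)"
    by (metis invertible_left_inverse matrix_left_invertible_ker)
  also have "\<dots> \<longleftrightarrow> (\<exists>v. v \<noteq> 0 \<and> E *v v = a *s v)"
  proof -
    have "mat a *v v = a *s v" for v :: "complex^'a"
      by (simp add: vec_eq_iff matrix_vector_mult_def mat_def if_distrib[of "\<lambda>x. x * _"] cong: if_cong)
    then show ?thesis
      by (metis eq_iff_diff_eq_0 matrix_vector_mult_diff_rdistrib)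
  qed
  finally show ?thesis .
qed

end

theory Submission
  imports Defs
begin

text \<open>
  With \<open>\<gamma>\<close> the curvature form and \<open>Q(\<tau>) = det (1 - \<tau> \<omega>\<^sub>M\<^sup>-\<^sup>1 \<gamma>)\<close>, the metric induced by a profile \<open>\<phi>\<close> has scalar
  curvature \<open>scal (g\<^sub>M(\<tau>)) - (Q \<phi>)'' / (2 Q)\<close>.  Subtracting this identity for the two profiles shows that
  at every point of the base \<open>Q\<close> solves \<open>(Q \<psi>)'' = 2 (c\<^sub>2 - c\<^sub>1) Q\<close>, where \<open>\<psi> = \<phi>\<^sub>1 - \<phi>\<^sub>2\<close>.  As \<open>\<psi>(0) = 0\<close> and \<open>Q(0) = 1\<close>,
  a comparison of leading coefficients at \<open>0\<close> shows that this equation has at most one polynomial solution,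
  so \<open>Q\<close> is the same at all points.  It determines the eigenvalues of \<open>\<omega>\<^sub>M\<^sup>-\<^sup>1 \<gamma>\<close>, and the first identity then
  determines \<open>scal (g\<^sub>M(\<tau>))\<close>.
\<close>

text \<open>In \<open>(Q \<psi>)'' = 2 C Q\<close> the function \<open>\<psi>\<close> is treated as
  a coefficient, because it is common to all base points while \<open>Q\<close> varies with the
  point. Read in this way the equation is singular at 0, where \<open>\<psi>\<close> vanishes, and
  \<open>\<psi>\<close> is merely smooth, so neither a Picard argument nor a power series of
  \<open>\<psi>\<close> is at hand. What replaces them is that the difference of two solutions is a
  polynomial: it has a definite finite order \<open>k\<close> at 0, and the normalisation
  \<open>Q(0) = 1\<close> makes \<open>k\<close> at least 1. The comparison of coefficients leaves
  the case where \<open>C = 0\<close> and \<open>\<psi>\<close> vanishes at 0 to higher, perhaps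
  infinite, order; it is excluded by reading the equation the other way round, as one for
  \<open>\<psi>\<close> with \<open>Q\<close> given. The curvature formula is computed in a frame
  that makes the metric block diagonal, so that only the diagonal blocks of the Ricci form matter.
  The induced metrics see only interior values of \<open>\<tau>\<close>; the scalar curvature at
  \<open>\<tau> = 0\<close> is reached by continuity.\<close>

no_notation fps_nth (infixl "$" 75)

section \<open>Differentiable functions of finite order\<close>

text \<open>Holds without differentiability: the two functions have the same derivatives at
  \<open>x\<close>, so the choice operator picks the same map even where none exists. This is what
  makes \<open>iddbar\<close> and \<open>scal\<close> local.\<close>

lemma frechet_derivative_cong_open:
  assumes "open S" "x \<in> S" "\<And>y. y \<in> S \<Longrightarrow> f y = g y"
  shows "frechet_derivative f (at x) = frechet_derivative g (at x)"
proof -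
  have "(f has_derivative D) (at x) \<longleftrightarrow> (g has_derivative D) (at x)" for D
    using assms by (metis has_derivative_transform_within_open)
  then show ?thesis by (simp add: frechet_derivative_def)
qed

lemma Ck_on_subset: "Ck_on k S f \<Longrightarrow> T \<subseteq> S \<Longrightarrow> Ck_on k T f"
  by (induction k arbitrary: f) (auto intro: continuous_on_subset)

lemma Ck_on_Suc_has_derivative:
  assumes "Ck_on (Suc k) S f" "x \<in> S"
  shows "(f has_derivative frechet_derivative f (at x)) (at x)"
  using assms by (simp add: frechet_derivative_works)

lemma Ck_on_cong:
  assumes "open S" "Ck_on k S f" "\<And>x. x \<in> S \<Longrightarrow> f x = g x"
  shows "Ck_on k S g"
  using assms(2,3)
proof (induction k arbitrary: f g)
  case 0
  then show ?case using continuous_on_cong by (metis Ck_on.simps(1))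
next
  case (Suc k)
  have eq: "frechet_derivative f (at x) = frechet_derivative g (at x)" if "x \<in> S" for x
    using frechet_derivative_cong_open[OF assms(1) that] Suc.prems(2) by blast
  have "g differentiable (at x)" if x: "x \<in> S" for x
    by (rule differentiableI, rule has_derivative_transform_within_open
        [OF Ck_on_Suc_has_derivative[OF Suc.prems(1) x] assms(1) x]) (simp add: Suc.prems(2))
  moreover have "Ck_on k S (\<lambda>x. frechet_derivative g (at x) v)" for v
    by (rule Suc.IH[of "\<lambda>x. frechet_derivative f (at x) v"]) (use Suc.prems(1) in \<open>auto simp: eq\<close>)
  ultimately show ?case by simp
qed

text \<open>The induction step behind the closure properties: since
  \<open>frechet_derivative\<close> is a choice term, an explicit family \<open>f'\<close> is
  differentiated instead and then transferred.\<close>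

lemma Ck_on_Suc_intro:
  assumes "open S" "\<And>x. x \<in> S \<Longrightarrow> (f has_derivative f' x) (at x)"
    and "\<And>v. Ck_on k S (\<lambda>x. f' x v)"
  shows "Ck_on (Suc k) S f"
proof -
  have "Ck_on k S (\<lambda>x. frechet_derivative f (at x) v)" for v
    by (rule Ck_on_cong[OF assms(1) assms(3)[of v]]) (metis assms(2) frechet_derivative_at)
  then show ?thesis using assms(2) by (auto intro: differentiableI)
qed

lemma Ck_on_SucD: "Ck_on (Suc k) S f \<Longrightarrow> Ck_on k S f"
proof (induction k arbitrary: f)
  case 0
  then show ?case
    by (auto intro!: differentiable_imp_continuous_on intro: differentiable_at_imp_differentiable_on)
qed auto

lemma Ck_on_mono: "Ck_on m S f \<Longrightarrow> k \<le> m \<Longrightarrow> Ck_on k S f"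
proof (induction m)
  case (Suc m)
  then show ?case using Ck_on_SucD le_Suc_eq by blast
qed simp

lemma Ck_on_continuous_on: "Ck_on k S f \<Longrightarrow> continuous_on S f"
  using Ck_on_mono[of k S f 0] by simp

lemma Ck_on_const [simp]: "Ck_on k S (\<lambda>x. c)"
  by (induction k arbitrary: c) auto

lemma Ck_on_bounded_linear: "bounded_linear f \<Longrightarrow> Ck_on k S f"
proof (cases k)
  case 0
  assume "bounded_linear f" then show ?thesis by (simp add: 0 bounded_linear.linear linear_continuous_on)
next
  case (Suc m)
  assume f: "bounded_linear f"
  then have "frechet_derivative f (at x) = f" for x
    using bounded_linear_imp_has_derivative frechet_derivative_at by metis
  then show ?thesis using f by (simp add: Suc bounded_linear_imp_differentiable)
qed

lemma Ck_on_linear_compose: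
  assumes "open S" "bounded_linear h" "Ck_on k S f"
  shows "Ck_on k S (\<lambda>x. h (f x))"
  using assms(3)
proof (induction k arbitrary: f)
  case 0
  then show ?case by (simp add: bounded_linear.continuous_on[OF assms(2)])
next
  case (Suc k)
  show ?case
  proof (rule Ck_on_Suc_intro[OF assms(1)])
    show "((\<lambda>x. h (f x)) has_derivative (\<lambda>v. h (frechet_derivative f (at x) v))) (at x)" if "x \<in> S" for x
      using bounded_linear.has_derivative[OF assms(2) Ck_on_Suc_has_derivative[OF Suc.prems that]] .
  qed (use Suc in auto)
qed

lemma Ck_on_add:
  assumes "open S" "Ck_on k S f" "Ck_on k S g"
  shows "Ck_on k S (\<lambda>x. f x + g x)"
  using assms(2,3)
proof (induction k arbitrary: f g)
  case (Suc k)
  show ?case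
  proof (rule Ck_on_Suc_intro[OF assms(1)])
    show "((\<lambda>x. f x + g x) has_derivative
        (\<lambda>v. frechet_derivative f (at x) v + frechet_derivative g (at x) v)) (at x)" if "x \<in> S" for x
      using Suc.prems[THEN Ck_on_Suc_has_derivative, OF that] by (rule has_derivative_add)
  qed (use Suc in auto)
qed (simp add: continuous_on_add)

lemma Ck_on_bilinear:
  assumes "open S" "bounded_bilinear pr" "Ck_on k S f" "Ck_on k S g"
  shows "Ck_on k S (\<lambda>x. pr (f x) (g x))"
  using assms(3,4)
proof (induction k arbitrary: f g)
  case 0
  then show ?case by (simp add: bounded_bilinear.continuous_on[OF assms(2)])
next
  case (Suc k)
  note S = Suc.prems[THEN Ck_on_SucD]
  show ?case
  proof (rule Ck_on_Suc_intro[OF assms(1)])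
    show "((\<lambda>x. pr (f x) (g x)) has_derivative (\<lambda>v. pr (f x) (frechet_derivative g (at x) v)
        + pr (frechet_derivative f (at x) v) (g x))) (at x)" if "x \<in> S" for x
      using bounded_bilinear.FDERIV[OF assms(2) Suc.prems[THEN Ck_on_Suc_has_derivative, OF that]] .
  qed (use Suc.prems S in \<open>auto intro!: Ck_on_add[OF assms(1)] Suc.IH\<close>)
qed

lemma Ck_on_mult:
  fixes f g :: "'a::real_normed_vector \<Rightarrow> 'b::real_normed_algebra"
  shows "open S \<Longrightarrow> Ck_on k S f \<Longrightarrow> Ck_on k S g \<Longrightarrow> Ck_on k S (\<lambda>x. f x * g x)"
  by (rule Ck_on_bilinear[OF _ bounded_bilinear_mult])

lemma Ck_on_minus: "open S \<Longrightarrow> Ck_on k S f \<Longrightarrow> Ck_on k S (\<lambda>x. - f x)"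
  by (rule Ck_on_linear_compose[OF _ bounded_linear_minus[OF bounded_linear_ident]])

lemma Ck_on_diff: "open S \<Longrightarrow> Ck_on k S f \<Longrightarrow> Ck_on k S g \<Longrightarrow> Ck_on k S (\<lambda>x. f x - g x)"
  using Ck_on_add[of S k f "\<lambda>x. - g x"] Ck_on_minus by auto

lemma Ck_on_sum:
  assumes "open S" "\<And>i. i \<in> A \<Longrightarrow> Ck_on k S (\<lambda>x. f i x)"
  shows "Ck_on k S (\<lambda>x. \<Sum>i\<in>A. f i x)"
  using assms(2) by (induction A rule: infinite_finite_induct) (auto intro!: Ck_on_add[OF assms(1)])

lemma Ck_on_prod:
  fixes f :: "_ \<Rightarrow> 'a::real_normed_vector \<Rightarrow> 'b::{real_normed_algebra,comm_ring_1}"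
  assumes "open S" "\<And>i. i \<in> A \<Longrightarrow> Ck_on k S (\<lambda>x. f i x)"
  shows "Ck_on k S (\<lambda>x. \<Prod>i\<in>A. f i x)"
  using assms(2) by (induction A rule: infinite_finite_induct) (auto intro!: Ck_on_mult[OF assms(1)])

lemma Ck_on_Pair:
  assumes "open S" "Ck_on k S f" "Ck_on k S g"
  shows "Ck_on k S (\<lambda>x. (f x, g x))"
proof -
  have "Ck_on k S (\<lambda>x. (f x, 0) + (0, g x))"
    using assms by (intro Ck_on_add Ck_on_linear_compose[of S "\<lambda>a. (a, 0)"] Ck_on_linear_compose[of S "\<lambda>a. (0, a)"]
      bounded_linear_Pair bounded_linear_ident bounded_linear_zero)
  then show ?thesis by simp
qed

lemma Ck_on_det:
  fixes A :: "'a::real_normed_vector \<Rightarrow> 'b::{real_normed_field}^'n::finite^'n"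
  assumes "open S" "\<And>i j. Ck_on k S (\<lambda>x. A x $ i $ j)"
  shows "Ck_on k S (\<lambda>x. det (A x))"
  unfolding det_def using assms by (intro Ck_on_sum Ck_on_mult Ck_on_prod Ck_on_const) auto

lemma Ck_on_inverse:
  fixes f :: "'a::real_normed_vector \<Rightarrow> 'b::real_normed_field"
  assumes "open S" "Ck_on k S f" "\<And>x. x \<in> S \<Longrightarrow> f x \<noteq> 0"
  shows "Ck_on k S (\<lambda>x. inverse (f x))"
  using assms(2)
proof (induction k)
  case 0
  then show ?case using assms(3) by (auto intro: continuous_on_inverse)
next
  case (Suc k)
  note S = Suc.IH[OF Suc.prems[THEN Ck_on_SucD]]
  show ?case
  proof (rule Ck_on_Suc_intro[OF assms(1)])
    show "((\<lambda>x. inverse (f x)) has_derivative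
        (\<lambda>v. - (inverse (f x) * frechet_derivative f (at x) v * inverse (f x)))) (at x)" if "x \<in> S" for x
      using Deriv.has_derivative_inverse[OF assms(3)[OF that] Ck_on_Suc_has_derivative[OF Suc.prems that]] .
  qed (use S Suc.prems in \<open>auto intro!: Ck_on_minus[OF assms(1)] Ck_on_mult[OF assms(1)]\<close>)
qed

text \<open>\<open>L\<close> is kept abstract so that one statement serves both the real
  \<open>ln\<close> of positive functions and the principal complex \<open>ln\<close> off the
  nonpositive real axis.\<close>

lemma Ck_on_logarithm:
  fixes f :: "'a::real_normed_vector \<Rightarrow> 'b::real_normed_field"
  assumes "open S" "Ck_on k S f" "\<And>x. x \<in> S \<Longrightarrow> f x \<noteq> 0"
    and "\<And>x. x \<in> S \<Longrightarrow> (L has_field_derivative inverse (f x)) (at (f x))"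
  shows "Ck_on k S (\<lambda>x. L (f x))"
proof (cases k)
  case 0
  then show ?thesis
    using assms(2) isCont_o2[OF _ DERIV_isCont, of _ f L, OF _ assms(4)]
    by (simp add: continuous_on_eq_continuous_at[OF assms(1)])
next
  case (Suc m)
  note f = assms(2)[unfolded Suc]
  show ?thesis unfolding Suc
  proof (rule Ck_on_Suc_intro[OF assms(1)])
    show "((\<lambda>x. L (f x)) has_derivative (\<lambda>v. inverse (f x) * frechet_derivative f (at x) v)) (at x)"
      if "x \<in> S" for x
      using has_derivative_compose[OF Ck_on_Suc_has_derivative[OF f that]
          assms(4)[OF that, unfolded has_field_derivative_def]] .
  qed (use f in \<open>auto intro!: Ck_on_mult[OF assms(1)] Ck_on_inverse[OF assms(1) Ck_on_SucD[OF f] assms(3)]\<close>)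
qed

lemma linear_basis_expansion:
  fixes F' :: "'b::euclidean_space \<Rightarrow> 'c::real_normed_vector"
  assumes "linear F'"
  shows "(\<Sum>e\<in>Basis. (y \<bullet> e) *\<^sub>R F' e) = F' y"
  using linear_sum[OF assms, of "\<lambda>e. (y \<bullet> e) *\<^sub>R e" Basis]
  by (simp add: euclidean_representation linear_scale[OF assms])

text \<open>The chain rule in a form that \<open>Ck_on\<close> can iterate: \<open>Ck_on\<close>
  speaks of derivatives of \<open>F\<close> in fixed directions, whereas the direction
  \<open>f' v\<close> moves with the point, so it is expanded in \<open>Basis\<close>.\<close>

lemma has_derivative_compose_basis:
  fixes f :: "'a::real_normed_vector \<Rightarrow> 'b::euclidean_space"
  assumes "(f has_derivative f') (at x)" "(F has_derivative F') (at (f x))"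
  shows "((\<lambda>x. F (f x)) has_derivative (\<lambda>v. \<Sum>e\<in>Basis. (f' v \<bullet> e) *\<^sub>R F' e)) (at x)"
  using has_derivative_compose[OF assms]
  by (simp only: linear_basis_expansion[OF has_derivative_linear[OF assms(2)]])

lemma Ck_on_compose:
  fixes f :: "'a::real_normed_vector \<Rightarrow> 'b::euclidean_space"
  assumes "open S" "f ` S \<subseteq> T" "Ck_on k S f" "Ck_on k T F"
  shows "Ck_on k S (\<lambda>x. F (f x))"
  using assms(3,4)
proof (induction k arbitrary: F)
  case 0
  then show ?case using continuous_on_compose2[of T F S f] assms(2) by auto
next
  case (Suc k)
  show ?case
  proof (rule Ck_on_Suc_intro[OF assms(1)])
    fix x assume x: "x \<in> S"
    show "((\<lambda>x. F (f x)) has_derivative (\<lambda>v. \<Sum>e\<in>Basis.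
        (frechet_derivative f (at x) v \<bullet> e) *\<^sub>R frechet_derivative F (at (f x)) e)) (at x)"
      using x assms(2) Suc.prems by (intro has_derivative_compose_basis Ck_on_Suc_has_derivative) auto
  next
    fix v
    have F: "Ck_on k S (\<lambda>x. frechet_derivative F (at (f x)) e)" for e
      by (rule Suc.IH[of "\<lambda>y. frechet_derivative F (at y) e"])
        (use Suc.prems in \<open>auto intro: Ck_on_SucD\<close>)
    show "Ck_on k S (\<lambda>x. \<Sum>e\<in>Basis.
        (frechet_derivative f (at x) v \<bullet> e) *\<^sub>R frechet_derivative F (at (f x)) e)"
      using Suc.prems
      by (intro Ck_on_sum Ck_on_bilinear[OF assms(1) bounded_bilinear_scaleR] F assms(1)
          Ck_on_linear_compose[OF assms(1) bounded_linear_inner_left]) auto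
  qed
qed

section \<open>Second derivatives and their chain rule\<close>

definition hess2 :: "('a::real_normed_vector \<Rightarrow> 'b::real_normed_vector) \<Rightarrow> 'a \<Rightarrow> 'a \<Rightarrow> 'a \<Rightarrow> 'b" where
  "hess2 f x a b = frechet_derivative (\<lambda>y. frechet_derivative f (at y) b) (at x) a"

lemma hess2_eqI:
  assumes "open S" "x \<in> S" "\<And>y. y \<in> S \<Longrightarrow> (f has_derivative f' y) (at y)"
    and "((\<lambda>y. f' y b) has_derivative D) (at x)"
  shows "hess2 f x a b = D a"
proof -
  have "frechet_derivative f (at y) = f' y" if "y \<in> S" for y
    using assms(3)[OF that] frechet_derivative_at by metis
  then have "((\<lambda>y. frechet_derivative f (at y) b) has_derivative D) (at x)"
    by (intro has_derivative_transform_within_open[OF assms(4,1,2)]) simp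
  from frechet_derivative_at[OF this] show ?thesis by (simp add: hess2_def)
qed

lemma Ck_on_hess2_has_derivative:
  assumes "Ck_on (Suc (Suc k)) S f" "x \<in> S"
  shows "((\<lambda>y. frechet_derivative f (at y) b) has_derivative (\<lambda>a. hess2 f x a b)) (at x)"
  unfolding hess2_def using assms by (intro Ck_on_Suc_has_derivative[of k S]) auto

lemma linear_hess2_left:
  assumes "Ck_on (Suc (Suc k)) S f" "x \<in> S"
  shows "linear (\<lambda>a. hess2 f x a b)"
  using Ck_on_hess2_has_derivative[OF assms] has_derivative_linear by blast

lemma linear_hess2_right:
  assumes "open S" "Ck_on (Suc (Suc k)) S f" "x \<in> S"
  shows "linear (hess2 f x a)"
proof -
  note D = Ck_on_hess2_has_derivative[OF assms(2,3)]
  have d: "(f has_derivative frechet_derivative f (at y)) (at y)" if "y \<in> S" for y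
    using assms that by (intro Ck_on_Suc_has_derivative)
  have lin: "linear (frechet_derivative f (at y))" if "y \<in> S" for y
    using d[OF that] by (rule has_derivative_linear)
  show ?thesis
  proof (rule linearI)
    fix b c
    have "((\<lambda>y. frechet_derivative f (at y) (b + c)) has_derivative (\<lambda>a. hess2 f x a b + hess2 f x a c)) (at x)"
      by (rule has_derivative_transform_within_open[OF has_derivative_add[OF D[of b] D[of c]] assms(1,3)])
        (simp add: linear_add[OF lin])
    then show "hess2 f x a (b + c) = hess2 f x a b + hess2 f x a c"
      using hess2_eqI[OF assms(1,3) d] by metis
  next
    fix r :: real and b
    have "((\<lambda>y. frechet_derivative f (at y) (r *\<^sub>R b)) has_derivative (\<lambda>a. r *\<^sub>R hess2 f x a b)) (at x)"
      by (rule has_derivative_transform_within_open[OF has_derivative_scaleR_right[OF D[of b]] assms(1,3)])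
        (simp add: linear_scale[OF lin])
    then show "hess2 f x a (r *\<^sub>R b) = r *\<^sub>R hess2 f x a b"
      using hess2_eqI[OF assms(1,3) d] by metis
  qed
qed

lemma hess2_compose:
  fixes f :: "'a::real_normed_vector \<Rightarrow> 'b::euclidean_space"
  assumes "open S" "f ` S \<subseteq> T" "open T" "Ck_on 2 S f" "Ck_on 2 T F" "x \<in> S"
  shows "hess2 (\<lambda>x. F (f x)) x a b =
     hess2 F (f x) (frechet_derivative f (at x) a) (frechet_derivative f (at x) b)
     + frechet_derivative F (at (f x)) (hess2 f x a b)"
proof -
  have f: "Ck_on (Suc (Suc 0)) S f" and F: "Ck_on (Suc (Suc 0)) T F" and fx: "f x \<in> T"
    using assms by (auto simp: numeral_2_eq_2)
  have d: "((\<lambda>x. F (f x)) has_derivative (\<lambda>v. \<Sum>e\<in>Basis.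
        (frechet_derivative f (at y) v \<bullet> e) *\<^sub>R frechet_derivative F (at (f y)) e)) (at y)" if "y \<in> S" for y
    using that assms(2) by (intro has_derivative_compose_basis Ck_on_Suc_has_derivative[OF f]
        Ck_on_Suc_has_derivative[OF F]) auto
  have df: "(f has_derivative frechet_derivative f (at x)) (at x)"
    using Ck_on_Suc_has_derivative[OF f] assms by blast
  have FD: "((\<lambda>y. frechet_derivative F (at (f y)) e) has_derivative
     (\<lambda>a. hess2 F (f x) (frechet_derivative f (at x) a) e)) (at x)" for e
    using has_derivative_compose[OF df Ck_on_hess2_has_derivative[OF F fx]] .
  have "((\<lambda>y. \<Sum>e\<in>Basis. (frechet_derivative f (at y) b \<bullet> e) *\<^sub>R frechet_derivative F (at (f y)) e)
     has_derivative (\<lambda>a. \<Sum>e\<in>Basis. (frechet_derivative f (at x) b \<bullet> e) *\<^sub>R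
            hess2 F (f x) (frechet_derivative f (at x) a) e
       + (hess2 f x a b \<bullet> e) *\<^sub>R frechet_derivative F (at (f x)) e)) (at x)"
    by (intro has_derivative_sum has_derivative_scaleR FD
        has_derivative_inner_left Ck_on_hess2_has_derivative[OF f assms(6)])
  from hess2_eqI[OF assms(1,6) d this]
  have "hess2 (\<lambda>x. F (f x)) x a b = (\<Sum>e\<in>Basis. (frechet_derivative f (at x) b \<bullet> e) *\<^sub>R
            hess2 F (f x) (frechet_derivative f (at x) a) e)
       + (\<Sum>e\<in>Basis. (hess2 f x a b \<bullet> e) *\<^sub>R frechet_derivative F (at (f x)) e)"
    by (simp add: sum.distrib)
  also have "\<dots> = hess2 F (f x) (frechet_derivative f (at x) a) (frechet_derivative f (at x) b)
     + frechet_derivative F (at (f x)) (hess2 f x a b)"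
    by (simp only: linear_basis_expansion[OF linear_hess2_right[OF assms(3) F fx]]
        linear_basis_expansion[OF has_derivative_linear[OF Ck_on_Suc_has_derivative[OF F fx]]])
  finally show ?thesis .
qed

section \<open>Block matrices and the complex Hessian\<close>

lemma sum_UNIV_option:
  fixes f :: "'n::finite option \<Rightarrow> 'b::comm_monoid_add"
  shows "sum f UNIV = f None + (\<Sum>i\<in>UNIV. f (Some i))"
  by (simp add: UNIV_option_conv sum.reindex)

lemma prod_UNIV_option:
  fixes f :: "'n::finite option \<Rightarrow> 'b::comm_monoid_mult"
  shows "prod f UNIV = f None * (\<Prod>i\<in>UNIV. f (Some i))"
  by (simp add: UNIV_option_conv prod.reindex)

lemma map_option_permutes:
  assumes "p permutes UNIV"
  shows "map_option p permutes UNIV"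
proof (rule bij_imp_permutes[OF o_bij])
  show "map_option (inv p) \<circ> map_option p = id" "map_option p \<circ> map_option (inv p) = id"
    using permutes_inv_o[OF assms] by (simp_all flip: option.map_comp add: option.map_id0 map_option.compositionality fun_eq_iff option.map_ident o_def)
qed auto

lemma sign_map_option:
  fixes p :: "'n::finite \<Rightarrow> 'n"
  assumes "p permutes UNIV"
  shows "sign (map_option p) = sign p"
  using assms finite
proof (induction p rule: permutes_induct)
  case id
  then show ?case by (simp add: option.map_id0 del: id_apply)
next
  case (swap a b p)
  have tr: "map_option (Transposition.transpose a b) = Transposition.transpose (Some a) (Some b)"
    by (auto simp: fun_eq_iff Transposition.transpose_def map_option_case split: option.split)
  have "permutation p" "permutation (map_option p)"
    using swap.hyps(4) map_option_permutes[OF swap.hyps(4)] permutation_permutes by (metis finite)+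
  moreover have "map_option (Transposition.transpose a b \<circ> p) = Transposition.transpose (Some a) (Some b) \<circ> map_option p"
    by (simp add: tr[symmetric] fun_eq_iff option.map_comp)
  ultimately show ?case
    using swap by (simp add: sign_compose permutation_swap_id sign_swap_id del: o_apply comp_apply)
qed

text \<open>In the Leibniz sum every permutation moving \<open>None\<close> meets a zero entry of
  the first row; those fixing \<open>None\<close> are exactly the \<open>map_option q\<close>, with
  the sign of \<open>q\<close>.\<close>

lemma det_block_triangular:
  fixes A :: "'a::comm_ring_1^('n::finite option)^('n option)"
  assumes "\<And>j. A $ None $ Some j = 0"
  shows "det A = A $ None $ None * det (\<chi> i j. A $ Some i $ Some j)"
proof -
  let ?P = "{p. p permutes (UNIV :: 'n option set)}" and ?Q = "{p. p permutes (UNIV :: 'n set)}"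
  let ?t = "\<lambda>p. of_int (sign p) * (\<Prod>i\<in>UNIV. A $ i $ p i)"
  have "sum ?t ?P = sum ?t (map_option ` ?Q)"
  proof (rule sum.mono_neutral_right)
    show "finite ?P" by (simp add: finite_permutations)
    show "map_option ` ?Q \<subseteq> ?P"
      by (auto intro: map_option_permutes)
    show "\<forall>p\<in>?P - map_option ` ?Q. ?t p = 0"
    proof
      fix p assume p: "p \<in> ?P - map_option ` ?Q"
      have "p None \<noteq> None"
      proof
        assume n: "p None = None"
        have pp: "p permutes UNIV" using p by blast
        have "\<forall>i. \<exists>j. p (Some i) = Some j"
          using n permutes_inj[OF pp] by (metis injD option.exhaust option.distinct(1))
        then obtain q where q: "p (Some i) = Some (q i)" for i by metis
        then have "p = map_option q" using n by (auto simp: fun_eq_iff map_option_case split: option.split)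
        moreover have "q permutes UNIV"
        proof (rule bij_imp_permutes)
          have "inj q" using q permutes_inj[OF pp] by (metis injD injI option.inject)
          then show "bij_betw q UNIV UNIV" by (simp add: bij_def endo_inj_surj)
        qed auto
        ultimately show False using p by blast
      qed
      then obtain j where "p None = Some j" by auto
      then show "?t p = 0" using assms by (simp add: prod_UNIV_option)
    qed
  qed
  also have "\<dots> = (\<Sum>q\<in>?Q. ?t (map_option q))"
    by (rule sum.reindex_cong[of map_option]) (auto simp: inj_on_def fun_eq_iff dest: spec[of _ "Some _"])
  also have "\<dots> = (\<Sum>q\<in>?Q. A $ None $ None * (of_int (sign q) * (\<Prod>i\<in>UNIV. A $ Some i $ Some (q i))))"
    by (intro sum.cong) (auto simp: sign_map_option prod_UNIV_option)
  finally show ?thesis by (simp add: det_def sum_distrib_left)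
qed

section \<open>Congruence, traces and determinants of Hermitian matrices\<close>

definition adjoint_mat :: "complex^'n^'m \<Rightarrow> complex^'m^'n" where
  "adjoint_mat A = (\<chi> i j. cnj (A $ j $ i))"

lemma cnj_det: "cnj (det (A :: complex^'n::finite^'n)) = det (\<chi> i j. cnj (A $ i $ j))"
  by (simp add: det_def)

lemma det_adjoint_mat: "det (adjoint_mat A) = cnj (det (A :: complex^'n::finite^'n))"
proof -
  have "adjoint_mat A = transpose (\<chi> i j. cnj (A $ i $ j))"
    by (simp add: adjoint_mat_def transpose_def)
  then show ?thesis by (simp add: cnj_det)
qed

lemma matrix_mult_adjoint_component:
  fixes R :: "complex^'n::finite^'n" and K :: "complex^'n^'m::finite"
  shows "(K ** R ** adjoint_mat K) $ A $ B = (\<Sum>i\<in>UNIV. \<Sum>j\<in>UNIV. K $ A $ i * cnj (K $ B $ j) * R $ i $ j)"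
  unfolding matrix_matrix_mult_def adjoint_mat_def
  by (simp add: sum_distrib_right sum_distrib_left mult_ac) (rule sum.swap)

lemma matrix_inv_inverse:
  assumes "invertible A"
  shows "A ** matrix_inv A = mat 1" "matrix_inv A ** A = mat 1"
  using someI_ex[OF assms[unfolded invertible_def]] by (simp_all add: matrix_inv_def)

lemma matrix_inv_eqI:
  fixes A :: "'a::field^'n::finite^'n"
  assumes "A ** B = mat 1"
  shows "matrix_inv A = B"
proof -
  have "invertible A" using assms invertible_right_inverse by blast
  then show ?thesis using assms matrix_inv_inverse
    by (metis matrix_mul_assoc matrix_mul_lid matrix_mul_rid)
qed

lemma matrix_inv_mult:
  fixes A B :: "'a::field^'n::finite^'n"
  assumes "invertible A" "invertible B"
  shows "matrix_inv (A ** B) = matrix_inv B ** matrix_inv A"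
  by (rule matrix_inv_eqI) (metis assms matrix_inv_inverse matrix_mul_assoc matrix_mul_rid)

lemma trace_transpose: "trace (transpose A) = trace (A :: 'a::semiring_1^'k^'k)"
  by (simp add: trace_def transpose_def)

text \<open>Allows scalar curvature to be computed in a frame that is not a coordinate frame: Ricci
  form and metric undergo the same congruence.\<close>

lemma trace_congruence:
  fixes R G K K' :: "'a::field^'n::finite^'n"
  assumes "invertible G" "invertible K" "invertible K'"
  shows "trace (R ** matrix_inv G) = trace ((K ** R ** K') ** matrix_inv (K ** G ** K'))"
proof -
  have "(K ** R ** K') ** matrix_inv (K ** G ** K') = K ** (R ** matrix_inv G ** matrix_inv K)"
    using assms by (simp add: matrix_inv_mult invertible_mult)
      (metis matrix_inv_inverse matrix_mul_assoc matrix_mul_rid)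
  also have "trace \<dots> = trace (R ** matrix_inv G ** matrix_inv K ** K)"
    by (rule trace_mul_sym)
  also have "R ** matrix_inv G ** matrix_inv K ** K = R ** matrix_inv G"
    using assms by (metis matrix_inv_inverse matrix_mul_assoc matrix_mul_rid)
  finally show ?thesis by simp
qed

definition block_diag :: "'a::zero \<Rightarrow> 'a^'n^'n \<Rightarrow> 'a^('n option)^('n option)" where
  "block_diag a N = (\<chi> A B. case (A, B) of (None, None) \<Rightarrow> a | (Some i, Some j) \<Rightarrow> N $ i $ j | _ \<Rightarrow> 0)"

lemma block_diag_component [simp]:
  "block_diag a N $ None $ None = a" "block_diag a N $ Some i $ Some j = N $ i $ j"
  "block_diag a N $ None $ Some j = 0" "block_diag a N $ Some i $ None = 0"
  by (simp_all add: block_diag_def)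

lemma det_block_diag: "det (block_diag a N) = a * det (N :: 'a::comm_ring_1^'n::finite^'n)"
  by (simp add: det_block_triangular)

text \<open>Only the diagonal blocks of \<open>R\<close> enter, so the mixed fibre-base components
  of the Ricci form never have to be computed.\<close>

lemma trace_mult_block_diag:
  fixes N :: "'a::field^'n::finite^'n"
  assumes "a \<noteq> 0" "invertible N"
  shows "trace (R ** matrix_inv (block_diag a N)) =
     R $ None $ None / a + trace ((\<chi> i j. R $ Some i $ Some j) ** matrix_inv N)"
proof -
  have eq: "matrix_inv (block_diag a N) = block_diag (inverse a) (matrix_inv N)"
  proof (rule matrix_inv_eqI)
    have *: "block_diag b B ** block_diag c C = block_diag (b * c) (B ** C)" for b c and B C :: "'a^'n^'n"
      by (auto simp: vec_eq_iff matrix_matrix_mult_def sum_UNIV_option block_diag_def split: option.split)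
    have **: "block_diag 1 (mat 1) = (mat 1 :: 'a^('n option)^('n option))"
      by (auto simp: vec_eq_iff mat_def block_diag_def split: option.split)
    show "block_diag a N ** block_diag (inverse a) (matrix_inv N) = mat 1"
      using assms by (simp add: * ** matrix_inv_inverse)
  qed
  show ?thesis
    unfolding eq by (simp add: trace_def matrix_matrix_mult_def sum_UNIV_option divide_inverse)
qed

lemma hermitian_posD:
  fixes G :: "complex^'n::finite^'n"
  assumes "hermitian_pos G"
  shows "cnj (G $ j $ i) = G $ i $ j"
    and "v \<noteq> 0 \<Longrightarrow> 0 < Re (\<Sum>i\<in>UNIV. \<Sum>j\<in>UNIV. G $ i $ j * v $ i * cnj (v $ j))"
proof -
  have 1: "\<forall>i j. G $ i $ j = cnj (G $ j $ i)"
    and 2: "\<forall>v. v \<noteq> 0 \<longrightarrow> 0 < Re (\<Sum>i\<in>UNIV. \<Sum>j\<in>UNIV. G $ i $ j * v $ i * cnj (v $ j))"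
    using assms unfolding hermitian_pos_def by (rule conjunct1, rule conjunct2)
  from 1 show "cnj (G $ j $ i) = G $ i $ j" by metis
  from 2 show "v \<noteq> 0 \<Longrightarrow> 0 < Re (\<Sum>i\<in>UNIV. \<Sum>j\<in>UNIV. G $ i $ j * v $ i * cnj (v $ j))" by blast
qed

text \<open>The Hermitian form pairs \<open>v\<close> with the first index of \<open>G\<close>; it
  would therefore vanish on a kernel vector of the transpose.\<close>

lemma hermitian_pos_invertible:
  fixes G :: "complex^'n::finite^'n"
  assumes "hermitian_pos G"
  shows "invertible G"
proof -
  have "v = 0" if "transpose G *v v = 0" for v
  proof (rule ccontr)
    assume "v \<noteq> 0"
    then have "0 < Re (\<Sum>i\<in>UNIV. \<Sum>j\<in>UNIV. G $ i $ j * v $ i * cnj (v $ j))"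
      by (rule hermitian_posD(2)[OF assms])
    also have "(\<Sum>i\<in>UNIV. \<Sum>j\<in>UNIV. G $ i $ j * v $ i * cnj (v $ j))
        = (\<Sum>j\<in>UNIV. cnj (v $ j) * (transpose G *v v) $ j)"
      by (subst sum.swap) (simp add: matrix_vector_mult_def transpose_def sum_distrib_left mult_ac)
    finally show False using that by simp
  qed
  then have "invertible (transpose G)"
    using matrix_left_invertible_ker invertible_left_inverse by blast
  then show ?thesis by (simp add: invertible_det_nz)
qed

text \<open>Reality follows from \<open>G\<close> being its own adjoint. For the sign, the segment
  \<open>H\<close> from the identity to \<open>G\<close> stays positive definite, so the determinant
  cannot vanish on its way from 1. Positivity keeps determinants away from the branch cut of the
  complex \<open>ln\<close> in \<open>ricci_form\<close>.\<close>

lemma det_hermitian_pos: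
  fixes G :: "complex^'n::finite^'n"
  assumes "hermitian_pos G"
  shows "det G \<in> \<real>" "0 < Re (det G)"
proof -
  have herm: "det A \<in> \<real>" if "\<And>i j. A $ i $ j = cnj (A $ j $ i)" for A :: "complex^'n^'n"
  proof -
    have "adjoint_mat A = A" by (simp add: adjoint_mat_def vec_eq_iff that[symmetric])
    then show ?thesis by (metis det_adjoint_mat Reals_cnj_iff)
  qed
  show "det G \<in> \<real>" by (rule herm) (simp add: hermitian_posD(1)[OF assms])
  define H :: "real \<Rightarrow> complex^'n^'n" where "H s = (\<chi> i j. of_real s * G $ i $ j + of_real (1 - s) * mat 1 $ i $ j)" for s
  have pos: "hermitian_pos (H s)" if s: "s \<in> {0..1}" for s
    unfolding hermitian_pos_def
  proof (intro conjI allI impI)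
    fix i j
    show "H s $ i $ j = cnj (H s $ j $ i)" by (simp add: H_def mat_def hermitian_posD(1)[OF assms])
  next
    fix v :: "complex^'n" assume v: "v \<noteq> 0"
    have 1: "(\<Sum>i\<in>UNIV. \<Sum>j\<in>UNIV. mat 1 $ i $ j * v $ i * cnj (v $ j)) = (\<Sum>i\<in>UNIV. v $ i * cnj (v $ i))"
      by (simp add: mat_def if_distrib[of "\<lambda>x. x * _"] cong: if_cong)
    have "0 < (\<Sum>i\<in>UNIV. (cmod (v $ i))\<^sup>2)"
    proof -
      obtain k where "v $ k \<noteq> 0" using v by (auto simp: vec_eq_iff)
      then show ?thesis by (intro sum_pos2[of _ k]) auto
    qed
    then have b: "0 < Re (\<Sum>i\<in>UNIV. \<Sum>j\<in>UNIV. mat 1 $ i $ j * v $ i * cnj (v $ j))"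
      unfolding 1 by (simp add: complex_norm_square[symmetric] Re_sum del: of_real_power)
    have a: "0 < Re (\<Sum>i\<in>UNIV. \<Sum>j\<in>UNIV. G $ i $ j * v $ i * cnj (v $ j))"
      by (rule hermitian_posD(2)[OF assms v])
    have "(\<Sum>i\<in>UNIV. \<Sum>j\<in>UNIV. H s $ i $ j * v $ i * cnj (v $ j)) =
       of_real s * (\<Sum>i\<in>UNIV. \<Sum>j\<in>UNIV. G $ i $ j * v $ i * cnj (v $ j))
       + of_real (1 - s) * (\<Sum>i\<in>UNIV. \<Sum>j\<in>UNIV. mat 1 $ i $ j * v $ i * cnj (v $ j))"
      by (simp add: H_def sum_distrib_left sum.distrib[symmetric] algebra_simps del: of_real_diff)
    then have "Re (\<Sum>i\<in>UNIV. \<Sum>j\<in>UNIV. H s $ i $ j * v $ i * cnj (v $ j)) =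
       s * Re (\<Sum>i\<in>UNIV. \<Sum>j\<in>UNIV. G $ i $ j * v $ i * cnj (v $ j))
       + (1 - s) * Re (\<Sum>i\<in>UNIV. \<Sum>j\<in>UNIV. mat 1 $ i $ j * v $ i * cnj (v $ j))"
      by (simp only: plus_complex.simps times_complex.simps Re_complex_of_real Im_complex_of_real mult_zero_left diff_zero)
    also have "\<dots> > 0"
    proof (cases "s = 0")
      case False then show ?thesis using s a b by (intro add_pos_nonneg mult_pos_pos mult_nonneg_nonneg) auto
    qed (use b in simp)
    finally show "0 < Re (\<Sum>i\<in>UNIV. \<Sum>j\<in>UNIV. H s $ i $ j * v $ i * cnj (v $ j))" .
  qed
  have ne: "Re (det (H s)) \<noteq> 0" if "s \<in> {0..1}" for s
  proof -
    have "det (H s) \<noteq> 0" using hermitian_pos_invertible[OF pos[OF that]] invertible_det_nz by blast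
    moreover have "det (H s) \<in> \<real>" by (rule herm) (simp add: hermitian_posD(1)[OF pos[OF that]])
    ultimately show ?thesis by (auto simp: complex_is_Real_iff complex_eq_iff)
  qed
  have cont: "continuous_on {0..1} (\<lambda>s. Re (det (H s)))"
    unfolding det_def H_def by (intro continuous_intros)
  have H0: "H 0 = mat 1" and H1: "H 1 = G" by (auto simp: H_def vec_eq_iff mat_def)
  show "0 < Re (det G)"
  proof (rule ccontr)
    assume "\<not> 0 < Re (det G)"
    then have "\<exists>s\<ge>0. s \<le> 1 \<and> Re (det (H s)) = 0"
      by (intro IVT2'[OF _ _ _ cont]) (auto simp: H0 H1)
    then show False using ne by auto
  qed
qed

text \<open>The part of a real bilinear form that is complex linear in \<open>a\<close> and
  antilinear in \<open>b\<close>. On a second derivative it is the mixed Wirtinger derivative; the 4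
  collects the two factors 1/2 of \<open>wd\<close> and \<open>wdbar\<close>.\<close>

definition levi :: "(complex^'n \<Rightarrow> complex^'n \<Rightarrow> complex) \<Rightarrow> complex^'n \<Rightarrow> complex^'n \<Rightarrow> complex" where
  "levi U a b = (U a b - \<i> * U (\<i> *s a) b + \<i> * U a (\<i> *s b) + U (\<i> *s a) (\<i> *s b)) / 4"

lemma vector_smult_complex: "c *s a = Re c *\<^sub>R a + Im c *\<^sub>R (\<i> *s a)" for a :: "complex^'n"
  by (simp add: vec_eq_iff complex_eq_iff algebra_simps)

context
  fixes U :: "complex^'n::finite \<Rightarrow> complex^'n \<Rightarrow> complex"
  assumes lin_left: "\<And>b. linear (\<lambda>a. U a b)" and lin_right: "\<And>a. linear (U a)"
begin

lemma levi_add_left: "levi U (a + a') b = levi U a b + levi U a' b"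
  using linear_add[OF lin_left] by (simp add: levi_def vector_add_ldistrib algebra_simps add_divide_distrib diff_divide_distrib)

lemma levi_add_right: "levi U a (b + b') = levi U a b + levi U a b'"
  using linear_add[OF lin_right] by (simp add: levi_def vector_add_ldistrib algebra_simps add_divide_distrib diff_divide_distrib)

lemma levi_smult_left: "levi U (c *s a) b = c * levi U a b"
proof -
  have 1: "U (c *s a) b' = Re c * U a b' + Im c * U (\<i> *s a) b'" for b'
    using linear_add[OF lin_left] linear_scale[OF lin_left]
    by (simp add: vector_smult_complex[of c] scaleR_conv_of_real)
  have i: "\<i> *s (c *s a) = Re c *\<^sub>R (\<i> *s a) - Im c *\<^sub>R a"
    by (simp add: vec_eq_iff complex_eq_iff algebra_simps)
  have 2: "U (\<i> *s (c *s a)) b' = Re c * U (\<i> *s a) b' - Im c * U a b'" for b'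
    using linear_diff[OF lin_left] linear_scale[OF lin_left] by (simp only: i scaleR_conv_of_real)
  have "levi U (c *s a) b = (of_real (Re c) + \<i> * of_real (Im c)) * levi U a b"
    unfolding levi_def 1 2 by (simp add: field_simps)
  then show ?thesis by (simp add: complex_eq[symmetric])
qed

lemma levi_smult_right: "levi U a (c *s b) = cnj c * levi U a b"
proof -
  have 1: "U a' (c *s b) = Re c * U a' b + Im c * U a' (\<i> *s b)" for a'
    using linear_add[OF lin_right] linear_scale[OF lin_right]
    by (simp add: vector_smult_complex[of c] scaleR_conv_of_real)
  have i: "\<i> *s (c *s b) = Re c *\<^sub>R (\<i> *s b) - Im c *\<^sub>R b"
    by (simp add: vec_eq_iff complex_eq_iff algebra_simps)
  have 2: "U a' (\<i> *s (c *s b)) = Re c * U a' (\<i> *s b) - Im c * U a' b" for a'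
    using linear_diff[OF lin_right] linear_scale[OF lin_right] by (simp only: i scaleR_conv_of_real)
  have "levi U a (c *s b) = (of_real (Re c) - \<i> * of_real (Im c)) * levi U a b"
    unfolding levi_def 1 2 by (simp add: field_simps)
  moreover have "cnj c = of_real (Re c) - \<i> * of_real (Im c)" by (simp add: complex_eq_iff)
  ultimately show ?thesis by simp
qed

lemma levi_expansion:
  "levi U a b = (\<Sum>i\<in>UNIV. \<Sum>j\<in>UNIV. a $ i * cnj (b $ j) * levi U (axis i 1) (axis j 1))"
proof -
  have s0: "levi U 0 b = 0" "levi U a 0 = 0" for a b
    using linear_0[OF lin_left] linear_0[OF lin_right] by (simp_all add: levi_def)
  have l: "levi U (\<Sum>i\<in>A. f i) b = (\<Sum>i\<in>A. levi U (f i) b)" for A :: "'n set" and f b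
    by (induction A rule: infinite_finite_induct) (simp_all add: s0 levi_add_left)
  have r: "levi U a (\<Sum>i\<in>A. f i) = (\<Sum>i\<in>A. levi U a (f i))" for A :: "'n set" and f a
    by (induction A rule: infinite_finite_induct) (simp_all add: s0 levi_add_right)
  have "levi U a b = levi U (\<Sum>i\<in>UNIV. a $ i *s axis i 1) (\<Sum>j\<in>UNIV. b $ j *s axis j 1)"
    by (simp add: basis_expansion)
  also have "\<dots> = (\<Sum>j\<in>UNIV. \<Sum>i\<in>UNIV. a $ i * cnj (b $ j) * levi U (axis i 1) (axis j 1))"
    by (simp add: l r levi_smult_left levi_smult_right mult_ac sum_distrib_left)
  finally show ?thesis by (subst sum.swap)
qed

end

text \<open>The argument order of \<open>hess2\<close> fits here: its second direction is
  differentiated first, like \<open>wdbar j\<close> inside \<open>wd i\<close>. The factor 2 is the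
  normalisation of (1,1)-forms by \<open>(\<i>/2) dz \<and> d(cnj z)\<close>.\<close>

lemma iddbar_eq_levi:
  assumes "open S" "Ck_on 2 S u" "z \<in> S"
  shows "iddbar u z $ i $ j = 2 * levi (hess2 u z) (axis i 1) (axis j 1)"
proof -
  have u: "Ck_on (Suc (Suc 0)) S u" using assms(2) by (simp add: numeral_2_eq_2)
  have ax: "\<i> *s axis k 1 = axis k \<i>" for k by (simp add: vec_eq_iff axis_def)
  have "((wdbar j u) has_derivative
      (\<lambda>a. (hess2 u z a (axis j 1) + \<i> * hess2 u z a (axis j \<i>)) / 2)) (at z)"
    unfolding wdbar_def[abs_def]
    by (intro bounded_linear.has_derivative[OF bounded_linear_divide] has_derivative_add
        has_derivative_mult_right Ck_on_hess2_has_derivative[OF u assms(3)])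
  note D = frechet_derivative_at[OF this, symmetric]
  show ?thesis by (simp add: iddbar_def wd_def D levi_def ax field_simps)
qed

text \<open>By sesquilinearity of \<open>levi\<close>, a congruence by \<open>K\<close> evaluates
  the form on the rows of \<open>K\<close>; this turns frame components into second derivatives
  along frame vectors.\<close>

lemma iddbar_contraction:
  assumes "open S" "Ck_on 2 S u" "z \<in> S"
  shows "(K ** iddbar u z ** adjoint_mat K) $ A $ B = 2 * levi (hess2 u z) (K $ A) (K $ B)"
proof -
  have u: "Ck_on (Suc (Suc 0)) S u" using assms(2) by (simp add: numeral_2_eq_2)
  show ?thesis
    unfolding matrix_mult_adjoint_component
      levi_expansion[OF linear_hess2_left[OF u assms(3)] linear_hess2_right[OF assms(1) u assms(3)], of "K $ A"]
    by (simp add: iddbar_eq_levi[OF assms] sum_distrib_left mult_ac)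
qed

lemma Ck_on_wd: "open S \<Longrightarrow> Ck_on (Suc k) S u \<Longrightarrow> Ck_on k S (wd i u)"
  unfolding wd_def[abs_def]
  by (rule Ck_on_linear_compose[of _ "\<lambda>x. x / 2"]) (auto intro!: Ck_on_diff Ck_on_mult bounded_linear_divide)

lemma Ck_on_wdbar: "open S \<Longrightarrow> Ck_on (Suc k) S u \<Longrightarrow> Ck_on k S (wdbar i u)"
  unfolding wdbar_def[abs_def]
  by (rule Ck_on_linear_compose[of _ "\<lambda>x. x / 2"]) (auto intro!: Ck_on_add Ck_on_mult bounded_linear_divide)

lemma Ck_on_iddbar: "open S \<Longrightarrow> Ck_on (Suc (Suc k)) S u \<Longrightarrow> Ck_on k S (\<lambda>z. iddbar u z $ i $ j)"
  unfolding iddbar_def vec_lambda_beta by (intro Ck_on_mult Ck_on_const Ck_on_wd Ck_on_wdbar)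

lemma iddbar_cong_open:
  assumes "open S" "z \<in> S" "\<And>w. w \<in> S \<Longrightarrow> u w = v w"
  shows "iddbar u z = iddbar v z"
proof -
  have "wdbar j u w = wdbar j v w" if "w \<in> S" for j w
    using frechet_derivative_cong_open[OF assms(1) that assms(3)] by (simp add: wdbar_def)
  then have "frechet_derivative (wdbar j u) (at z) = frechet_derivative (wdbar j v) (at z)" for j
    by (rule frechet_derivative_cong_open[OF assms(1,2)])
  then show ?thesis by (simp add: iddbar_def wd_def)
qed

section \<open>The radius function on the total space\<close>

lemma DERIV_det_mat_minus:
  fixes C :: "complex^'n::finite^'n"
  shows "((\<lambda>h. det (\<chi> i j. mat 1 $ i $ j - h * C $ i $ j)) has_field_derivative - trace C) (at 0)"
proof -
  let ?P = "{p. p permutes (UNIV :: 'n set)}"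
  have "((\<lambda>h. \<Prod>i\<in>UNIV. mat 1 $ i $ p i - h * C $ i $ p i) has_field_derivative
      (if p = id then - trace C else 0)) (at 0)" if p: "p \<in> ?P" for p
  proof -
    have "((\<lambda>h. \<Prod>i\<in>UNIV. mat 1 $ i $ p i - h * C $ i $ p i) has_field_derivative
      (\<Sum>i\<in>UNIV. - C $ i $ p i * (\<Prod>j\<in>UNIV - {i}. mat 1 $ j $ p j - 0 * C $ j $ p j))) (at 0)"
      by (rule has_field_derivative_prod) (auto intro!: derivative_eq_intros)
    also have "(\<Sum>i\<in>UNIV. - C $ i $ p i * (\<Prod>j\<in>UNIV - {i}. mat 1 $ j $ p j - 0 * C $ j $ p j))
        = (if p = id then - trace C else 0)"
    proof (cases "p = id")
      case True
      then show ?thesis by (simp add: mat_def trace_def sum_negf)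
    next
      case False
      then obtain a where a: "p a \<noteq> a" by (auto simp: fun_eq_iff)
      have inj: "inj p" using p permutes_inj by blast
      \<comment> \<open>A permutation other than the identity moves at least two indices, so after
        deletion of the factor \<open>i\<close> a vanishing off-diagonal entry of the identity
        remains.\<close>
      have "(\<Prod>j\<in>UNIV - {i}. mat 1 $ j $ p j - 0 * C $ j $ p j) = 0" for i
      proof (rule prod_zero)
        obtain j where "j \<noteq> i" "p j \<noteq> j" using a inj by (metis injD)
        then show "\<exists>j\<in>UNIV - {i}. mat 1 $ j $ p j - 0 * C $ j $ p j = 0"
          by (intro bexI[of _ j]) (auto simp: mat_def)
      qed simp
      then have "(\<Sum>i\<in>UNIV. - C $ i $ p i * (\<Prod>j\<in>UNIV - {i}. mat 1 $ j $ p j - 0 * C $ j $ p j)) = 0"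
        by (simp only: mult_zero_right sum.neutral_const)
      then show ?thesis using False by (simp only: if_False)
    qed
    finally show ?thesis .
  qed
  then have "((\<lambda>h. \<Sum>p\<in>?P. of_int (sign p) * (\<Prod>i\<in>UNIV. mat 1 $ i $ p i - h * C $ i $ p i))
     has_field_derivative (\<Sum>p\<in>?P. of_int (sign p) * (if p = id then - trace C else 0))) (at 0)"
    by (intro DERIV_sum DERIV_cmult)
  also have "(\<Sum>p\<in>?P. of_int (sign p) * (if p = id then - trace C else 0)) = - trace C"
    by (subst sum.remove[of _ id]) (auto simp: permutes_id finite_permutations intro!: sum.neutral)
  finally show ?thesis by (simp add: det_def)
qed

text \<open>With the metric for \<open>A\<close> and the curvature for \<open>B\<close> this is the
  volume density of \<open>g_M(\<tau>)\<close>, that is, \<open>det A\<close> times the polynomial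
  \<open>Q\<close> of the overview.\<close>

definition det_pencil :: "complex^'n::finite^'n \<Rightarrow> complex^'n^'n \<Rightarrow> complex poly" where
  "det_pencil A B = det (\<chi> i j. [:A $ i $ j, - B $ i $ j:])"

lemma poly_det_pencil: "poly (det_pencil A B) a = det (\<chi> i j. A $ i $ j - a * B $ i $ j)"
  unfolding det_pencil_def det_def by (simp add: poly_sum poly_prod of_int_poly)

lemma matrix_diff_rdistrib: "((A :: 'a::ring_1^'n^'m) - B) ** C = A ** C - B ** C"
  by (simp add: vec_eq_iff matrix_matrix_mult_def left_diff_distrib sum_subtractf)

text \<open>With \<open>N = A - a B\<close> one has \<open>N - h B = (1 - h B N^(-1)) N\<close>,
  which reduces the derivative at \<open>a\<close> to the one at the identity. For the curvature it
  gives the trace as minus the logarithmic derivative of the volume density.\<close>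

lemma poly_pderiv_det_pencil:
  fixes A B :: "complex^'n::finite^'n"
  assumes "invertible (\<chi> i j. A $ i $ j - a * B $ i $ j)"
  shows "poly (pderiv (det_pencil A B)) a =
     - poly (det_pencil A B) a * trace (B ** matrix_inv (\<chi> i j. A $ i $ j - a * B $ i $ j))"
proof -
  let ?N = "\<chi> i j. A $ i $ j - a * B $ i $ j"
  let ?C = "B ** matrix_inv ?N"
  have CN: "?C ** ?N = B" 
    by (simp only: matrix_mul_assoc[symmetric] matrix_inv_inverse(2)[OF assms] matrix_mul_rid)
  have eq: "poly (det_pencil A B) (a + h) = det (\<chi> i j. mat 1 $ i $ j - h * ?C $ i $ j) * det ?N" for h
  proof -
    have hC: "(\<chi> i j. h * ?C $ i $ j) ** ?N = (\<chi> i j. h * B $ i $ j)"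
    proof -
      have "(\<chi> i j. h * X $ i $ j) ** Y = (\<chi> i j. h * (X ** Y) $ i $ j)" for X Y :: "complex^'n^'n"
        by (simp add: vec_eq_iff matrix_matrix_mult_def mult.assoc sum_distrib_left)
      then show ?thesis by (simp only: CN)
    qed
    have "(\<chi> i j. mat 1 $ i $ j - h * ?C $ i $ j) = mat 1 - (\<chi> i j. h * ?C $ i $ j)"
      by (simp add: vec_eq_iff)
    then have "(\<chi> i j. mat 1 $ i $ j - h * ?C $ i $ j) ** ?N = ?N - (\<chi> i j. h * B $ i $ j)"
      by (simp only: matrix_diff_rdistrib hC matrix_mul_lid)
    also have "\<dots> = (\<chi> i j. A $ i $ j - (a + h) * B $ i $ j)"
      by (simp add: vec_eq_iff algebra_simps)
    finally show ?thesis by (simp only: poly_det_pencil det_mul[symmetric])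
  qed
  have "((\<lambda>h. poly (det_pencil A B) (a + h)) has_field_derivative - trace ?C * det ?N) (at 0)"
    unfolding eq by (intro DERIV_cmult_right DERIV_det_mat_minus)
  moreover have "((\<lambda>h. poly (det_pencil A B) (a + h)) has_field_derivative poly (pderiv (det_pencil A B)) a) (at 0)"
  proof -
    have "(poly (det_pencil A B) has_field_derivative poly (pderiv (det_pencil A B)) a) (at (0 + a))"
      using poly_DERIV by simp
    then show ?thesis by (subst (asm) DERIV_shift) (simp add: add.commute)
  qed
  ultimately show ?thesis using DERIV_unique by (fastforce simp: poly_det_pencil)
qed

section \<open>Coordinates on the total space\<close>

definition base_part :: "complex^('n::finite option) \<Rightarrow> complex^'n" where
  "base_part w = (\<chi> k. w $ Some k)"

lemma bounded_linear_base_part: "bounded_linear base_part"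
  unfolding base_part_def linear_conv_bounded_linear[symmetric]
  by (rule linearI) (auto simp: vec_eq_iff)

lemma base_part_smult: "base_part (c *s w) = c *s base_part w"
  by (simp add: base_part_def vec_eq_iff)

lemma Ck_on_real_field_derivative:
  fixes f :: "real \<Rightarrow> real"
  assumes "open S" "\<And>x. x \<in> S \<Longrightarrow> (f has_field_derivative f' x) (at x)" "Ck_on k S f'"
  shows "Ck_on (Suc k) S f"
  using assms by (intro Ck_on_Suc_intro[of S f "\<lambda>x v. f' x * v"])
    (auto simp: has_field_derivative_def intro!: Ck_on_mult)

lemma Ck_on_deriv:
  fixes f :: "real \<Rightarrow> real"
  assumes "open S" "Ck_on (Suc k) S f"
  shows "Ck_on k S (deriv f)" "\<And>x. x \<in> S \<Longrightarrow> (f has_field_derivative deriv f x) (at x)"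
proof -
  show d: "(f has_field_derivative deriv f x) (at x)" if "x \<in> S" for x
    using assms(2) that by (auto simp: DERIV_deriv_iff_real_differentiable)
  have "frechet_derivative f (at x) 1 = deriv f x" if "x \<in> S" for x
    using frechet_derivative_at[OF d[OF that, unfolded has_field_derivative_def]] by (metis mult.right_neutral)
  moreover have "Ck_on k S (\<lambda>x. frechet_derivative f (at x) 1)" using assms(2) by simp
  ultimately show "Ck_on k S (deriv f)" using Ck_on_cong[OF assms(1)] by blast
qed

lemma Ck_on_of_real:
  "open S \<Longrightarrow> Ck_on k S f \<Longrightarrow> Ck_on k S (\<lambda>x. of_real (f x) :: complex)"
  by (rule Ck_on_linear_compose[OF _ bounded_linear_of_real])

lemma hess2_of_real:
  assumes "open S" "Ck_on 2 S f" "x \<in> S"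
  shows "hess2 (\<lambda>x. of_real (f x) :: complex) x a b = of_real (hess2 f x a b)"
proof -
  have f: "Ck_on (Suc (Suc 0)) S f" using assms by (simp add: numeral_2_eq_2)
  show ?thesis
    by (rule hess2_eqI[OF assms(1,3)])
      (rule bounded_linear.has_derivative[OF bounded_linear_of_real], rule Ck_on_Suc_has_derivative[OF f], assumption,
       rule bounded_linear.has_derivative[OF bounded_linear_of_real], rule Ck_on_hess2_has_derivative[OF f assms(3)])
qed

text \<open>The function \<open>t\<close> in bundle coordinates, where \<open>l = ln h\<close>.\<close>

definition log_radius :: "(complex^'n::finite \<Rightarrow> real) \<Rightarrow> complex^('n option) \<Rightarrow> real" where
  "log_radius l w = ln (cmod (w $ None)) + l (base_part w) / 2"

text \<open>No branch of a logarithm is involved: only the zero section is removed, which is enough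
  for \<open>ln (cmod (w $ None))\<close> to be smooth.\<close>

definition slit :: "(complex^'n::finite) set \<Rightarrow> (complex^('n option)) set" where
  "slit S = {w. w $ None \<noteq> 0 \<and> base_part w \<in> S}"

lemma open_slit:
  fixes S :: "(complex^'n::finite) set"
  assumes "open S" shows "open (slit S)"
proof -
  have "open ((\<lambda>w::complex^('n option). w $ None) -` (- {0}) \<inter> base_part -` S)"
    by (intro open_Int open_vimage assms linear_continuous_on bounded_linear_base_part continuous_intros) auto
  then show ?thesis by (simp add: slit_def vimage_def Collect_conj_eq[symmetric] Int_def)
qed

locale hermitian_chart =
  fixes S :: "(complex^'n::finite) set" and l :: "complex^'n \<Rightarrow> real"
  assumes open_S: "open S" and l_smooth: "Ck_on k S l"
begin

abbreviation "t \<equiv> log_radius l"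
abbreviation "dt w a \<equiv> Re (a $ None / w $ None) + frechet_derivative l (at (base_part w)) (base_part a) / 2"

lemma Ck_on_log_radius: "Ck_on k (slit S) t"
proof -
  have b: "bounded_linear (\<lambda>w::complex^('n option). Re (w $ None))" "bounded_linear (\<lambda>w::complex^('n option). Im (w $ None))"
    by (intro bounded_linear_compose[OF bounded_linear_Re] bounded_linear_compose[OF bounded_linear_Im]
        bounded_linear_vec_nth)+
  have ne: "Re (w $ None) * Re (w $ None) + Im (w $ None) * Im (w $ None) > 0" if "w \<in> slit S" for w
    using that by (auto simp: slit_def complex_eq_iff sum_squares_gt_zero_iff)
  \<comment> \<open>The norm is traded for the quadratic polynomial under its root, whose smoothness
    of every order is immediate.\<close>
  have ln: "ln (cmod z) = ln (Re z * Re z + Im z * Im z) * (1 / 2)" if "z \<noteq> 0" for z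
  proof -
    have "ln ((cmod z)\<^sup>2) = 2 * ln (cmod z)" using that by (simp add: ln_realpow)
    moreover have "(cmod z)\<^sup>2 = Re z * Re z + Im z * Im z" by (simp only: cmod_power2) (simp only: power2_eq_square)
    ultimately show ?thesis by simp
  qed
  note o = open_slit[OF open_S]
  have "Ck_on k (slit S) (\<lambda>w. ln (Re (w $ None) * Re (w $ None) + Im (w $ None) * Im (w $ None)))"
  proof (rule Ck_on_logarithm[where L = ln, OF o])
    show "Ck_on k (slit S) (\<lambda>w. Re (w $ None) * Re (w $ None) + Im (w $ None) * Im (w $ None))"
      by (intro Ck_on_add Ck_on_mult o Ck_on_bounded_linear b)
  qed (use ne in \<open>fastforce intro: DERIV_ln\<close>)+
  moreover have "Ck_on k (slit S) (\<lambda>w. l (base_part w))"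
    by (rule Ck_on_compose[OF o _ Ck_on_bounded_linear[OF bounded_linear_base_part] l_smooth])
      (auto simp: slit_def)
  ultimately have "Ck_on k (slit S) (\<lambda>w. ln (Re (w $ None) * Re (w $ None) + Im (w $ None) * Im (w $ None)) * (1/2)
      + l (base_part w) * (1/2))"
    by (intro Ck_on_add Ck_on_mult o Ck_on_const)
  then show ?thesis
    by (rule Ck_on_cong[OF open_slit[OF open_S]]) (simp add: log_radius_def ln slit_def)
qed

lemma has_derivative_log_radius:
  assumes "w \<in> slit S" shows "(t has_derivative dt w) (at w)"
proof -
  let ?z = "w $ None"
  have z: "?z \<noteq> 0" "base_part w \<in> S" using assms by (auto simp: slit_def)
  have RE: "(a \<bullet> sgn ?z) * inverse (cmod ?z) = Re (a / ?z)" for a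
  proof -
    have "cmod ?z * cmod ?z = Re ?z * Re ?z + Im ?z * Im ?z"
      using cmod_power2[of ?z] by (simp only: power2_eq_square)
    then show ?thesis using z
      by (simp add: Re_divide inner_complex_def sgn_div_norm power2_eq_square field_simps)
  qed
  have "((\<lambda>w::complex^('n option). cmod (w $ None)) has_derivative (\<lambda>a. a $ None \<bullet> sgn ?z)) (at w)"
    by (rule has_derivative_compose[OF bounded_linear_imp_has_derivative[OF bounded_linear_vec_nth] has_derivative_norm])
      (rule z)
  from DERIV_compose_FDERIV[OF DERIV_ln this]
  have "((\<lambda>w::complex^('n option). ln (cmod (w $ None))) has_derivative
      (\<lambda>a. (a $ None \<bullet> sgn ?z) * inverse (cmod ?z))) (at w)" using z by simp
  then have 1: "((\<lambda>w::complex^('n option). ln (cmod (w $ None))) has_derivative (\<lambda>a. Re (a $ None / ?z))) (at w)"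
    unfolding RE .
  have 2: "((\<lambda>w. l (base_part w)) has_derivative (\<lambda>a. frechet_derivative l (at (base_part w)) (base_part a))) (at w)"
    by (rule has_derivative_compose[OF bounded_linear_imp_has_derivative[OF bounded_linear_base_part]])
      (rule Ck_on_Suc_has_derivative[OF l_smooth z(2)])
  show ?thesis unfolding log_radius_def
    by (rule has_derivative_add[OF 1 bounded_linear.has_derivative[OF bounded_linear_divide 2]])
qed

lemma frechet_derivative_log_radius: "w \<in> slit S \<Longrightarrow> frechet_derivative t (at w) = dt w"
  by (rule frechet_derivative_at[symmetric]) (rule has_derivative_log_radius)

lemma hess2_log_radius:
  assumes "w \<in> slit S"
  shows "hess2 t w a b = - Re (a $ None * b $ None / (w $ None)\<^sup>2)
     + hess2 l (base_part w) (base_part a) (base_part b) / 2"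
proof (rule hess2_eqI[OF open_slit[OF open_S] assms has_derivative_log_radius])
  have z: "w $ None \<noteq> 0" "base_part w \<in> S" using assms by (auto simp: slit_def)
  have 1: "((\<lambda>w. frechet_derivative l (at (base_part w)) (base_part b)) has_derivative
      (\<lambda>a. hess2 l (base_part w) (base_part a) (base_part b))) (at w)"
    by (rule has_derivative_compose[OF bounded_linear_imp_has_derivative[OF bounded_linear_base_part]])
      (rule Ck_on_hess2_has_derivative[OF l_smooth z(2)])
  have "((\<lambda>w. b $ None / w $ None) has_derivative (\<lambda>a. - (a $ None * b $ None / (w $ None)\<^sup>2))) (at w)"
    using z by (auto intro!: derivative_eq_intros bounded_linear_imp_has_derivative[OF bounded_linear_vec_nth]
      simp: fun_eq_iff power2_eq_square field_simps)
  from bounded_linear.has_derivative[OF bounded_linear_Re this] 1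
  have "((\<lambda>w. dt w b) has_derivative (\<lambda>a. Re (- (a $ None * b $ None / (w $ None)\<^sup>2))
     + hess2 l (base_part w) (base_part a) (base_part b) / 2)) (at w)"
    by (rule has_derivative_add[OF _ bounded_linear.has_derivative[OF bounded_linear_divide]])
  then show "((\<lambda>w. dt w b) has_derivative (\<lambda>a. - Re (a $ None * b $ None / (w $ None)\<^sup>2)
     + hess2 l (base_part w) (base_part a) (base_part b) / 2)) (at w)"
    by simp
qed

definition curv :: "complex^'n \<Rightarrow> complex^'n^'n" where
  "curv z = - iddbar (\<lambda>w. of_real (l w)) z"

lemma Ck_on_curv: "Ck_on k S (\<lambda>z. curv z $ i $ j)"
  unfolding curv_def vector_uminus_component
  by (intro Ck_on_minus Ck_on_iddbar Ck_on_of_real open_S l_smooth)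

text \<open>Rows: the Euler field \<open>z\<^sup>0 \<partial>/\<partial>z\<^sup>0\<close> and the horizontal lifts of the coordinate fields.\<close>

definition frame :: "complex^('n option) \<Rightarrow> complex^('n option)^('n option)" where
  "frame w = (\<chi> A B. case A of
      None \<Rightarrow> (if B = None then w $ None else 0)
    | Some i \<Rightarrow> (if B = None then - (w $ None) * wd i (\<lambda>z. of_real (l z)) (base_part w) else if B = Some i then 1 else 0))"

lemma base_part_frame [simp]:
  "base_part (frame w $ None) = 0" "base_part (frame w $ Some i) = axis i 1"
  by (auto simp: base_part_def frame_def vec_eq_iff axis_def)

lemma det_frame: "det (frame w) = w $ None"
proof -
  have "(\<chi> i j. frame w $ Some i $ Some j) = mat 1"
    by (auto simp: frame_def mat_def vec_eq_iff)
  then show ?thesis by (subst det_block_triangular) (simp_all add: frame_def)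
qed

text \<open>As \<open>t\<close> is \<open>ln |z^0| + l / 2\<close>, the coefficient of
  \<open>z^0 \<partial>/\<partial>z^0\<close> in a horizontal lift is chosen so that the (1,0)-part
  of the differential of \<open>t\<close> vanishes on it. On the Euler field that part equals 1/2.
  Radial and base directions thus decouple.\<close>

lemma dt_frame:
  assumes "w \<in> slit S"
  shows "dt w (frame w $ None) = 1" "dt w (\<i> *s frame w $ None) = 0"
    "dt w (frame w $ Some i) = 0" "dt w (\<i> *s frame w $ Some i) = 0"
proof -
  have z: "w $ None \<noteq> 0" "base_part w \<in> S" using assms by (auto simp: slit_def)
  let ?l = "frechet_derivative l (at (base_part w))"
  have d: "(l has_derivative ?l) (at (base_part w))" by (rule Ck_on_Suc_has_derivative[OF l_smooth z(2)])
  then have l0: "?l 0 = 0" using has_derivative_linear linear_0 by blast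
  have "frechet_derivative (\<lambda>z. of_real (l z) :: complex) (at (base_part w)) = (\<lambda>v. of_real (?l v))"
    using frechet_derivative_at[OF bounded_linear.has_derivative[OF bounded_linear_of_real d]] by (rule sym)
  then have wd: "wd i (\<lambda>z. of_real (l z)) (base_part w) = (of_real (?l (axis i 1)) - \<i> * of_real (?l (axis i \<i>))) / 2"
    by (simp add: wd_def)
  have ax: "\<i> *s axis i 1 = (axis i \<i> :: complex^'n)" by (simp add: vec_eq_iff axis_def)
  show "dt w (frame w $ None) = 1" "dt w (\<i> *s frame w $ None) = 0"
    using z by (simp_all add: base_part_smult l0) (simp_all add: frame_def)
  show "dt w (frame w $ Some i) = 0" "dt w (\<i> *s frame w $ Some i) = 0"
    using z by (simp_all add: base_part_smult ax) (simp_all add: frame_def wd)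
qed

end

lemma hess2_add:
  assumes "open S" "Ck_on 2 S f" "Ck_on 2 S g" "x \<in> S"
  shows "hess2 (\<lambda>x. f x + g x) x a b = hess2 f x a b + hess2 g x a b"
proof -
  have f: "Ck_on (Suc (Suc 0)) S f" and g: "Ck_on (Suc (Suc 0)) S g"
    using assms by (simp_all add: numeral_2_eq_2)
  show ?thesis
    by (rule hess2_eqI[OF assms(1,4)])
      (rule has_derivative_add, rule Ck_on_Suc_has_derivative[OF f], assumption,
       rule Ck_on_Suc_has_derivative[OF g], assumption,
       rule has_derivative_add, rule Ck_on_hess2_has_derivative[OF f assms(4)],
       rule Ck_on_hess2_has_derivative[OF g assms(4)])
qed

lemma hess2_const [simp]: "hess2 (\<lambda>x. c) x a b = 0"
  by (simp add: hess2_def)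

text \<open>Potentials on the total space will have the form \<open>F (t w, base_part w)\<close>;
  this lemma and \<open>partial_derivatives_fst\<close> reduce the pure second derivatives of
  \<open>F\<close> to functions of one of the two arguments.\<close>

lemma hess2_slice:
  fixes F :: "real \<times> 'a::euclidean_space \<Rightarrow> 'b::real_normed_vector"
  assumes "open O'" "Ck_on 2 O' F" "(s, z) \<in> O'"
  shows "hess2 F (s, z) (0, a) (0, b) = hess2 (\<lambda>z. F (s, z)) z a b"
proof -
  let ?f = "\<lambda>z::'a. (s, z)"
  have d: "(?f has_derivative (\<lambda>v. (0, v))) (at y)" for y by (auto intro!: derivative_eq_intros)
  have o: "open (?f -` O')" by (intro open_vimage assms continuous_intros)
  have C: "Ck_on 2 (?f -` O') ?f"
    using o by (intro Ck_on_Pair Ck_on_const Ck_on_bounded_linear bounded_linear_ident)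
  have h: "hess2 ?f z a b = (0, 0)"
    by (rule hess2_eqI[OF open_UNIV UNIV_I d]) (simp flip: zero_prod_def)
  have D: "frechet_derivative ?f (at z) = (\<lambda>v. (0, v))" using frechet_derivative_at[OF d] by (rule sym)
  have F: "linear (frechet_derivative F (at (s, z)))"
    using assms by (intro has_derivative_linear[OF Ck_on_Suc_has_derivative[of 1 O' F]])
      (simp_all add: numeral_2_eq_2)
  show ?thesis
    using hess2_compose[OF o _ assms(1) C assms(2), of z a b] assms(3)
    by (simp add: h D linear_0[OF F, unfolded zero_prod_def] image_subset_iff)
qed

lemma partial_derivatives_fst:
  fixes F :: "real \<times> 'a::euclidean_space \<Rightarrow> 'b::real_normed_vector"
  assumes "open O'" "Ck_on 2 O' F" "open T" "s \<in> T" "\<And>r. r \<in> T \<Longrightarrow> (r, z) \<in> O'"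
    and "\<And>r. r \<in> T \<Longrightarrow> ((\<lambda>r. F (r, z)) has_vector_derivative F1 r) (at r)"
    and "(F1 has_vector_derivative F2) (at s)"
  shows "frechet_derivative F (at (s, z)) (1, 0) = F1 s" "hess2 F (s, z) (1, 0) (1, 0) = F2"
proof -
  have C: "Ck_on (Suc (Suc 0)) O' F" using assms by (simp add: numeral_2_eq_2)
  have d: "((\<lambda>r. (r, z)) has_derivative (\<lambda>v. (v, 0))) (at r)" for r by (auto intro!: derivative_eq_intros)
  have 1: "frechet_derivative F (at (r, z)) (1, 0) = F1 r" if r: "r \<in> T" for r
  proof -
    have D: "(F has_derivative frechet_derivative F (at (r, z))) (at (r, z))"
      by (rule Ck_on_Suc_has_derivative[OF C assms(5)[OF r]])
    have "((\<lambda>r. F (r, z)) has_derivative (\<lambda>v. frechet_derivative F (at (r, z)) (v, 0))) (at r)"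
      by (rule has_derivative_compose[OF d D])
    moreover have "((\<lambda>r. F (r, z)) has_derivative (\<lambda>v. v *\<^sub>R F1 r)) (at r)"
      using assms(6)[OF r] by (simp add: has_vector_derivative_def)
    ultimately have "(\<lambda>v. frechet_derivative F (at (r, z)) (v, 0)) = (\<lambda>v. v *\<^sub>R F1 r)"
      by (rule has_derivative_unique)
    from fun_cong[OF this, of 1] show ?thesis by simp
  qed
  show "frechet_derivative F (at (s, z)) (1, 0) = F1 s" using 1 assms(4) .
  have "((\<lambda>r. frechet_derivative F (at (r, z)) (1, 0)) has_derivative (\<lambda>v. hess2 F (s, z) (v, 0) (1, 0))) (at s)"
    by (rule has_derivative_compose[OF d Ck_on_hess2_has_derivative[OF C assms(5)[OF assms(4)]]])
  then have "(F1 has_derivative (\<lambda>v. hess2 F (s, z) (v, 0) (1, 0))) (at s)"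
    by (rule has_derivative_transform_within_open[OF _ assms(3,4)]) (rule 1)
  moreover have "(F1 has_derivative (\<lambda>v. v *\<^sub>R F2)) (at s)"
    using assms(7) by (simp add: has_vector_derivative_def)
  ultimately have "(\<lambda>v. hess2 F (s, z) (v, 0) (1, 0)) = (\<lambda>v. v *\<^sub>R F2)"
    by (rule has_derivative_unique)
  from fun_cong[OF this, of 1] show "hess2 F (s, z) (1, 0) (1, 0) = F2" by simp
qed

lemma levi_add: "levi (\<lambda>a b. U a b + V a b) a b = levi U a b + levi V a b"
  by (simp add: levi_def field_simps)

lemma levi_zero [simp]: "levi (\<lambda>a b. 0) a b = 0"
  by (simp add: levi_def)

lemma levi_mult: "levi (\<lambda>a b. c * U a b) a b = c * levi U a b"
  by (simp add: levi_def field_simps)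

context hermitian_chart
begin

text \<open>The summand \<open>ln |z^0|\<close> of \<open>t\<close> is pluriharmonic: its second
  derivative is the real part of a complex bilinear form, which \<open>levi\<close>
  annihilates.\<close>

lemma levi_log_radius:
  assumes "w \<in> slit S"
  shows "levi (\<lambda>a b. of_real (hess2 t w a b)) a b
    = levi (hess2 (\<lambda>z. of_real (l z)) (base_part w)) (base_part a) (base_part b) / 2"
proof -
  have z: "base_part w \<in> S" using assms by (simp add: slit_def)
  show ?thesis
    unfolding levi_def hess2_log_radius[OF assms] base_part_smult hess2_of_real[OF open_S l_smooth z]
    by (simp add: field_simps complex_eq_iff)
qed

lemma levi_log_radius_frame:
  assumes "w \<in> slit S"
  shows "levi (\<lambda>a b. of_real (hess2 t w a b)) (frame w $ None) b = 0"
    "levi (\<lambda>a b. of_real (hess2 t w a b)) a (frame w $ None) = 0"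
    "levi (\<lambda>a b. of_real (hess2 t w a b)) (frame w $ Some i) (frame w $ Some j) = - curv (base_part w) $ i $ j / 4"
proof -
  have z: "base_part w \<in> S" using assms by (simp add: slit_def)
  have C: "Ck_on 2 S (\<lambda>z. of_real (l z) :: complex)" by (intro Ck_on_of_real open_S l_smooth)
  then have C': "Ck_on (Suc (Suc 0)) S (\<lambda>z. of_real (l z) :: complex)" by (simp add: numeral_2_eq_2)
  let ?U = "hess2 (\<lambda>z. of_real (l z) :: complex) (base_part w)"
  have "?U 0 b = 0" "?U b 0 = 0" for b
    using linear_0[OF linear_hess2_left[OF C' z]] linear_0[OF linear_hess2_right[OF open_S C' z]] by auto
  then show "levi (\<lambda>a b. of_real (hess2 t w a b)) (frame w $ None) b = 0"
    "levi (\<lambda>a b. of_real (hess2 t w a b)) a (frame w $ None) = 0"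
    unfolding levi_log_radius[OF assms] by (simp_all add: levi_def)
  show "levi (\<lambda>a b. of_real (hess2 t w a b)) (frame w $ Some i) (frame w $ Some j) = - curv (base_part w) $ i $ j / 4"
    unfolding levi_log_radius[OF assms] by (simp add: curv_def iddbar_eq_levi[OF open_S C z])
qed

text \<open>By the second-order chain rule \<open>U\<close> is \<open>H\<close> on the pairs
  \<open>(dt, base_part)\<close> plus the radial derivative of \<open>F\<close> times the second
  derivative of \<open>t\<close>. By \<open>dt_frame\<close> each frame vector feels only one
  argument of \<open>F\<close>. The 4 under \<open>H (1, 0) (1, 0)\<close> is the squared value 1/2
  of the (1,0)-differential of \<open>t\<close> on the Euler field; the curvature term is the Levi
  form of \<open>t\<close>.\<close>

lemma levi_compose_frame:
  fixes F :: "real \<times> (complex^'n) \<Rightarrow> complex"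
  assumes w: "w \<in> slit S" and F: "open O'" "Ck_on 2 O' F" "(t w, base_part w) \<in> O'"
  defines "U \<equiv> hess2 (\<lambda>w. F (t w, base_part w)) w" and "H \<equiv> hess2 F (t w, base_part w)"
  shows "levi U (frame w $ None) (frame w $ None) = H (1, 0) (1, 0) / 4"
    and "levi U (frame w $ Some i) (frame w $ Some j) =
       levi (hess2 (\<lambda>z. F (t w, z)) (base_part w)) (axis i 1) (axis j 1)
       - frechet_derivative F (at (t w, base_part w)) (1, 0) * curv (base_part w) $ i $ j / 4"
    and "(\<And>a. H (1, 0) (0, a) = 0) \<Longrightarrow> levi U (frame w $ None) (frame w $ Some j) = 0"
    and "(\<And>a. H (0, a) (1, 0) = 0) \<Longrightarrow> levi U (frame w $ Some i) (frame w $ None) = 0"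
proof -
  let ?p = "(t w, base_part w)"
  let ?\<Phi> = "\<lambda>w. (t w, base_part w)"
  let ?F1 = "frechet_derivative F (at ?p)"
  let ?N = "slit S \<inter> ?\<Phi> -` O'"
  have C: "Ck_on (Suc (Suc 0)) O' F" using F by (simp add: numeral_2_eq_2)
  have cont: "continuous_on (slit S) ?\<Phi>"
    by (intro Ck_on_continuous_on[of 0] Ck_on_Pair open_slit open_S Ck_on_log_radius
        Ck_on_bounded_linear bounded_linear_base_part)
  have N: "open ?N" by (rule continuous_open_preimage[OF cont open_slit[OF open_S] F(1)])
  have C\<Phi>: "Ck_on k ?N ?\<Phi>" for k
    using N by (intro Ck_on_Pair Ck_on_bounded_linear bounded_linear_base_part
      Ck_on_subset[OF Ck_on_log_radius]) auto
  have d\<Phi>: "(?\<Phi> has_derivative (\<lambda>a. (dt y a, base_part a))) (at y)" if "y \<in> slit S" for y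
    by (intro has_derivative_Pair has_derivative_log_radius that
        bounded_linear_imp_has_derivative bounded_linear_base_part)
  have f\<Phi>: "frechet_derivative ?\<Phi> (at w) a = (dt w a, base_part a)" for a
    by (rule fun_cong[OF frechet_derivative_at[OF d\<Phi>[OF w], symmetric]])
  have h\<Phi>: "hess2 ?\<Phi> w a b = (hess2 t w a b, 0)" for a b
  proof (rule hess2_eqI[OF open_slit[OF open_S] w d\<Phi>])
    have "((\<lambda>y. frechet_derivative t (at y) b) has_derivative (\<lambda>a. hess2 t w a b)) (at w)"
      by (rule Ck_on_hess2_has_derivative[OF Ck_on_log_radius w])
    then have "((\<lambda>y. dt y b) has_derivative (\<lambda>a. hess2 t w a b)) (at w)"
      by (rule has_derivative_transform_within_open[OF _ open_slit[OF open_S] w])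
        (simp add: frechet_derivative_log_radius)
    then show "((\<lambda>y. (dt y b, base_part b)) has_derivative (\<lambda>a. (hess2 t w a b, 0))) (at w)"
      by (intro has_derivative_Pair has_derivative_const)
  qed
  have lin: "linear ?F1" by (rule has_derivative_linear[OF Ck_on_Suc_has_derivative[OF C F(3)]])
  have F1: "?F1 (r, 0) = ?F1 (1, 0) * of_real r" for r
    using linear_scale[OF lin, of r "(1, 0)"] by (simp add: scaleR_conv_of_real)
  have U: "U = (\<lambda>a b. H (dt w a, base_part a) (dt w b, base_part b) + ?F1 (1, 0) * of_real (hess2 t w a b))"
    unfolding U_def H_def
    using w F by (intro ext, subst hess2_compose[OF N _ F(1) C\<Phi> F(2)])
      (auto simp: f\<Phi> h\<Phi> F1[of "hess2 t w _ _"])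
  have H0: "H 0 b = 0" "H b 0 = 0" for b
    unfolding H_def using linear_0[OF linear_hess2_left[OF C F(3)]] linear_0[OF linear_hess2_right[OF F(1) C F(3)]]
    by auto
  have b0: "base_part (\<i> *s frame w $ None) = 0" "base_part (\<i> *s frame w $ Some i) = \<i> *s axis i 1" for i
    by (simp_all add: base_part_smult)
  note eqs = base_part_frame b0 H0[unfolded zero_prod_def]
  note LU = U levi_add levi_mult levi_log_radius_frame[OF w]
  show "levi U (frame w $ None) (frame w $ None) = H (1, 0) (1, 0) / 4"
    unfolding LU unfolding levi_def unfolding dt_frame[OF w] unfolding eqs by simp
  show "levi U (frame w $ Some i) (frame w $ Some j) =
       levi (hess2 (\<lambda>z. F (t w, z)) (base_part w)) (axis i 1) (axis j 1)
       - ?F1 (1, 0) * curv (base_part w) $ i $ j / 4"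
    unfolding LU unfolding levi_def unfolding dt_frame[OF w] unfolding eqs H_def hess2_slice[OF F] by simp
  show "levi U (frame w $ None) (frame w $ Some j) = 0" if "\<And>a. H (1, 0) (0, a) = 0"
    unfolding LU unfolding levi_def unfolding dt_frame[OF w] unfolding eqs that by simp
  show "levi U (frame w $ Some i) (frame w $ None) = 0" if "\<And>a. H (0, a) (1, 0) = 0"
    unfolding LU unfolding levi_def unfolding dt_frame[OF w] unfolding eqs that by simp
qed

end

section \<open>Scalar curvature of a bundle-adapted metric\<close>

lemma sum_axis_sesquilinear:
  fixes M :: "complex^'n::finite^'n"
  shows "(\<Sum>i\<in>UNIV. \<Sum>j\<in>UNIV. axis a 1 $ i * cnj (axis b 1 $ j) * M $ i $ j) = M $ a $ b"
proof -
  have "axis a 1 $ i * cnj (axis b 1 $ j) * M $ i $ j = (if i = a then if j = b then M $ i $ j else 0 else 0)" for i j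
    by (simp add: axis_def)
  moreover have "(\<Sum>j\<in>UNIV. if i = a then if j = b then M $ i $ j else 0 else 0) = (if i = a then M $ i $ b else 0)" for i
    by simp
  ultimately show ?thesis by simp
qed

text \<open>The integrals defining the profile functions are replaced by the equations they satisfy,
  \<open>\<mu>' = \<phi>(\<mu>)\<close> and \<open>f' = \<mu>\<close>, whence
  \<open>f'' = \<phi>(\<mu>)\<close>. Here \<open>T\<close> is a set of values of the radial
  function, not a trivialization.\<close>

locale momentum_chart = hermitian_chart S l
  for S :: "(complex^'n::finite) set" and l :: "complex^'n \<Rightarrow> real" +
  fixes g :: "complex^'n \<Rightarrow> complex^'n^'n" and J T :: "real set" and \<phi> \<mu> f :: "real \<Rightarrow> real"
  assumes g_smooth: "Ck_on k S (\<lambda>z. g z $ i $ j)"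
    and open_J: "open J" and open_T: "open T"
    and \<phi>_smooth: "Ck_on k J \<phi>" and \<phi>_pos: "x \<in> J \<Longrightarrow> 0 < \<phi> x"
    and pos: "\<tau> \<in> J \<Longrightarrow> z \<in> S \<Longrightarrow> hermitian_pos (g z - \<tau> *\<^sub>R curv z)"
    and \<mu>_in: "s \<in> T \<Longrightarrow> \<mu> s \<in> J"
    and \<mu>_deriv: "s \<in> T \<Longrightarrow> (\<mu> has_field_derivative \<phi> (\<mu> s)) (at s)"
    and f_deriv: "s \<in> T \<Longrightarrow> (f has_field_derivative \<mu> s) (at s)"
begin

abbreviation "gt \<tau> z \<equiv> g z - \<tau> *\<^sub>R curv z"
abbreviation "P z \<equiv> det_pencil (g z) (curv z)"

definition bundle_metric :: "complex^('n option) \<Rightarrow> complex^('n option)^('n option)" where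
  "bundle_metric w = pullback_form g w + 2 *\<^sub>R iddbar (\<lambda>w'. of_real (f (t w'))) w"

definition dom :: "(complex^('n option)) set" where
  "dom = {w \<in> slit S. t w \<in> T}"

lemma open_dom: "open dom"
proof -
  have "open (slit S \<inter> t -` T)"
    by (rule continuous_open_preimage[OF Ck_on_continuous_on[OF Ck_on_log_radius[of 0]] open_slit[OF open_S] open_T])
  also have "slit S \<inter> t -` T = dom" by (auto simp: dom_def)
  finally show ?thesis .
qed

lemma gt_eq: "gt \<tau> z = (\<chi> i j. g z $ i $ j - of_real \<tau> * curv z $ i $ j)"
  by (simp add: vec_eq_iff) (simp add: scaleR_conv_of_real)

lemma poly_P: "poly (P z) (of_real \<tau>) = det (gt \<tau> z)"
  by (simp add: poly_det_pencil gt_eq)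

lemma Ck_on_\<mu>: "Ck_on k T \<mu>"
proof (induction k)
  case 0
  show ?case using \<mu>_deriv by (auto intro!: continuous_at_imp_continuous_on DERIV_isCont)
next
  case (Suc k)
  have "Ck_on k T (\<lambda>s. \<phi> (\<mu> s))"
    by (rule Ck_on_compose[OF open_T _ Suc \<phi>_smooth]) (use \<mu>_in in auto)
  from Ck_on_real_field_derivative[OF open_T _ this, of \<mu>] show ?case using \<mu>_deriv by blast
qed

lemma Ck_on_f: "Ck_on k T f"
  by (rule Ck_on_SucD[OF Ck_on_real_field_derivative[OF open_T _ Ck_on_\<mu>]]) (rule f_deriv)

lemma frame_pullback:
  "(frame w ** pullback_form g w ** adjoint_mat (frame w)) $ A $ B =
    (\<Sum>i\<in>UNIV. \<Sum>j\<in>UNIV. base_part (frame w $ A) $ i * cnj (base_part (frame w $ B) $ j) * g (base_part w) $ i $ j)"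
  unfolding matrix_mult_adjoint_component
  by (simp add: sum_UNIV_option pullback_form_def base_part_def)

text \<open>The fibre entry is \<open>f''(t)\<close>, since the explicit 2 and the 2 of
  \<open>iddbar\<close> cancel the 4 in \<open>levi_compose_frame\<close>; the base block is
  \<open>g - f'(t) curv\<close> for the same reason. Mixed entries vanish because
  \<open>f (t w)\<close> depends on the base only through \<open>t\<close>.\<close>

lemma frame_bundle_metric:
  assumes w: "w \<in> dom"
  shows "frame w ** bundle_metric w ** adjoint_mat (frame w)
    = block_diag (of_real (\<phi> (\<mu> (t w)))) (gt (\<mu> (t w)) (base_part w))"
proof -
  have wS: "w \<in> slit S" and wT: "t w \<in> T" using w by (auto simp: dom_def)
  let ?F = "\<lambda>p::real \<times> (complex^'n). of_real (f (fst p)) :: complex"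
  let ?O = "T \<times> (UNIV :: (complex^'n) set)"
  let ?z = "base_part w"
  let ?\<mu> = "\<mu> (t w)"
  have oO: "open ?O" using open_T open_Times by blast
  have C: "Ck_on k ?O ?F" for k
    by (rule Ck_on_of_real[OF oO Ck_on_compose[OF oO _ Ck_on_bounded_linear[OF bounded_linear_fst] Ck_on_f]]) auto
  have p: "(t w, ?z) \<in> ?O" using wT by simp
  have d1: "((\<lambda>r. ?F (r, ?z)) has_vector_derivative of_real (\<mu> r)) (at r)" if "r \<in> T" for r
    using f_deriv[OF that] by (auto intro!: has_vector_derivative_of_real)
  have d2: "((\<lambda>r. of_real (\<mu> r) :: complex) has_vector_derivative of_real (\<phi> ?\<mu>)) (at (t w))"
    using \<mu>_deriv[OF wT] by (auto intro!: has_vector_derivative_of_real)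
  note F1 = partial_derivatives_fst[OF oO C open_T wT _ d1 d2, simplified]
  have dF: "(?F has_derivative (\<lambda>v. of_real (\<mu> (fst y) * fst v))) (at y)" if "y \<in> ?O" for y
    by (rule bounded_linear.has_derivative[OF bounded_linear_of_real],
      rule has_derivative_compose[OF bounded_linear_imp_has_derivative[OF bounded_linear_fst]])
      (use f_deriv that in \<open>auto simp: has_field_derivative_def\<close>)
  have h1: "hess2 ?F (t w, ?z) a (0, b) = 0" for a b
    by (rule hess2_eqI[OF oO p dF]) simp_all
  have h2: "hess2 ?F (t w, ?z) (0, b) (1, 0) = 0" for b
  proof -
    have "((\<lambda>y. \<mu> (fst y)) has_derivative (\<lambda>v. \<phi> ?\<mu> * fst v)) (at (t w, ?z))"
      by (rule has_derivative_compose[OF bounded_linear_imp_has_derivative[OF bounded_linear_fst]])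
        (use \<mu>_deriv[OF wT] in \<open>auto simp: has_field_derivative_def\<close>)
    then have "((\<lambda>y. of_real (\<mu> (fst y) * fst (1::real, 0 :: complex^'n)) :: complex) has_derivative (\<lambda>v. of_real (\<phi> ?\<mu> * fst v))) (at (t w, ?z))"
      using bounded_linear.has_derivative[OF bounded_linear_of_real] by (simp only: fst_conv mult_1_right) blast
    from hess2_eqI[OF oO p dF this] show ?thesis by simp
  qed
  have h3: "hess2 (\<lambda>z :: complex^'n. of_real (f (t w)) :: complex) ?z = (\<lambda>a b. 0)" by (intro ext) simp
  note L = levi_compose_frame[OF wS oO C p, unfolded h1 h2 F1 fst_conv h3]
  have C2: "Ck_on 2 dom (\<lambda>w. of_real (f (t w)) :: complex)"
    by (intro Ck_on_of_real open_dom Ck_on_compose[OF open_dom _ Ck_on_subset[OF Ck_on_log_radius] Ck_on_f])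
      (auto simp: dom_def)
  have "(frame w ** bundle_metric w ** adjoint_mat (frame w)) $ A $ B
    = block_diag (of_real (\<phi> ?\<mu>)) (gt ?\<mu> ?z) $ A $ B" for A B
  proof -
    have "(frame w ** bundle_metric w ** adjoint_mat (frame w)) $ A $ B =
      (frame w ** pullback_form g w ** adjoint_mat (frame w)) $ A $ B
      + 2 * (frame w ** iddbar (\<lambda>w'. of_real (f (t w'))) w ** adjoint_mat (frame w)) $ A $ B"
      unfolding matrix_mult_adjoint_component
      by (simp add: bundle_metric_def algebra_simps sum.distrib sum_distrib_left scaleR_conv_of_real)
    also have "\<dots> = block_diag (of_real (\<phi> ?\<mu>)) (gt ?\<mu> ?z) $ A $ B"
      unfolding iddbar_contraction[OF open_dom C2 w] frame_pullback
      by (cases A; cases B) (simp_all add: L sum_axis_sesquilinear gt_eq)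
    finally show ?thesis .
  qed
  then show ?thesis by (simp add: vec_eq_iff)
qed

lemma hermitian_gt: "s \<in> T \<Longrightarrow> z \<in> S \<Longrightarrow> hermitian_pos (gt (\<mu> s) z)"
  by (rule pos[OF \<mu>_in])

lemma det_gt_positive:
  assumes "s \<in> T" "z \<in> S"
  obtains d where "0 < d" "det (gt (\<mu> s) z) = of_real d"
  using det_hermitian_pos[OF hermitian_gt[OF assms]] by (auto elim!: Reals_cases)

lemma det_bundle_metric:
  assumes w: "w \<in> dom"
  shows "det (bundle_metric w) * of_real ((cmod (w $ None))\<^sup>2)
     = of_real (\<phi> (\<mu> (t w))) * det (gt (\<mu> (t w)) (base_part w))"
proof -
  have "det (frame w ** bundle_metric w ** adjoint_mat (frame w)) =
     w $ None * det (bundle_metric w) * cnj (w $ None)"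
    by (simp add: det_mul det_adjoint_mat det_frame)
  then show ?thesis
    by (simp only: frame_bundle_metric[OF w] det_block_diag complex_norm_square mult_ac)
qed

text \<open>The frame contributes \<open>|z^0|^2\<close> to the determinant, and
  \<open>2 ln |z^0| = 2 t - l\<close>. So the Ricci potential depends only on \<open>t\<close> and
  the base point, and \<open>levi_compose_frame\<close> applies to it.\<close>

lemma ln_det_bundle_metric:
  assumes w: "w \<in> dom"
  shows "ln (det (bundle_metric w)) =
     of_real (ln (\<phi> (\<mu> (t w))) - 2 * t w) + (ln (det (gt (\<mu> (t w)) (base_part w))) + of_real (l (base_part w)))"
proof -
  have wS: "w $ None \<noteq> 0" "base_part w \<in> S" and wT: "t w \<in> T" using w by (auto simp: dom_def slit_def)
  obtain d where d: "0 < d" "det (gt (\<mu> (t w)) (base_part w)) = of_real d"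
    using det_gt_positive[OF wT wS(2)] .
  let ?\<phi> = "\<phi> (\<mu> (t w))"
  have \<phi>: "0 < ?\<phi>" using \<phi>_pos \<mu>_in wT by blast
  have "det (bundle_metric w) = of_real (?\<phi> * d / (cmod (w $ None))\<^sup>2)"
    using det_bundle_metric[OF w] wS(1) d(2) by (simp add: field_simps)
  moreover have "0 < ?\<phi> * d / (cmod (w $ None))\<^sup>2" using \<phi> d wS(1) by simp
  ultimately have "ln (det (bundle_metric w)) = of_real (ln (?\<phi> * d / (cmod (w $ None))\<^sup>2))"
    by (simp only: Ln_of_real)
  also have "ln (?\<phi> * d / (cmod (w $ None))\<^sup>2) = ln ?\<phi> + ln d - 2 * ln (cmod (w $ None))"
    using \<phi> d wS(1) by (simp add: ln_div ln_mult ln_realpow)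
  also have "\<dots> = (ln ?\<phi> - 2 * t w) + (ln d + l (base_part w))"
    by (simp add: log_radius_def)
  finally show ?thesis using d by (simp add: Ln_of_real)
qed

lemma invertible_bundle_metric: "w \<in> dom \<Longrightarrow> invertible (bundle_metric w)"
proof -
  assume w: "w \<in> dom"
  have wS: "w $ None \<noteq> 0" "base_part w \<in> S" and wT: "t w \<in> T" using w by (auto simp: dom_def slit_def)
  have "det (gt (\<mu> (t w)) (base_part w)) \<noteq> 0"
    using det_gt_positive[OF wT wS(2)] by (metis less_irrefl of_real_eq_0_iff)
  moreover have "0 < \<phi> (\<mu> (t w))" using \<phi>_pos \<mu>_in wT by blast
  ultimately have "det (bundle_metric w) \<noteq> 0" using det_bundle_metric[OF w] by auto
  then show ?thesis by (simp add: invertible_det_nz)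
qed

definition potential :: "real \<times> (complex^'n) \<Rightarrow> complex" where
  "potential p = of_real (ln (\<phi> (\<mu> (fst p))) - 2 * fst p)
     + (ln (det (gt (\<mu> (fst p)) (snd p))) + of_real (l (snd p)))"

lemma Ck_on_det_gt: "Ck_on k (T \<times> S) (\<lambda>p. det (gt (\<mu> (fst p)) (snd p)))"
proof -
  have o: "open (T \<times> S)" using open_T open_S by (rule open_Times)
  have snd: "Ck_on k (T \<times> S) (\<lambda>p. F (snd p))" if "Ck_on k S F" for F :: "complex^'n \<Rightarrow> complex"
    by (rule Ck_on_compose[OF o _ Ck_on_bounded_linear[OF bounded_linear_snd] that]) auto
  have fst: "Ck_on k (T \<times> S) (\<lambda>p. of_real (\<mu> (fst p)) :: complex)"
    by (rule Ck_on_of_real[OF o Ck_on_compose[OF o _ Ck_on_bounded_linear[OF bounded_linear_fst] Ck_on_\<mu>]]) auto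
  show ?thesis
    unfolding gt_eq by (rule Ck_on_det[OF o]) (simp, intro Ck_on_diff Ck_on_mult o fst snd g_smooth Ck_on_curv)
qed

lemma det_gt_not_nonpos: "s \<in> T \<Longrightarrow> z \<in> S \<Longrightarrow> det (gt (\<mu> s) z) \<notin> \<real>\<^sub>\<le>\<^sub>0"
  by (erule (1) det_gt_positive) auto

lemma det_gt_nonzero: "s \<in> T \<Longrightarrow> z \<in> S \<Longrightarrow> det (gt (\<mu> s) z) \<noteq> 0"
  by (erule (1) det_gt_positive) auto

lemma Ck_on_ln_det_gt: "Ck_on k (T \<times> S) (\<lambda>p. ln (det (gt (\<mu> (fst p)) (snd p))))"
  using det_gt_not_nonpos det_gt_nonzero
  by (intro Ck_on_logarithm[OF open_Times[OF open_T open_S] Ck_on_det_gt] has_field_derivative_Ln) auto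

lemma Ck_on_potential: "Ck_on k (T \<times> S) potential"
proof -
  have o: "open (T \<times> S)" using open_T open_S by (rule open_Times)
  have "Ck_on k T (\<lambda>s. \<phi> (\<mu> s))"
    by (rule Ck_on_compose[OF open_T _ Ck_on_\<mu> \<phi>_smooth]) (use \<mu>_in in auto)
  then have "Ck_on k T (\<lambda>s. ln (\<phi> (\<mu> s)))"
    by (rule Ck_on_logarithm[OF open_T]) (use \<phi>_pos \<mu>_in in \<open>force intro: DERIV_ln\<close>)+
  then have "Ck_on k T (\<lambda>s. ln (\<phi> (\<mu> s)) - 2 * s)"
    by (rule Ck_on_diff[OF open_T _ Ck_on_bounded_linear[OF bounded_linear_mult_right]])
  then have 1: "Ck_on k (T \<times> S) (\<lambda>p. of_real (ln (\<phi> (\<mu> (fst p))) - 2 * fst p) :: complex)"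
    by (intro Ck_on_of_real[OF o Ck_on_compose[OF o _ Ck_on_bounded_linear[OF bounded_linear_fst]]]) auto
  have 2: "Ck_on k (T \<times> S) (\<lambda>p. of_real (l (snd p)) :: complex)"
    by (rule Ck_on_of_real[OF o Ck_on_compose[OF o _ Ck_on_bounded_linear[OF bounded_linear_snd] l_smooth]]) auto
  show ?thesis
    unfolding potential_def[abs_def] by (intro Ck_on_add o 1 2 Ck_on_ln_det_gt)
qed

lemma \<phi>_derivs:
  assumes "x \<in> J"
  shows "(\<phi> has_field_derivative deriv \<phi> x) (at x)"
    "(deriv \<phi> has_field_derivative deriv (deriv \<phi>) x) (at x)"
  using Ck_on_deriv(2)[OF open_J \<phi>_smooth[of 1, unfolded One_nat_def] assms]
    Ck_on_deriv(2)[OF open_J Ck_on_deriv(1)[OF open_J \<phi>_smooth[of 2, unfolded numeral_2_eq_2]] assms] by auto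

text \<open>Since \<open>\<mu>' = \<phi>(\<mu>)\<close>, a derivative in \<open>r\<close> is
  \<open>\<phi>\<close> times a derivative in \<open>\<tau>\<close>. This cancels the denominator in
  the derivative of \<open>ln \<phi>\<close>; the constant - 2 stems from the term
  \<open>- 2 t\<close> of the potential.\<close>

lemma potential_derivs:
  assumes z: "z \<in> S"
  defines "F1 \<equiv> \<lambda>r. of_real (deriv \<phi> (\<mu> r) - 2)
      + of_real (\<phi> (\<mu> r)) * (poly (pderiv (P z)) (of_real (\<mu> r)) / poly (P z) (of_real (\<mu> r))) :: complex"
  shows "r \<in> T \<Longrightarrow> ((\<lambda>r. potential (r, z)) has_vector_derivative F1 r) (at r)"
    and "r \<in> T \<Longrightarrow> (F1 has_vector_derivative
       (of_real (deriv (deriv \<phi>) (\<mu> r) * \<phi> (\<mu> r))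
       + (of_real (\<phi> (\<mu> r)) * (of_real (\<phi> (\<mu> r)) *
           ((poly (pderiv (pderiv (P z))) (of_real (\<mu> r)) * poly (P z) (of_real (\<mu> r))
             - poly (pderiv (P z)) (of_real (\<mu> r)) * poly (pderiv (P z)) (of_real (\<mu> r)))
             / (poly (P z) (of_real (\<mu> r)))\<^sup>2))
          + of_real (deriv \<phi> (\<mu> r) * \<phi> (\<mu> r)) *
             (poly (pderiv (P z)) (of_real (\<mu> r)) / poly (P z) (of_real (\<mu> r)))))) (at r)"
proof -
  assume r: "r \<in> T"
  let ?x = "of_real (\<mu> r) :: complex"
  have J: "\<mu> r \<in> J" and \<phi>: "0 < \<phi> (\<mu> r)" using r \<mu>_in \<phi>_pos by auto
  have nz: "poly (P z) ?x \<noteq> 0" "poly (P z) ?x \<notin> \<real>\<^sub>\<le>\<^sub>0"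
    unfolding poly_P using det_gt_nonzero[OF r z] det_gt_not_nonpos[OF r z] by auto
  have of_real: "((\<lambda>r. of_real (h r) :: complex) has_vector_derivative of_real h') (at r)"
    if "(h has_field_derivative h') (at r)" for h h'
    using that by (auto intro!: has_vector_derivative_of_real)
  note mu = of_real[OF \<mu>_deriv[OF r]]
  note phi = of_real[OF DERIV_chain2[OF \<phi>_derivs(1)[OF J] \<mu>_deriv[OF r]]]
  have "((\<lambda>r. ln (\<phi> (\<mu> r)) - 2 * r) has_field_derivative (deriv \<phi> (\<mu> r) - 2)) (at r)"
    using \<phi> by (auto intro!: derivative_eq_intros DERIV_chain2[OF \<phi>_derivs(1)[OF J] \<mu>_deriv[OF r]])
  note 1 = of_real[OF this]
  have "((\<lambda>x. ln (poly (P z) x)) has_field_derivative poly (pderiv (P z)) ?x / poly (P z) ?x) (at ?x)"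
    using nz by (auto intro!: derivative_eq_intros simp: field_simps)
  from field_vector_diff_chain_at[OF mu this]
  have 2: "((\<lambda>r. ln (det (gt (\<mu> r) z))) has_vector_derivative
      of_real (\<phi> (\<mu> r)) * (poly (pderiv (P z)) ?x / poly (P z) ?x)) (at r)"
    by (simp add: o_def poly_P)
  have "((\<lambda>r. of_real (ln (\<phi> (\<mu> r)) - 2 * r) + (ln (det (gt (\<mu> r) z)) + of_real (l z))) has_vector_derivative
      of_real (deriv \<phi> (\<mu> r) - 2) + (of_real (\<phi> (\<mu> r)) * (poly (pderiv (P z)) ?x / poly (P z) ?x) + 0)) (at r)"
    by (intro has_vector_derivative_add 1 2 has_vector_derivative_const)
  then show "((\<lambda>r. potential (r, z)) has_vector_derivative F1 r) (at r)"
    by (simp add: potential_def F1_def)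
  have "((\<lambda>r. deriv \<phi> (\<mu> r) - 2) has_field_derivative deriv (deriv \<phi>) (\<mu> r) * \<phi> (\<mu> r)) (at r)"
    using DERIV_chain2[OF \<phi>_derivs(2)[OF J] \<mu>_deriv[OF r]] by (auto intro!: derivative_eq_intros)
  note 3 = of_real[OF this]
  have "((\<lambda>x. poly (pderiv (P z)) x / poly (P z) x) has_field_derivative
     (poly (pderiv (pderiv (P z))) ?x * poly (P z) ?x - poly (pderiv (P z)) ?x * poly (pderiv (P z)) ?x) / (poly (P z) ?x)\<^sup>2) (at ?x)"
    using nz by (auto intro!: derivative_eq_intros simp: power2_eq_square)
  from field_vector_diff_chain_at[OF mu this]
  show "(F1 has_vector_derivative
       (of_real (deriv (deriv \<phi>) (\<mu> r) * \<phi> (\<mu> r))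
       + (of_real (\<phi> (\<mu> r)) * (of_real (\<phi> (\<mu> r)) *
           ((poly (pderiv (pderiv (P z))) ?x * poly (P z) ?x
             - poly (pderiv (P z)) ?x * poly (pderiv (P z)) ?x) / (poly (P z) ?x)\<^sup>2))
          + of_real (deriv \<phi> (\<mu> r) * \<phi> (\<mu> r)) *
             (poly (pderiv (P z)) ?x / poly (P z) ?x)))) (at r)"
    unfolding F1_def o_def by (intro has_vector_derivative_add has_vector_derivative_mult 3 phi)
qed

lemma iddbar_potential_slice:
  assumes s: "s \<in> T" and z: "z \<in> S"
  shows "2 * levi (hess2 (\<lambda>z. potential (s, z)) z) (axis i 1) (axis j 1)
    = - ricci_form (gt (\<mu> s)) z $ i $ j - curv z $ i $ j"
proof -
  have sl: "Ck_on k S (\<lambda>z. ln (det (gt (\<mu> s) z)))" for k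
  proof -
    have "Ck_on k S (\<lambda>z. (s, z))"
      by (intro Ck_on_Pair open_S Ck_on_const Ck_on_bounded_linear bounded_linear_ident)
    from Ck_on_compose[OF open_S _ this Ck_on_ln_det_gt] show ?thesis using s by auto
  qed
  note l = Ck_on_of_real[OF open_S l_smooth]
  have C: "Ck_on 2 S (\<lambda>z. ln (det (gt (\<mu> s) z)) + of_real (l z))" by (intro Ck_on_add open_S sl l)
  have "hess2 (\<lambda>z. potential (s, z)) z = (\<lambda>a b. hess2 (\<lambda>z. ln (det (gt (\<mu> s) z))) z a b + hess2 (\<lambda>z. of_real (l z)) z a b)"
    unfolding potential_def fst_conv snd_conv
    by (intro ext) (simp only: hess2_add[OF open_S Ck_on_const C z] hess2_add[OF open_S sl l z] hess2_const add_0)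
  then show ?thesis
    using iddbar_eq_levi[OF open_S sl z, of i j] iddbar_eq_levi[OF open_S l z, of i j]
    by (simp add: levi_add ricci_form_def curv_def algebra_simps)
qed

lemma trace_curv:
  assumes s: "s \<in> T" and z: "z \<in> S"
  shows "trace (curv z ** matrix_inv (gt (\<mu> s) z)) =
    - poly (pderiv (P z)) (of_real (\<mu> s)) / poly (P z) (of_real (\<mu> s))"
proof -
  have "invertible (gt (\<mu> s) z)" using hermitian_pos_invertible[OF hermitian_gt[OF s z]] .
  from poly_pderiv_det_pencil[OF this[unfolded gt_eq]] show ?thesis
    using det_gt_nonzero[OF s z] unfolding gt_eq[symmetric] poly_P[symmetric] by (simp add: field_simps)
qed

text \<open>The bracket is \<open>(\<phi> P)''\<close> by the product rule. It collects the fibre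
  part of the Ricci form, divided by \<open>\<phi>\<close>, and the trace of the curvature
  correction to its base part.\<close>

lemma scal_bundle_metric:
  assumes w: "w \<in> dom"
  defines "z \<equiv> base_part w" and "\<tau> \<equiv> \<mu> (t w)"
  shows "scal bundle_metric w = scal (gt \<tau>) z -
    (of_real (deriv (deriv \<phi>) \<tau>) * poly (P z) (of_real \<tau>)
      + 2 * of_real (deriv \<phi> \<tau>) * poly (pderiv (P z)) (of_real \<tau>)
      + of_real (\<phi> \<tau>) * poly (pderiv (pderiv (P z))) (of_real \<tau>)) / (2 * poly (P z) (of_real \<tau>))"
proof -
  have wS: "w \<in> slit S" and z: "z \<in> S" and s: "t w \<in> T" and nz: "w $ None \<noteq> 0"
    using w by (auto simp: dom_def slit_def z_def)
  have \<tau>: "\<tau> \<in> J" and \<phi>: "0 < \<phi> \<tau>" using s \<mu>_in \<phi>_pos by (auto simp: \<tau>_def)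
  have o: "open (T \<times> S)" using open_T open_S by (rule open_Times)
  let ?u = "\<lambda>w. potential (t w, base_part w)"
  let ?K = "frame w"
  let ?R = "ricci_form bundle_metric w"
  have p: "(t w, base_part w) \<in> T \<times> S" using s z by (simp add: z_def)
  have C2: "Ck_on 2 dom ?u"
    by (intro Ck_on_compose[OF open_dom _ Ck_on_Pair[OF open_dom Ck_on_subset[OF Ck_on_log_radius]
          Ck_on_bounded_linear[OF bounded_linear_base_part]] Ck_on_potential])
      (auto simp: dom_def slit_def)
  have R: "?R = - iddbar ?u w"
    unfolding ricci_form_def
    by (rule arg_cong[where f = uminus], rule iddbar_cong_open[OF open_dom w])
      (simp add: ln_det_bundle_metric potential_def)
  have KRK: "(?K ** ?R ** adjoint_mat ?K) $ A $ B = - 2 * levi (hess2 ?u w) (?K $ A) (?K $ B)" for A B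
    using iddbar_contraction[OF open_dom C2 w, of ?K A B]
    unfolding R matrix_mult_adjoint_component by (simp add: sum_negf)
  let ?D = "poly (P z) (of_real \<tau>)"
  let ?D' = "poly (pderiv (P z)) (of_real \<tau>)"
  let ?D'' = "poly (pderiv (pderiv (P z))) (of_real \<tau>)"
  let ?f = "of_real (\<phi> \<tau>) :: complex"
  let ?f' = "of_real (deriv \<phi> \<tau>) :: complex"
  let ?f'' = "of_real (deriv (deriv \<phi>) \<tau>) :: complex"
  have D: "?D \<noteq> 0" unfolding poly_P \<tau>_def by (rule det_gt_nonzero[OF s z])
  note d = partial_derivatives_fst[OF o Ck_on_potential open_T s _ potential_derivs(1)[OF z] potential_derivs(2)[OF z s],
      simplified z s, folded \<tau>_def]
  note L = levi_compose_frame[OF wS o Ck_on_potential p, folded z_def]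
  have NN: "(?K ** ?R ** adjoint_mat ?K) $ None $ None =
     - (?f'' * ?f + (?f * (?f * ((?D'' * ?D - ?D' * ?D') / ?D\<^sup>2)) + ?f' * ?f * (?D' / ?D))) / 2"
    unfolding KRK L(1) using d(2) z s by (simp add: mult_ac)
  have SS: "(\<chi> i j. (?K ** ?R ** adjoint_mat ?K) $ Some i $ Some j)
     = ricci_form (gt \<tau>) z + (\<chi> i j. ((?f' + ?f * (?D' / ?D)) / 2) * curv z $ i $ j)"
  proof -
    let ?F1 = "frechet_derivative potential (at (t w, z)) (1, 0)"
    have F1: "?F1 = (?f' + ?f * (?D' / ?D)) - 2" using d(1) z s by simp
    have "- 2 * (levi (hess2 (\<lambda>z. potential (t w, z)) z) (axis i 1) (axis j 1) - ?F1 * curv z $ i $ j / 4)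
      = ricci_form (gt \<tau>) z $ i $ j + ((?f' + ?f * (?D' / ?D)) / 2) * curv z $ i $ j" for i j
    proof -
      \<comment> \<open>The curvature term from the summand \<open>l\<close> of the potential
        cancels the - 2 in its radial derivative.\<close>
      have alg: "- 2 * (X - (q - 2) * c / 4) = r + q / 2 * c" if "2 * X = - r - c" for X q c r :: complex
      proof -
        have X: "X = (- r - c) / 2" unfolding that[symmetric] by simp
        show ?thesis unfolding X by (simp add: field_simps)
      qed
      show ?thesis unfolding F1 by (rule alg) (simp only: iddbar_potential_slice[OF s z] \<tau>_def)
    qed
    then show ?thesis unfolding KRK L(2) by (simp add: vec_eq_iff)
  qed
  have inv: "invertible (gt \<tau> z)" using hermitian_pos_invertible[OF hermitian_gt[OF s z]] by (simp add: \<tau>_def)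
  have K: "invertible ?K" "invertible (adjoint_mat ?K)"
    using nz by (simp_all add: invertible_det_nz det_adjoint_mat det_frame)
  have "scal bundle_metric w = trace (?R ** matrix_inv (bundle_metric w))"
    by (simp add: scal_def form_endo_def trace_transpose)
  also have "\<dots> = trace ((?K ** ?R ** adjoint_mat ?K) ** matrix_inv (block_diag ?f (gt \<tau> z)))"
    using trace_congruence[OF invertible_bundle_metric[OF w] K]
    by (simp only: frame_bundle_metric[OF w] z_def \<tau>_def)
  also have "\<dots> = (?K ** ?R ** adjoint_mat ?K) $ None $ None / ?f
      + trace ((ricci_form (gt \<tau>) z + (\<chi> i j. ((?f' + ?f * (?D' / ?D)) / 2) * curv z $ i $ j)) ** matrix_inv (gt \<tau> z))"
    unfolding SS[symmetric] by (rule trace_mult_block_diag[OF _ inv]) (use \<phi> in simp)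
  also have "trace ((ricci_form (gt \<tau>) z + (\<chi> i j. ((?f' + ?f * (?D' / ?D)) / 2) * curv z $ i $ j)) ** matrix_inv (gt \<tau> z))
     = scal (gt \<tau>) z + ((?f' + ?f * (?D' / ?D)) / 2) * trace (curv z ** matrix_inv (gt \<tau> z))"
  proof -
    have "trace ((A + (\<chi> i j. c * B $ i $ j)) ** N) = trace (A ** N) + c * trace (B ** N)" for A B N :: "complex^'n^'n" and c
      by (simp add: trace_def matrix_matrix_mult_def algebra_simps sum.distrib sum_distrib_left)
    then show ?thesis by (simp only: scal_def form_endo_def trace_transpose)
  qed
  also have "trace (curv z ** matrix_inv (gt \<tau> z)) = - ?D' / ?D"
    unfolding \<tau>_def by (rule trace_curv[OF s z])
  \<comment> \<open>The terms with \<open>?D'\<close> squared from fibre and base cancel, while the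
    two halves of \<open>?f' * ?D' / ?D\<close> add up; this leaves the expanded second derivative
    of the product.\<close>
  also have "(?K ** ?R ** adjoint_mat ?K) $ None $ None / ?f
      + (scal (gt \<tau>) z + ((?f' + ?f * (?D' / ?D)) / 2) * (- ?D' / ?D))
      = scal (gt \<tau>) z - (?f'' * ?D + 2 * ?f' * ?D' + ?f * ?D'') / (2 * ?D)"
  proof -
    have "- (f'' * f + (f * (f * ((d'' * d - d' * d') / d\<^sup>2)) + f' * f * (d' / d))) / 2 / f
        + (r + ((f' + f * (d' / d)) / 2) * (- d' / d)) = r - (f'' * d + 2 * f' * d' + f * d'') / (2 * d)"
      if "f \<noteq> 0" "d \<noteq> 0" for f f' f'' d d' d'' r :: complex
      using that by (simp add: field_simps power2_eq_square)
    then show ?thesis unfolding NN using D \<phi> by simp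
  qed
  finally show ?thesis .
qed

end

section \<open>The profile of a momentum construction\<close>

text \<open>Monotone convergence to an infimum, possibly infinite. It identifies the
  \<open>Lim\<close> in \<open>profile_t1\<close>, which has a meaning only once convergence is
  known.\<close>

lemma Lim_at_right_mono:
  fixes k :: "ereal \<Rightarrow> ereal"
  assumes ab: "a < b" and mono: "\<And>x y. a < x \<Longrightarrow> x \<le> y \<Longrightarrow> y < b \<Longrightarrow> k x \<le> k y"
  shows "Lim (at_right a) k = Inf (k ` {a<..<b})"
proof (rule tendsto_Lim)
  show "at_right a \<noteq> bot"
  proof
    assume "at_right a = bot"
    then obtain c where "c > a" "\<And>y. y > a \<Longrightarrow> y < c \<Longrightarrow> False"
      using eventually_at_right[OF ab, of "\<lambda>_. False"] by auto
    then show False using dense by blast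
  qed
  show "(k \<longlongrightarrow> Inf (k ` {a<..<b})) (at_right a)"
  proof (rule order_tendstoI)
    fix y assume y: "y < Inf (k ` {a<..<b})"
    then have "y < k x" if "a < x" "x < b" for x
      using that by (meson INF_lower greaterThanLessThan_iff order_less_le_trans)
    then show "\<forall>\<^sub>F x in at_right a. y < k x"
      unfolding eventually_at_right[OF ab] using ab by blast
  next
    fix y assume "Inf (k ` {a<..<b}) < y"
    then obtain c where c: "a < c" "c < b" "k c < y" by (auto simp: INF_less_iff)
    have "k x < y" if "a < x" "x < c" for x
      using mono[of x c] that c by force
    then show "\<forall>\<^sub>F x in at_right a. k x < y"
      unfolding eventually_at_right[OF ab] using c by blast
  qed
qed

lemma Lim_at_left_mono:
  fixes k :: "ereal \<Rightarrow> ereal"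
  assumes ab: "a < b" and mono: "\<And>x y. a < x \<Longrightarrow> x \<le> y \<Longrightarrow> y < b \<Longrightarrow> k x \<le> k y"
  shows "Lim (at_left b) k = Sup (k ` {a<..<b})"
proof (rule tendsto_Lim)
  show "at_left b \<noteq> bot"
  proof
    assume "at_left b = bot"
    then obtain c where "c < b" "\<And>y. y > c \<Longrightarrow> y < b \<Longrightarrow> False"
      using eventually_at_left[OF ab, of "\<lambda>_. False"] by auto
    then show False using dense by blast
  qed
  show "(k \<longlongrightarrow> Sup (k ` {a<..<b})) (at_left b)"
  proof (rule order_tendstoI)
    fix y assume y: "Sup (k ` {a<..<b}) < y"
    then have "k x < y" if "a < x" "x < b" for x
      using that by (meson SUP_upper greaterThanLessThan_iff order_le_less_trans)
    then show "\<forall>\<^sub>F x in at_left b. k x < y"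
      unfolding eventually_at_left[OF ab] using ab by blast
  next
    fix y assume "y < Sup (k ` {a<..<b})"
    then obtain c where c: "a < c" "c < b" "y < k c" by (auto simp: less_SUP_iff)
    have "y < k x" if "c < x" "x < b" for x
      using mono[of c x] that c by force
    then show "\<forall>\<^sub>F x in at_left b. y < k x"
      unfolding eventually_at_left[OF ab] using c by blast
  qed
qed

lemma interval_integral_has_field_derivative:
  fixes q :: "real \<Rightarrow> real"
  assumes q: "continuous_on {a<..<b} q" and c: "c \<in> {a<..<b}" and x: "x \<in> {a<..<b}"
  shows "((\<lambda>u. LBINT y=ereal c..ereal u. q y) has_field_derivative q x) (at x)"
proof -
  \<comment> \<open>A compact subinterval that contains \<open>c\<close> and has \<open>x\<close> in
    its interior: \<open>q\<close> may be unbounded near \<open>a\<close> and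
    \<open>b\<close>.\<close>
  define a' b' where "a' = (a + min x c) / 2" and "b' = (b + max x c) / 2"
  have ab: "a < a'" "a' < x" "a' \<le> c" "x < b'" "c \<le> b'" "b' < b"
    using c x by (auto simp: a'_def b'_def min_def max_def)
  have "continuous_on {a'..b'} q" by (rule continuous_on_subset[OF q]) (use ab in auto)
  then have "((\<lambda>u. LBINT y=ereal c..ereal u. q y) has_vector_derivative q x) (at x within {a'..b'})"
    by (rule interval_integral_FTC2[OF ab(3,5)]) (use ab in auto)
  moreover have "at x within {a'..b'} = at x" using ab by (simp add: at_within_Icc_at)
  ultimately show ?thesis by (simp add: has_real_derivative_iff_has_vector_derivative)
qed

locale positive_profile =
  fixes \<epsilon> \<tau>0 :: real and \<phi> :: "real \<Rightarrow> real"
  assumes \<tau>0: "\<tau>0 \<in> {0<..<\<epsilon>}" and cont: "continuous_on {0<..<\<epsilon>} \<phi>"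
    and pos: "x \<in> {0<..<\<epsilon>} \<Longrightarrow> 0 < \<phi> x"
begin

abbreviation "I \<equiv> {0..<\<epsilon>}"
abbreviation "J \<equiv> {0<..<\<epsilon>}"
abbreviation "pt x \<equiv> profile_t \<phi> \<tau>0 (ereal x)"

lemma DERIV_profile_t: "x \<in> J \<Longrightarrow> (pt has_field_derivative 1 / \<phi> x) (at x)"
  unfolding profile_t_def
  by (rule interval_integral_has_field_derivative[OF _ \<tau>0]) (use cont pos in \<open>force intro!: continuous_intros\<close>)+

lemma pt_strict_mono: "x \<in> J \<Longrightarrow> y \<in> J \<Longrightarrow> x < y \<Longrightarrow> pt x < pt y"
  by (rule DERIV_pos_imp_increasing) (use DERIV_profile_t pos in force)+

lemma inj_pt: "inj_on pt J"
  by (rule linorder_inj_onI) (use pt_strict_mono in force)+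

lemma continuous_pt: "continuous_on J pt"
  by (intro continuous_at_imp_continuous_on ballI DERIV_isCont[OF DERIV_profile_t])

lemma open_pt_image: "open (pt ` J)"
  using injective_eq_1d_open_map_UNIV[OF continuous_pt] inj_pt by (simp add: is_interval_convex)

lemma profile_mu_pt: "x \<in> J \<Longrightarrow> profile_mu I \<phi> \<tau>0 (pt x) = x"
  unfolding profile_mu_def using inj_pt by (auto simp: inj_on_def intro!: the_equality)

text \<open>The inverse function theorem for \<open>pt' = 1 / \<phi>\<close>. With
  \<open>DERIV_profile_f\<close>, where \<open>x / \<phi>\<close> is multiplied by
  \<open>\<phi>\<close>, it supplies the equations of \<open>momentum_chart\<close>.\<close>

lemma DERIV_profile_mu:
  assumes "x \<in> J" shows "(profile_mu I \<phi> \<tau>0 has_field_derivative \<phi> x) (at (pt x))"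
  unfolding has_field_derivative_def
proof (rule has_derivative_inverse_strong[OF open_greaterThanLessThan assms continuous_pt profile_mu_pt])
  show "(pt has_derivative (*) (1 / \<phi> x)) (at x)"
    using DERIV_profile_t[OF assms] by (simp only: has_field_derivative_def)
  show "(*) (1 / \<phi> x) \<circ> (*) (\<phi> x) = id" using pos[OF assms] by auto
qed

lemma DERIV_profile_f:
  assumes "x \<in> J" shows "(profile_f I \<phi> \<tau>0 has_field_derivative x) (at (pt x))"
proof -
  have "((\<lambda>u. LBINT y=ereal \<tau>0..ereal u. y / \<phi> y) has_field_derivative x / \<phi> x) (at (profile_mu I \<phi> \<tau>0 (pt x)))"
    unfolding profile_mu_pt[OF assms]
    by (rule interval_integral_has_field_derivative[OF _ \<tau>0 assms]) (use cont pos in \<open>force intro!: continuous_intros\<close>)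
  from DERIV_chain2[OF this DERIV_profile_mu[OF assms]] show ?thesis
    unfolding profile_f_def using pos[OF assms] by simp
qed

text \<open>Strict because \<open>x / 2\<close> and \<open>(x + \<epsilon>) / 2\<close> give values
  of \<open>pt\<close> on either side. It shows that each interior \<open>\<tau>\<close> occurs on
  the domain of the induced metric.\<close>

lemma pt_between:
  assumes "x \<in> J"
  shows "profile_t1 I \<phi> \<tau>0 < ereal (pt x)" "ereal (pt x) < profile_t2 I \<phi> \<tau>0"
proof -
  have \<epsilon>: "0 < \<epsilon>" using \<tau>0 by auto
  have int: "interior I = J" by simp
  have img: "ereal ` J = {0<..<ereal \<epsilon>}"
  proof (intro equalityI subsetI)
    fix y assume "y \<in> {0<..<ereal \<epsilon>}"
    then show "y \<in> ereal ` J" by (cases y) auto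
  qed (auto simp: zero_ereal_def)
  have inf: "Inf (ereal ` interior I) = 0" and sup: "Sup (ereal ` interior I) = ereal \<epsilon>"
    unfolding int img using \<epsilon> by (auto intro: cInf_greaterThanLessThan cSup_greaterThanLessThan)
  let ?k = "\<lambda>\<tau>. ereal (profile_t \<phi> \<tau>0 \<tau>)"
  have mono: "?k u \<le> ?k v" if uv: "0 < u" "u \<le> v" "v < ereal \<epsilon>" for u v
  proof -
    have "u \<in> ereal ` J" "v \<in> ereal ` J" unfolding img using uv by auto
    then obtain p q where "u = ereal p" "v = ereal q" "p \<in> J" "q \<in> J" by blast
    then show ?thesis using pt_strict_mono[of p q] uv(2) by (cases "p = q") auto
  qed
  have 0: "0 < ereal \<epsilon>" using \<epsilon> by simp
  have "profile_t1 I \<phi> \<tau>0 = Inf (?k ` ereal ` J)"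
    unfolding profile_t1_def inf img by (rule Lim_at_right_mono[OF 0 mono])
  also have "\<dots> \<le> ?k (ereal (x / 2))" by (intro Inf_lower imageI) (use assms in auto)
  also have "\<dots> < ereal (pt x)" using assms by (auto intro!: pt_strict_mono)
  finally show "profile_t1 I \<phi> \<tau>0 < ereal (pt x)" .
  have "ereal (pt x) < ?k (ereal ((x + \<epsilon>) / 2))" using assms by (auto intro!: pt_strict_mono)
  also have "\<dots> \<le> Sup (?k ` ereal ` J)" by (intro Sup_upper imageI) (use assms in auto)
  also have "\<dots> = profile_t2 I \<phi> \<tau>0"
    unfolding profile_t2_def sup img by (rule Lim_at_left_mono[OF 0 mono, symmetric])
  finally show "ereal (pt x) < profile_t2 I \<phi> \<tau>0" .
qed

end

section \<open>From charts and trivializations to the local model\<close>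

lemma scal_cong_open:
  assumes "open U" "w \<in> U" "\<And>y. y \<in> U \<Longrightarrow> G y = G' y"
  shows "scal G w = scal G' w"
  using assms(3)[OF assms(2)] iddbar_cong_open[OF assms(1,2), of "\<lambda>w. ln (det (G w))" "\<lambda>w. ln (det (G' w))"] assms(3)
  by (simp add: scal_def ricci_form_def)

definition chart_dom :: "('a, 'n::finite) chart \<Rightarrow> ('a, 'l) triv \<Rightarrow> (complex^'n) set" where
  "chart_dom c T = snd c ` (fst c \<inter> fst T)"

definition log_h :: "('a, 'l) line_bundle_data \<Rightarrow> ('a, 'n::finite) chart \<Rightarrow> ('a, 'l) triv \<Rightarrow> complex^'n \<Rightarrow> real" where
  "log_h L c T z = ln (local_h L T (chart_inv c z))"

locale horizontal_chart =
  fixes M :: "('a, 'n::finite) kaehler_data" and L :: "('a, 'l) line_bundle_data" and I :: "real set"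
    and c :: "('a, 'n) chart" and T :: "('a, 'l) triv"
  assumes horizontal: "horizontal_data M L I" and c: "c \<in> atlas M" and T: "T \<in> trivs L"
begin

lemma kaehler: "kaehler_manifold M" and line_bundle: "holomorphic_line_bundle M L" and metric: "hermitian_metric M L"
  using horizontal by (auto simp only: horizontal_data_def)

lemma manifold: "complex_manifold (mspace M) (atlas M)"
  using kaehler by (simp only: kaehler_manifold_def)

lemma chart_open: "openin (mspace M) (fst c)" and chart_image_open: "open (snd c ` fst c)"
  and chart_homeo: "homeomorphic_map (subtopology (mspace M) (fst c)) (top_of_set (snd c ` fst c)) (snd c)"
  using manifold c unfolding complex_manifold_def by blast+

lemma triv_open: "openin (mspace M) (fst T)"
  and triv_homeo: "homeomorphic_map (subtopology (total L) (over L (fst T)))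
          (prod_topology (subtopology (mspace M) (fst T)) euclidean) (\<lambda>v. (proj L v, snd T v))"
  using line_bundle T unfolding holomorphic_line_bundle_def by blast+

lemma chart_inj: "inj_on (snd c) (fst c)"
  using homeomorphic_imp_injective_map[OF chart_homeo] openin_subset[OF chart_open]
  by (simp add: Int_absorb1)

lemma chart_inv_apply: "x \<in> fst c \<Longrightarrow> chart_inv c (snd c x) = x"
  unfolding chart_inv_def by (rule inv_into_f_f[OF chart_inj])

lemma open_chart_dom: "open (chart_dom c T)"
proof -
  have "openin (subtopology (mspace M) (fst c)) (fst c \<inter> fst T)"
    using triv_open by (auto simp: openin_subtopology)
  then have "openin (top_of_set (snd c ` fst c)) (snd c ` (fst c \<inter> fst T))"
    using homeomorphic_imp_open_map[OF chart_homeo] by (simp add: open_map_def)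
  then show ?thesis
    unfolding chart_dom_def using chart_image_open openin_open_eq by blast
qed

lemma local_h_pos: "x \<in> fst T \<Longrightarrow> 0 < local_h L T x"
  and sqnorm_eq: "v \<in> over L (fst T) \<Longrightarrow> sqnorm L v = (cmod (snd T v))\<^sup>2 * local_h L T (proj L v)"
  and local_h_smooth: "Ck_on k (chart_dom c T) (\<lambda>z. local_h L T (chart_inv c z))"
  using metric T c unfolding hermitian_metric_def chart_dom_def smooth_on_def by blast+

lemma chart_inv_mem: "z \<in> chart_dom c T \<Longrightarrow> chart_inv c z \<in> fst c \<inter> fst T"
  by (auto simp: chart_dom_def chart_inv_apply)

lemma Ck_on_log_h: "Ck_on k (chart_dom c T) (log_h L c T)"
  unfolding log_h_def[abs_def]
  by (rule Ck_on_logarithm[OF open_chart_dom local_h_smooth])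
    (use local_h_pos chart_inv_mem in \<open>force intro: DERIV_ln\<close>)+

sublocale hermitian_chart "chart_dom c T" "log_h L c T"
  by unfold_locales (rule open_chart_dom Ck_on_log_h)+

lemma curv_eq: "curv = curv_form L c T"
  by (simp add: fun_eq_iff curv_def curv_form_def log_h_def)

lemma metric_smooth: "Ck_on k (chart_dom c T) (\<lambda>z. metric M c z $ i $ j)"
proof -
  have "smooth_on (snd c ` fst c) (metric M c)"
    using kaehler c unfolding kaehler_manifold_def by blast
  then have "Ck_on k (chart_dom c T) (metric M c)"
    unfolding smooth_on_def chart_dom_def by (blast intro: Ck_on_subset)
  then show ?thesis
    by (rule Ck_on_linear_compose[OF open_chart_dom
          bounded_linear_compose[OF bounded_linear_vec_nth bounded_linear_vec_nth]])
qed

lemma metric_pos: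
  assumes "\<tau> \<in> I" "z \<in> chart_dom c T"
  shows "hermitian_pos (metric M c z - \<tau> *\<^sub>R curv z)"
proof -
  obtain x where x: "x \<in> fst c \<inter> fst T" "z = snd c x" using assms(2) by (auto simp: chart_dom_def)
  have "hermitian_pos (metric_at M L \<tau> c T (snd c x))"
    using horizontal assms(1) c T x(1) unfolding horizontal_data_def by blast
  then show ?thesis by (simp add: metric_at_def curv_eq x(2))
qed

lemma bundle_chart_surj:
  assumes "base_part w \<in> chart_dom c T"
  shows "\<exists>v\<in>over L (fst c \<inter> fst T). snd (bundle_chart L c T) v = w"
proof -
  obtain x where x: "x \<in> fst c \<inter> fst T" "base_part w = snd c x" using assms by (auto simp: chart_dom_def)
  have "(\<lambda>v. (proj L v, snd T v)) ` over L (fst T) = fst T \<times> UNIV"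
  proof -
    have "topspace (total L) \<inter> over L (fst T) = over L (fst T)" by (auto simp: over_def)
    then show ?thesis
      using homeomorphic_imp_surjective_map[OF triv_homeo] openin_subset[OF triv_open]
      by (simp add: Int_absorb1)
  qed
  then have "(x, w $ None) \<in> (\<lambda>v. (proj L v, snd T v)) ` over L (fst T)" using x by auto
  then obtain v where v: "v \<in> over L (fst T)" "proj L v = x" "snd T v = w $ None" by auto
  have "snd (bundle_chart L c T) v = w"
    using v x by (auto simp: bundle_chart_def vec_eq_iff base_part_def split: option.split)
  moreover have "v \<in> over L (fst c \<inter> fst T)" using v x by (auto simp: over_def)
  ultimately show ?thesis by blast
qed

lemma bundle_chart_components:
  "snd (bundle_chart L c T) v $ None = snd T v"
  "base_part (snd (bundle_chart L c T) v) = snd c (proj L v)"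
  by (simp_all add: bundle_chart_def base_part_def)

lemma log_norm_eq:
  assumes "v \<in> over L (fst c \<inter> fst T)" "snd T v \<noteq> 0"
  shows "log_norm L v = t (snd (bundle_chart L c T) v)" "sqnorm L v \<noteq> 0"
proof -
  have v: "v \<in> over L (fst T)" "proj L v \<in> fst c \<inter> fst T" using assms by (auto simp: over_def)
  have h: "0 < local_h L T (proj L v)" using local_h_pos v by blast
  show "sqnorm L v \<noteq> 0" using h assms(2) by (simp add: sqnorm_eq[OF v(1)])
  show "log_norm L v = t (snd (bundle_chart L c T) v)"
    using h assms(2) v(2)
    by (simp add: log_norm_def sqnorm_eq[OF v(1)] log_radius_def bundle_chart_components log_h_def
        chart_inv_apply ln_mult ln_realpow add_divide_distrib)
qed

text \<open>\<open>inv_into\<close> serves as a right inverse: the log norm of a preimage is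
  determined by its coordinates, and \<open>bundle_chart_surj\<close> provides a preimage.\<close>

lemma log_norm_chart_inv:
  assumes "w \<in> slit (chart_dom c T)"
  shows "log_norm L (chart_inv (bundle_chart L c T) w) = t w"
proof -
  let ?v = "chart_inv (bundle_chart L c T) w"
  have w: "base_part w \<in> chart_dom c T" "w $ None \<noteq> 0" using assms by (auto simp: slit_def)
  have im: "w \<in> snd (bundle_chart L c T) ` over L (fst c \<inter> fst T)" using bundle_chart_surj[OF w(1)] by blast
  have fst: "fst (bundle_chart L c T) = over L (fst c \<inter> fst T)" by (simp add: bundle_chart_def)
  have "?v \<in> over L (fst c \<inter> fst T)" and eq: "snd (bundle_chart L c T) ?v = w"
    unfolding chart_inv_def fst using inv_into_into[OF im] f_inv_into_f[OF im] by auto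
  then show ?thesis
    using log_norm_eq[of ?v] w(2) bundle_chart_components(1)[of ?v] by simp
qed

end

lemma momentum_profile_extension:
  assumes "momentum_profile {0..<\<epsilon>} \<phi>" "0 < \<epsilon>"
  obtains U \<psi> where "open U" "{0..\<epsilon>} \<subseteq> U" "\<And>k. Ck_on k U \<psi>" "\<And>x. x \<in> {0..\<epsilon>} \<Longrightarrow> \<psi> x = \<phi> x"
    "\<And>x. x \<in> {0<..<\<epsilon>} \<Longrightarrow> 0 < \<phi> x"
proof -
  have cl: "closure {0..<\<epsilon>} = {0..\<epsilon>}" using assms(2) by simp
  obtain U \<psi> where "open U" "{0..\<epsilon>} \<subseteq> U" "\<forall>k. Ck_on k U \<psi>" "\<forall>x\<in>{0..\<epsilon>}. \<psi> x = \<phi> x"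
    using assms(1) unfolding momentum_profile_def smooth_on_def cl by blast
  moreover have "\<forall>x\<in>{0<..<\<epsilon>}. 0 < \<phi> x" using assms(1) by (simp add: momentum_profile_def)
  ultimately show thesis using that[of U \<psi>] by blast
qed

text \<open>Above \<open>x\<close> there is a vector whose log norm is \<open>pt \<tau>\<close>. It
  lies in the induced domain, so the assumed constant value can be compared with the local formula
  at this very \<open>\<tau>\<close>.\<close>

lemma scal_induced:
  fixes M :: "('a, 'n::finite) kaehler_data" and L :: "('a, 'l) line_bundle_data"
  assumes "0 < \<epsilon>" and hd: "horizontal_data M L {0..<\<epsilon>}" and \<tau>0: "\<tau>0 \<in> {0<..<\<epsilon>}"
    and prof: "momentum_profile {0..<\<epsilon>} \<phi>" and ics: "induces_constant_scal M L {0..<\<epsilon>} \<tau>0 \<phi> s"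
    and c: "c \<in> atlas M" and T: "T \<in> trivs L" and x: "x \<in> fst c \<inter> fst T" and \<tau>: "\<tau> \<in> {0<..<\<epsilon>}"
  defines "P \<equiv> det_pencil (metric M c (snd c x)) (curv_form L c T (snd c x))"
  shows "of_real s = scal (metric_at M L \<tau> c T) (snd c x) -
    (of_real (deriv (deriv \<phi>) \<tau>) * poly P (of_real \<tau>)
      + 2 * of_real (deriv \<phi> \<tau>) * poly (pderiv P) (of_real \<tau>)
      + of_real (\<phi> \<tau>) * poly (pderiv (pderiv P)) (of_real \<tau>)) / (2 * poly P (of_real \<tau>))"
proof -
  let ?I = "{0..<\<epsilon>}" and ?J = "{0<..<\<epsilon>}"
  interpret horizontal_chart M L ?I c T using hd c T by unfold_locales
  obtain U \<psi> where U: "open U" "{0..\<epsilon>} \<subseteq> U" "\<And>k. Ck_on k U \<psi>" "\<And>x. x \<in> {0..\<epsilon>} \<Longrightarrow> \<psi> x = \<phi> x"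
    and \<phi>_pos: "\<And>x. x \<in> ?J \<Longrightarrow> 0 < \<phi> x"
    using momentum_profile_extension[OF prof assms(1)] by blast
  have C: "Ck_on k ?J \<phi>" for k
    by (rule Ck_on_cong[OF _ Ck_on_subset[OF U(3)]]) (use U(2,4) in auto)
  interpret pp: positive_profile \<epsilon> \<tau>0 \<phi>
    using \<tau>0 \<phi>_pos Ck_on_continuous_on[OF C] by unfold_locales auto
  let ?\<mu> = "profile_mu ?I \<phi> \<tau>0" and ?f = "profile_f ?I \<phi> \<tau>0"
  interpret mc: momentum_chart "chart_dom c T" "log_h L c T" "metric M c" ?J "pp.pt ` ?J" \<phi> ?\<mu> ?f
  proof unfold_locales
    show "open (pp.pt ` ?J)" by (rule pp.open_pt_image)
  qed (use metric_smooth C \<phi>_pos metric_pos pp.profile_mu_pt pp.DERIV_profile_mu pp.DERIV_profile_f in auto)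
  let ?z = "snd c x"
  have z: "?z \<in> chart_dom c T" using x by (auto simp: chart_dom_def)
  \<comment> \<open>Solves \<open>ln |\<zeta>| + ln h / 2 = pt \<tau>\<close>, so that
    \<open>t w = pt \<tau>\<close> and the momentum at \<open>w\<close> is
    \<open>\<tau>\<close>.\<close>
  define \<zeta> where "\<zeta> = complex_of_real (exp (pp.pt \<tau> - log_h L c T ?z / 2))"
  define w where "w = (\<chi> A. case A of None \<Rightarrow> \<zeta> | Some i \<Rightarrow> ?z $ i)"
  have bw: "base_part w = ?z" and w0: "w $ None = \<zeta>" and \<zeta>: "\<zeta> \<noteq> 0"
    by (simp_all add: w_def base_part_def \<zeta>_def)
  have w_slit: "w \<in> slit (chart_dom c T)" using z \<zeta> by (simp add: slit_def bw w0)
  have tw: "t w = pp.pt \<tau>" by (simp add: log_radius_def bw w0 \<zeta>_def norm_exp_eq_Re)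
  have w_dom: "w \<in> mc.dom" using w_slit tw \<tau> by (simp add: mc.dom_def)
  obtain v where v: "v \<in> over L (fst c \<inter> fst T)" "snd (bundle_chart L c T) v = w"
    using bundle_chart_surj[of w] z bw by auto
  have Tv: "snd T v \<noteq> 0" using bundle_chart_components(1)[of v] v(2) w0 \<zeta> by simp
  have "v \<in> induced_domain L ?I \<tau>0 \<phi>"
    using log_norm_eq[OF v(1) Tv] pp.pt_between[OF \<tau>] v tw by (simp add: induced_domain_def over_def)
  then have "of_real s = scal (induced_metric M L ?I \<tau>0 \<phi> c T) w"
    using ics c T v unfolding induces_constant_scal_def by auto
  also have "\<dots> = scal mc.bundle_metric w"
  proof (rule scal_cong_open[OF open_slit[OF open_chart_dom] w_slit])
    fix y assume y: "y \<in> slit (chart_dom c T)"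
    show "induced_metric M L ?I \<tau>0 \<phi> c T y = mc.bundle_metric y"
      unfolding induced_metric_def mc.bundle_metric_def
      by (subst iddbar_cong_open[OF open_slit[OF open_chart_dom] y, of _ "\<lambda>w'. of_real (?f (t w'))"])
        (simp_all add: log_norm_chart_inv)
  qed
  also note mc.scal_bundle_metric[OF w_dom]
  finally show ?thesis
    by (simp only: bw tw pp.profile_mu_pt[OF \<tau>] P_def curv_eq metric_at_def[abs_def])
qed

section \<open>Uniqueness for the momentum equation\<close>

lemma has_vector_derivative_poly_of_real:
  "((\<lambda>x. poly p (of_real x :: complex)) has_vector_derivative poly (pderiv p) (of_real x)) (at x)"
proof -
  have "((\<lambda>x. of_real x :: complex) has_vector_derivative 1) (at x)"
    using has_vector_derivative_of_real[OF DERIV_ident] by simp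
  from field_vector_diff_chain_at[OF this poly_DERIV] show ?thesis by (simp add: o_def)
qed

text \<open>The imaginary part vanishes on the whole interval, hence so does its derivative. Needed
  because \<open>sigma_constant\<close> asks for real constants while \<open>scal\<close> is
  complex.\<close>

lemma poly_pderiv_real:
  assumes "\<And>x. x \<in> {a<..<b} \<Longrightarrow> poly p (of_real x :: complex) \<in> \<real>" "x \<in> {a<..<b}"
  shows "poly (pderiv p) (of_real x) \<in> \<real>"
proof -
  have "((\<lambda>x. Im (poly p (of_real x))) has_vector_derivative Im (poly (pderiv p) (of_real x))) (at x)"
    using bounded_linear.has_vector_derivative[OF bounded_linear_Im has_vector_derivative_poly_of_real] .
  moreover have "((\<lambda>x. Im (poly p (of_real x))) has_vector_derivative 0) (at x)"
    by (rule has_vector_derivative_transform_within_open[OF has_vector_derivative_const[of 0] open_greaterThanLessThan assms(2)])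
      (use assms(1) in \<open>simp add: complex_is_Real_iff\<close>)
  ultimately have "Im (poly (pderiv p) (of_real x)) = 0" by (rule vector_derivative_unique_at)
  then show ?thesis by (simp add: complex_is_Real_iff)
qed

lemma poly_eqI_interval:
  fixes p q :: "complex poly"
  assumes "a < b" "\<And>x. x \<in> {a<..<b} \<Longrightarrow> poly p (of_real x) = poly q (of_real x)"
  shows "p = q"
proof (rule ccontr)
  assume "p \<noteq> q"
  then have "finite {x. poly (p - q) x = 0}" by (intro poly_roots_finite) simp
  moreover have "complex_of_real ` {a<..<b} \<subseteq> {x. poly (p - q) x = 0}" using assms(2) by auto
  ultimately have "finite (complex_of_real ` {a<..<b})" by (rule finite_subset[rotated])
  then have "finite {a<..<b}" by (rule finite_imageD) (simp add: inj_on_def)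
  then show False using assms(1) infinite_Ioo by blast
qed

text \<open>The Euler operator \<open>X d/dX\<close> preserves the factor \<open>X^k\<close>, which
  avoids the truncated exponent \<open>k - 1\<close>.\<close>

lemma pderiv_X_power_mult:
  fixes e :: "complex poly"
  shows "[:0, 1:] * pderiv ([:0, 1:] ^ k * e) = [:0, 1:] ^ k * (smult (of_nat k) e + [:0, 1:] * pderiv e)"
proof (cases k)
  case (Suc m)
  have "pderiv ([:0, 1:] ^ k) = smult (of_nat k) ([:0, 1::complex:] ^ m)"
    unfolding Suc pderiv_power_Suc by (simp add: pderiv_pCons)
  moreover have "X * (X * Y * f + e * smult c Y) = X * Y * (smult c e + X * f)" for X Y f :: "complex poly" and c
    by (simp add: algebra_simps)
  ultimately show ?thesis by (simp only: pderiv_mult) (simp only: Suc power_Suc)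
qed simp

text \<open>The second identity applies the Euler operator \<open>E = x d/dx\<close> twice and uses
  \<open>x^2 p'' = E (E p) - E p\<close>.\<close>

lemma poly_pderiv_X_power_mult:
  fixes e :: "complex poly" and k :: nat
  defines "d \<equiv> [:0, 1:] ^ k * e"
  shows "x * poly (pderiv d) x = x ^ k * (of_nat k * poly e x + x * poly (pderiv e) x)" (is "?L1 = ?R1")
    and "x\<^sup>2 * poly (pderiv (pderiv d)) x = x ^ k * (of_nat k * (of_nat k - 1) * poly e x
       + 2 * of_nat k * x * poly (pderiv e) x + x\<^sup>2 * poly (pderiv (pderiv e)) x)" (is "?L2 = ?R2")
proof -
  let ?e1 = "smult (of_nat k) e + [:0, 1:] * pderiv e"
  have d: "[:0, 1:] * pderiv d = [:0, 1:] ^ k * ?e1" unfolding d_def by (rule pderiv_X_power_mult)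
  from arg_cong[OF this, of "\<lambda>p. poly p x"] show 1: "?L1 = ?R1" by (simp add: poly_power)
  have "[:0, 1:] * pderiv ([:0, 1:] * pderiv d) = [:0, 1:] ^ k * (smult (of_nat k) ?e1 + [:0, 1:] * pderiv ?e1)"
    unfolding d by (rule pderiv_X_power_mult)
  from arg_cong[OF this, of "\<lambda>p. poly p x"]
  have "x * poly (pderiv d) x + ?L2 = x ^ k * (of_nat k * (of_nat k * poly e x + x * poly (pderiv e) x)
     + x * (of_nat k * poly (pderiv e) x + poly (pderiv e) x + x * poly (pderiv (pderiv e)) x))"
    by (simp add: poly_power pderiv_mult pderiv_add pderiv_smult pderiv_pCons power2_eq_square algebra_simps)
  then show "?L2 = ?R2" unfolding 1 by (simp add: algebra_simps power2_eq_square)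
qed

text \<open>Near \<open>0\<close> the profile difference \<open>\<psi>\<close> vanishes to order \<open>1\<close> or \<open>2\<close>.  If two solutions \<open>p\<close>, \<open>q\<close> of
  \<open>(\<psi> p)'' = 2 C p\<close> differed, comparing the leading coefficients of the equation for \<open>p - q\<close>,
  which vanishes to order at least \<open>1\<close>, would force \<open>\<psi>'(0) = \<psi>''(0) = C = 0\<close>.\<close>

lemma momentum_ode_unique:
  fixes p q :: "complex poly" and \<psi> :: "real \<Rightarrow> real" and C :: real
  assumes \<epsilon>: "0 < \<epsilon>" and U: "open U" "{0..\<epsilon>} \<subseteq> U" and smooth: "\<And>k. Ck_on k U \<psi>" and \<psi>0: "\<psi> 0 = 0"
    and ode: "\<And>\<tau> r. \<tau> \<in> {0<..<\<epsilon>} \<Longrightarrow> r \<in> {p, q} \<Longrightarrow>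
        of_real (deriv (deriv \<psi>) \<tau>) * poly r (of_real \<tau>) + 2 * of_real (deriv \<psi> \<tau>) * poly (pderiv r) (of_real \<tau>)
          + of_real (\<psi> \<tau>) * poly (pderiv (pderiv r)) (of_real \<tau>) = 2 * of_real C * poly r (of_real \<tau>)"
    and norm: "poly p 0 = 1" "poly q 0 = 1"
    and nz: "\<And>\<tau>. \<tau> \<in> {0<..<\<epsilon>} \<Longrightarrow> poly p (of_real \<tau>) \<noteq> 0"
    and nontrivial: "\<exists>\<tau>\<in>{0<..<\<epsilon>}. \<psi> \<tau> \<noteq> 0"
  shows "p = q"
proof (rule ccontr)
  assume "p \<noteq> q"
  let ?J = "{0<..<\<epsilon>}" and ?F = "at_right (0::real)"
  define d where "d = p - q"
  define \<psi>1 where "\<psi>1 = deriv \<psi>"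
  define \<psi>2 where "\<psi>2 = deriv \<psi>1"
  have U0: "0 \<in> U" and JU: "?J \<subseteq> U" using U(2) \<epsilon> by auto
  have D1: "(\<psi> has_field_derivative \<psi>1 x) (at x)" if "x \<in> U" for x
    unfolding \<psi>1_def using Ck_on_deriv(2)[OF U(1) smooth[of "Suc 0"] that] .
  have C1: "Ck_on k U \<psi>1" for k
    unfolding \<psi>1_def using Ck_on_deriv(1)[OF U(1) smooth[of "Suc k"]] .
  have D2: "(\<psi>1 has_field_derivative \<psi>2 x) (at x)" if "x \<in> U" for x
    unfolding \<psi>2_def using Ck_on_deriv(2)[OF U(1) C1[of "Suc 0"] that] .
  have C2: "Ck_on k U \<psi>2" for k
    unfolding \<psi>2_def using Ck_on_deriv(1)[OF U(1) C1[of "Suc k"]] .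
  have lim: "(f \<longlongrightarrow> f 0) ?F" if "continuous_on U f" for f :: "real \<Rightarrow> real"
    using that U0 U(1) by (simp add: continuous_on_eq_continuous_at isCont_def tendsto_mono[OF at_le])
      (meson at_le tendsto_mono subset_UNIV)
  define A where "A = \<psi>1 0"
  define B where "B = \<psi>2 0"
  have id: "((\<lambda>x. x) \<longlongrightarrow> 0) ?F" by (rule tendsto_ident_at)
  have evJ: "\<forall>\<^sub>F x in ?F. x \<in> ?J"
    using eventually_at_right_less[of 0] \<epsilon> by (auto simp: eventually_at_right)
  have l0: "(\<psi> \<longlongrightarrow> 0) ?F" using lim[OF Ck_on_continuous_on[OF smooth[of 0]]] \<psi>0 by simp
  have l1: "(\<psi>1 \<longlongrightarrow> A) ?F" using lim[OF Ck_on_continuous_on[OF C1[of 0]]] by (simp add: A_def)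
  have l2: "(\<psi>2 \<longlongrightarrow> B) ?F" using lim[OF Ck_on_continuous_on[OF C2[of 0]]] by (simp add: B_def)
  have quot: "((\<lambda>x. f x / x) \<longlongrightarrow> f') ?F" if "(f has_field_derivative f') (at 0)" "f 0 = 0" for f :: "real \<Rightarrow> real" and f'
    using that by (auto simp: has_field_derivative_iff intro: tendsto_mono[OF at_le])
  have q1: "((\<lambda>x. \<psi> x / x) \<longlongrightarrow> A) ?F" using quot[OF D1[OF U0] \<psi>0] by (simp add: A_def)
  have polylim: "((\<lambda>x. poly r (of_real x :: complex)) \<longlongrightarrow> poly r 0) ?F" for r
    by (rule tendsto_eq_rhs[OF tendsto_poly[OF tendsto_of_real[OF id]]]) simp
  have ode': "of_real (\<psi>2 x) * poly r (of_real x) + 2 * of_real (\<psi>1 x) * poly (pderiv r) (of_real x)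
      + of_real (\<psi> x) * poly (pderiv (pderiv r)) (of_real x) = 2 * of_real C * poly r (of_real x)"
    if "x \<in> ?J" "r \<in> {p, q}" for x r
    using ode[OF that] by (simp only: \<psi>2_def \<psi>1_def)
  have lim_eq: "a = b" if "(f \<longlongrightarrow> a) ?F" "(g \<longlongrightarrow> b) ?F" "\<And>x. x \<in> ?J \<Longrightarrow> f x = g x" for f g :: "real \<Rightarrow> complex" and a b
  proof -
    have "\<forall>\<^sub>F x in ?F. f x = g x" using evJ that(3) by (rule eventually_mono)
    then have "(f \<longlongrightarrow> b) ?F" using that(2) tendsto_cong by blast
    then show ?thesis using that(1) tendsto_unique trivial_limit_at_right_real by blast
  qed
  note tends = l0 l1 l2 id q1 polylim tendsto_intros
  \<comment> \<open>The equation for \<open>p\<close> itself at 0. The equation for the difference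
    is homogeneous in it, so the link between \<open>B\<close> and \<open>C\<close> has to come from
    a solution with value 1 at 0.\<close>
  have "of_real B * poly p 0 + 2 * of_real A * poly (pderiv p) 0 + of_real 0 * poly (pderiv (pderiv p)) 0
      = 2 * of_real C * poly p 0"
  proof (rule lim_eq)
    show "((\<lambda>x. of_real (\<psi>2 x) * poly p (of_real x) + 2 * of_real (\<psi>1 x) * poly (pderiv p) (of_real x)
      + of_real (\<psi> x) * poly (pderiv (pderiv p)) (of_real x)) \<longlongrightarrow> of_real B * poly p 0
      + 2 * of_real A * poly (pderiv p) 0 + of_real 0 * poly (pderiv (pderiv p)) 0) ?F"
      by (intro tends)
    show "((\<lambda>x. 2 * of_real C * poly p (of_real x)) \<longlongrightarrow> 2 * of_real C * poly p 0) ?F"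
      by (intro tends)
  qed (use ode'[where r = p] in simp)
  then have eqB: "of_real B + 2 * of_real A * poly (pderiv p) 0 = 2 * complex_of_real C" using norm by simp
  have d0: "d \<noteq> 0" using \<open>p \<noteq> q\<close> by (simp add: d_def)
  define k where "k = order 0 d"
  obtain e where de: "d = [:0, 1:] ^ k * e" and e: "\<not> [:0, 1:] dvd e"
    using order_decomp[OF d0, of 0] by (auto simp: k_def)
  have e0: "poly e 0 \<noteq> 0" using e by (simp add: poly_eq_0_iff_dvd)
  have "poly d 0 = 0" using norm by (simp add: d_def)
  then have k: "k \<noteq> 0" using d0 order_root[of d 0] by (simp add: k_def)
  define E1 where "E1 = (\<lambda>x. of_nat k * poly e x + x * poly (pderiv e) x)"
  define E2 where "E2 = (\<lambda>x. of_nat k * (of_nat k - 1) * poly e x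
       + 2 * of_nat k * x * poly (pderiv e) x + x\<^sup>2 * poly (pderiv (pderiv e)) x)"
  have lE1: "((\<lambda>x. E1 (of_real x)) \<longlongrightarrow> of_nat k * poly e 0) ?F"
  proof -
    have "((\<lambda>x. E1 (of_real x)) \<longlongrightarrow> of_nat k * poly e 0 + of_real 0 * poly (pderiv e) 0) ?F"
      unfolding E1_def by (intro tends)
    then show ?thesis by simp
  qed
  have lE2: "((\<lambda>x. E2 (of_real x)) \<longlongrightarrow> of_nat k * (of_nat k - 1) * poly e 0) ?F"
  proof -
    have "((\<lambda>x. E2 (of_real x)) \<longlongrightarrow> of_nat k * (of_nat k - 1) * poly e 0
       + 2 * of_nat k * of_real 0 * poly (pderiv e) 0 + (of_real 0)\<^sup>2 * poly (pderiv (pderiv e)) 0) ?F"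
      unfolding E2_def by (intro tends)
    then show ?thesis by simp
  qed
  \<comment> \<open>The equation for \<open>d\<close>, multiplied by \<open>X^2\<close> and divided
    by \<open>X^k\<close>: its coefficients now have limits at 0, and the remaining polynomial
    satisfies \<open>e(0) \<noteq> 0\<close>.\<close>
  have main: "of_real (\<psi>2 x) * X\<^sup>2 * poly e X + 2 * of_real (\<psi>1 x) * X * E1 X + of_real (\<psi> x) * E2 X
      = 2 * of_real C * X\<^sup>2 * poly e X" if x: "x \<in> ?J" "X = of_real x" for x X
  proof -
    have "of_real (\<psi>2 x) * poly d X + 2 * of_real (\<psi>1 x) * poly (pderiv d) X
      + of_real (\<psi> x) * poly (pderiv (pderiv d)) X = 2 * of_real C * poly d X"
      using ode'[OF x(1), of p] ode'[OF x(1), of q] by (simp add: d_def pderiv_diff x(2) algebra_simps)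
    then have "of_real (\<psi>2 x) * X\<^sup>2 * poly d X + 2 * of_real (\<psi>1 x) * X * (X * poly (pderiv d) X)
      + of_real (\<psi> x) * (X\<^sup>2 * poly (pderiv (pderiv d)) X) = 2 * of_real C * X\<^sup>2 * poly d X"
      by (simp add: power2_eq_square) algebra
    moreover have "X * poly (pderiv d) X = X ^ k * E1 X" "X\<^sup>2 * poly (pderiv (pderiv d)) X = X ^ k * E2 X"
      unfolding de E1_def E2_def by (rule poly_pderiv_X_power_mult)+
    moreover have "poly d X = X ^ k * poly e X" by (simp add: de poly_power)
    ultimately have "X ^ k * (of_real (\<psi>2 x) * X\<^sup>2 * poly e X + 2 * of_real (\<psi>1 x) * X * E1 X + of_real (\<psi> x) * E2 X)
      = X ^ k * (2 * of_real C * X\<^sup>2 * poly e X)"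
      by (simp add: algebra_simps)
    then show ?thesis using x by simp
  qed
  \<comment> \<open>\<open>main\<close> divided by \<open>x\<close>, in the limit: only
    \<open>A k (k + 1) e(0) = 0\<close> is left, so \<open>A = 0\<close>.\<close>
  have "of_real B * of_real 0 * poly e 0 + 2 * of_real A * (of_nat k * poly e 0)
      + of_real A * (of_nat k * (of_nat k - 1) * poly e 0) = 2 * of_real C * of_real 0 * poly e 0"
  proof (rule lim_eq)
    show "((\<lambda>x. of_real (\<psi>2 x) * of_real x * poly e (of_real x) + 2 * of_real (\<psi>1 x) * E1 (of_real x)
       + of_real (\<psi> x / x) * E2 (of_real x)) \<longlongrightarrow> of_real B * of_real 0 * poly e 0 + 2 * of_real A * (of_nat k * poly e 0)
      + of_real A * (of_nat k * (of_nat k - 1) * poly e 0)) ?F"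
      by (intro tends lE1 lE2)
    show "((\<lambda>x. 2 * of_real C * of_real x * poly e (of_real x)) \<longlongrightarrow> 2 * of_real C * of_real 0 * poly e 0) ?F"
      by (intro tends)
    fix x assume "x \<in> ?J"
    show "of_real (\<psi>2 x) * of_real x * poly e (of_real x) + 2 * of_real (\<psi>1 x) * E1 (of_real x)
       + of_real (\<psi> x / x) * E2 (of_real x) = 2 * of_real C * of_real x * poly e (of_real x)"
    proof -
      have cancel: "p2 * X * e + 2 * p1 * E1 + p0 / X * E2 = 2 * c * X * e"
        if "p2 * X\<^sup>2 * e + 2 * p1 * X * E1 + p0 * E2 = 2 * c * X\<^sup>2 * e" "X \<noteq> 0" for p0 p1 p2 X e E1 E2 c :: complex
      proof -
        have "X * (p2 * X * e + 2 * p1 * E1 + p0 / X * E2) = X * (2 * c * X * e)"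
          using that by (simp add: algebra_simps power2_eq_square)
        then show ?thesis using that(2) by simp
      qed
      from cancel[OF main[OF \<open>x \<in> ?J\<close> refl]] \<open>x \<in> ?J\<close> show ?thesis by simp
    qed
  qed
  then have "of_real A * (of_nat k * (of_nat k + 1) * poly e 0) = 0" by (simp add: algebra_simps)
  moreover have "of_nat k + 1 \<noteq> (0 :: complex)" by (metis of_nat_Suc of_nat_eq_0_iff nat.distinct(1) add.commute)
  ultimately have A: "A = 0" using k e0 by simp
  have "complex_of_real B = of_real (2 * C)" using eqB A by simp
  then have B: "B = 2 * C" by (simp only: of_real_eq_iff)
  have q2: "((\<lambda>x. \<psi>1 x / x) \<longlongrightarrow> B) ?F" using quot[OF D2[OF U0]] A by (simp add: A_def B_def)
  have q3: "((\<lambda>x. \<psi> x / x\<^sup>2) \<longlongrightarrow> B / 2) ?F"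
  proof (rule lhopital_right_0[OF l0])
    show "((\<lambda>x. x\<^sup>2) \<longlongrightarrow> 0) ?F" using tendsto_power[OF id, of 2] by simp
    show "\<forall>\<^sub>F x in ?F. x\<^sup>2 \<noteq> 0" "\<forall>\<^sub>F x in ?F. 2 * x \<noteq> 0"
      using evJ by (auto elim!: eventually_mono)
    show "\<forall>\<^sub>F x in ?F. (\<psi> has_field_derivative \<psi>1 x) (at x)"
      using evJ by (rule eventually_mono) (use JU D1 in blast)
    show "\<forall>\<^sub>F x in ?F. ((\<lambda>x. x\<^sup>2) has_field_derivative 2 * x) (at x)"
      by (auto intro!: always_eventually derivative_eq_intros)
    have "((\<lambda>x. \<psi>1 x / x / 2) \<longlongrightarrow> B / 2) ?F" by (intro tendsto_intros q2) simp
    then show "((\<lambda>x. \<psi>1 x / (2 * x)) \<longlongrightarrow> B / 2) ?F" by (simp add: mult.commute)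
  qed
  \<comment> \<open>With \<open>A = 0\<close> one may divide \<open>main\<close> by
    \<open>x^2\<close>, as \<open>\<psi>1 / x\<close> tends to \<open>B\<close> and
    \<open>\<psi> / x^2\<close> to \<open>B / 2\<close>. The limit
    \<open>B (1 + 2 k + k (k - 1) / 2) = 2 C\<close> together with \<open>B = 2 C\<close> gives
    \<open>C k (k + 3) = 0\<close>.\<close>
  have "of_real B * poly e 0 + 2 * of_real B * (of_nat k * poly e 0)
      + of_real (B / 2) * (of_nat k * (of_nat k - 1) * poly e 0) = 2 * of_real C * poly e 0"
  proof (rule lim_eq)
    show "((\<lambda>x. of_real (\<psi>2 x) * poly e (of_real x) + 2 * of_real (\<psi>1 x / x) * E1 (of_real x)
       + of_real (\<psi> x / x\<^sup>2) * E2 (of_real x)) \<longlongrightarrow> of_real B * poly e 0 + 2 * of_real B * (of_nat k * poly e 0)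
      + of_real (B / 2) * (of_nat k * (of_nat k - 1) * poly e 0)) ?F"
      by (intro tends lE1 lE2 tendsto_of_real[OF q2] tendsto_of_real[OF q3])
    show "((\<lambda>x. 2 * of_real C * poly e (of_real x)) \<longlongrightarrow> 2 * of_real C * poly e 0) ?F"
      by (intro tends)
    fix x assume "x \<in> ?J"
    show "of_real (\<psi>2 x) * poly e (of_real x) + 2 * of_real (\<psi>1 x / x) * E1 (of_real x)
       + of_real (\<psi> x / x\<^sup>2) * E2 (of_real x) = 2 * of_real C * poly e (of_real x)"
    proof -
      have cancel: "p2 * e + 2 * (p1 / X) * E1 + p0 / X\<^sup>2 * E2 = 2 * c * e"
        if "p2 * X\<^sup>2 * e + 2 * p1 * X * E1 + p0 * E2 = 2 * c * X\<^sup>2 * e" "X \<noteq> 0" for p0 p1 p2 X e E1 E2 c :: complex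
      proof -
        have "X\<^sup>2 * (p2 * e + 2 * (p1 / X) * E1 + p0 / X\<^sup>2 * E2) = X\<^sup>2 * (2 * c * e)"
          using that by (simp add: algebra_simps power2_eq_square)
        then show ?thesis using that(2) by simp
      qed
      from cancel[OF main[OF \<open>x \<in> ?J\<close> refl]] \<open>x \<in> ?J\<close> show ?thesis by simp
    qed
  qed
  then have "of_real C * (of_nat k * (of_nat k + 3) * poly e 0) = 0" by (simp add: B field_simps)
  moreover have "of_nat k + 3 \<noteq> (0 :: complex)"
    by (metis of_nat_add of_nat_numeral of_nat_eq_0_iff add_is_0 zero_neq_numeral)
  ultimately have C: "C = 0" using k e0 by simp
  \<comment> \<open>With \<open>C = 0\<close> the equation says \<open>(\<psi> p)'' = 0\<close>, and
    \<open>\<psi> p\<close> and its derivative tend to 0 at 0. Hence \<open>\<psi> p\<close>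
    vanishes identically, however flat \<open>\<psi>\<close> might be.\<close>
  let ?h = "\<lambda>x. of_real (\<psi> x) * poly p (of_real x)"
  let ?h1 = "\<lambda>x. of_real (\<psi> x) * poly (pderiv p) (of_real x) + of_real (\<psi>1 x) * poly p (of_real x)"
  have hv: "(?h has_vector_derivative ?h1 x) (at x)" if "x \<in> ?J" for x
    using D1[of x] that JU
    by (intro has_vector_derivative_mult has_vector_derivative_of_real has_vector_derivative_poly_of_real) auto
  have h1v: "(?h1 has_vector_derivative 0) (at x)" if "x \<in> ?J" for x
  proof -
    have "(?h1 has_vector_derivative (of_real (\<psi> x) * poly (pderiv (pderiv p)) (of_real x) + of_real (\<psi>1 x) * poly (pderiv p) (of_real x))
        + (of_real (\<psi>1 x) * poly (pderiv p) (of_real x) + of_real (\<psi>2 x) * poly p (of_real x))) (at x)"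
      using D1[of x] D2[of x] that JU
      by (intro has_vector_derivative_add has_vector_derivative_mult has_vector_derivative_of_real
          has_vector_derivative_poly_of_real) auto
    also have "(of_real (\<psi> x) * poly (pderiv (pderiv p)) (of_real x) + of_real (\<psi>1 x) * poly (pderiv p) (of_real x))
        + (of_real (\<psi>1 x) * poly (pderiv p) (of_real x) + of_real (\<psi>2 x) * poly p (of_real x)) = 0"
      using ode'[OF that, of p] C by (simp add: algebra_simps)
    finally show ?thesis .
  qed
  have const: "f x = 0" if f': "\<And>x. x \<in> ?J \<Longrightarrow> (f has_vector_derivative 0) (at x)" "(f \<longlongrightarrow> 0) ?F" "x \<in> ?J"
    for f :: "real \<Rightarrow> complex" and x
  proof -
    obtain b where b: "\<And>x. x \<in> ?J \<Longrightarrow> f x = b"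
      using has_vector_derivative_zero_constant[OF convex_real_interval(8) has_vector_derivative_at_within[OF f'(1)]]
      by blast
    have "b = 0" by (rule lim_eq[OF tendsto_const f'(2)]) (simp add: b)
    then show ?thesis using b f'(3) by simp
  qed
  have "(?h1 \<longlongrightarrow> of_real 0 * poly (pderiv p) 0 + of_real A * poly p 0) ?F" by (intro tends)
  then have "?h1 x = 0" if "x \<in> ?J" for x using const[OF h1v _ that] A by simp
  then have "(?h has_vector_derivative 0) (at x)" if "x \<in> ?J" for x using hv[OF that] that by simp
  moreover have "(?h \<longlongrightarrow> of_real 0 * poly p 0) ?F" by (intro tends)
  ultimately have "?h x = 0" if "x \<in> ?J" for x using const[of ?h x] that by simp
  then have "\<psi> x = 0" if "x \<in> ?J" for x using nz[OF that] that by auto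
  then show False using nontrivial by blast
qed

section \<open>Continuity of the scalar curvature in \<tau>\<close>

lemma matrix_inv_cramer:
  fixes A :: "'a::field^'n::finite^'n"
  assumes "invertible A"
  shows "matrix_inv A $ i $ j = det (\<chi> k l. if l = i then axis j 1 $ k else A $ k $ l) / det A"
proof -
  let ?x = "\<chi> k. matrix_inv A $ k $ j"
  have "A *v ?x = (\<chi> k. (A ** matrix_inv A) $ k $ j)"
    by (simp add: vec_eq_iff matrix_vector_mult_def matrix_matrix_mult_def)
  also have "\<dots> = axis j 1"
    by (simp add: matrix_inv_inverse[OF assms] vec_eq_iff mat_def axis_def)
  finally have "?x = (\<chi> k. det (\<chi> i l. if l = k then axis j 1 $ i else A $ i $ l) / det A)"
    using cramer[of A] assms by (simp add: invertible_det_nz)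
  then show ?thesis by (simp add: vec_eq_iff)
qed

lemma continuous_on_det:
  fixes A :: "'a::topological_space \<Rightarrow> complex^'n::finite^'n"
  assumes "\<And>i j. continuous_on X (\<lambda>x. A x $ i $ j)"
  shows "continuous_on X (\<lambda>x. det (A x))"
  unfolding det_def by (intro continuous_intros assms)

lemma continuous_on_matrix_inv:
  fixes A :: "'a::topological_space \<Rightarrow> complex^'n::finite^'n"
  assumes "\<And>i j. continuous_on X (\<lambda>x. A x $ i $ j)" "\<And>x. x \<in> X \<Longrightarrow> invertible (A x)"
  shows "continuous_on X (\<lambda>x. matrix_inv (A x) $ i $ j)"
proof -
  have "continuous_on X (\<lambda>x. if l = i then axis j 1 $ k else A x $ k $ l)" for k l
    using assms(1) by (cases "l = i") auto
  then have "continuous_on X (\<lambda>x. det (\<chi> k l. if l = i then axis j 1 $ k else A x $ k $ l) / det (A x))"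
    using assms(2) by (intro continuous_intros continuous_on_det assms(1)) (auto simp: invertible_det_nz)
  then show ?thesis using assms(2) by (simp add: matrix_inv_cramer cong: continuous_on_cong)
qed

context hermitian_chart
begin

text \<open>The Ricci form involves \<open>z\<close>-derivatives only, but their continuity in
  \<open>\<tau>\<close> is required. So \<open>\<tau>\<close> is treated as a further coordinate,
  and joint smoothness of \<open>ln det\<close> in \<open>(\<tau>, z)\<close> gives continuity of
  its second derivatives.\<close>

lemma continuous_on_scal:
  fixes g :: "complex^'n \<Rightarrow> complex^'n^'n"
  assumes g: "\<And>k i j. Ck_on k S (\<lambda>z. g z $ i $ j)" and z: "z \<in> S"
    and pos: "\<And>\<tau>. \<tau> \<in> X \<Longrightarrow> hermitian_pos (g z - \<tau> *\<^sub>R curv z)"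
  shows "continuous_on X (\<lambda>\<tau>. scal (\<lambda>z. g z - \<tau> *\<^sub>R curv z) z)"
proof -
  let ?G = "\<lambda>p::real \<times> (complex^'n). \<chi> i j. g (snd p) $ i $ j - of_real (fst p) * curv (snd p) $ i $ j"
  have G: "g y - \<tau> *\<^sub>R curv y = ?G (\<tau>, y)" for \<tau> y by (simp add: vec_eq_iff) (simp add: scaleR_conv_of_real)
  have o: "open (UNIV \<times> S :: (real \<times> (complex^'n)) set)" using open_S by (intro open_Times) auto
  have snd: "Ck_on k ((UNIV :: real set) \<times> S) (\<lambda>p. F (snd p))" if "Ck_on k S F" for F :: "complex^'n \<Rightarrow> complex" and k
    by (rule Ck_on_compose[OF o _ Ck_on_bounded_linear[OF bounded_linear_snd] that]) auto
  have CG: "Ck_on k ((UNIV :: real set) \<times> S) (\<lambda>p. ?G p $ i $ j)" for k i j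
    by (simp, intro Ck_on_diff Ck_on_mult o snd g Ck_on_curv Ck_on_bounded_linear
        bounded_linear_compose[OF bounded_linear_of_real bounded_linear_fst])
  \<comment> \<open>Open in the product, while \<open>X\<close> may contain a boundary point such as
    \<open>\<tau> = 0\<close>; the two-sided derivatives in \<open>Ck_on\<close> require the open
    set.\<close>
  define Q where "Q = ((UNIV :: real set) \<times> S) \<inter> (\<lambda>p. det (?G p)) -` (- \<real>\<^sub>\<le>\<^sub>0)"
  have Q: "open Q" unfolding Q_def
    by (rule continuous_open_preimage[OF Ck_on_continuous_on[OF Ck_on_det[OF o CG]] o]) (rule open_Compl, simp)
  have "Ck_on k Q (\<lambda>p. det (?G p))" for k
    by (rule Ck_on_subset[OF Ck_on_det[OF o CG]]) (auto simp: Q_def)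
  then have CF: "Ck_on k Q (\<lambda>p. ln (det (?G p)))" for k
    by (rule Ck_on_logarithm[OF Q]) (auto simp: Q_def intro!: has_field_derivative_Ln)
  have inQ: "(\<tau>, z) \<in> Q" if "\<tau> \<in> X" for \<tau>
    using det_hermitian_pos[OF pos[OF that]] z unfolding G Q_def by (auto elim!: Reals_cases)
  have cs: "continuous_on X (\<lambda>\<tau>. (\<tau>, z))" by (intro continuous_intros)
  let ?H = "\<lambda>\<tau>. hess2 (\<lambda>p. ln (det (?G p))) (\<tau>, z)"
  have cH: "continuous_on X (\<lambda>\<tau>. ?H \<tau> a b)" for a b
  proof -
    have "continuous_on Q (\<lambda>p. hess2 (\<lambda>p. ln (det (?G p))) p a b)"
      using CF[of 2] unfolding numeral_2_eq_2 hess2_def Ck_on.simps by blast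
    from continuous_on_compose2[OF this cs] show ?thesis using inQ by auto
  qed
  have ric: "ricci_form (\<lambda>z. g z - \<tau> *\<^sub>R curv z) z $ i $ j
      = - 2 * levi (\<lambda>a b. ?H \<tau> (0, a) (0, b)) (axis i 1) (axis j 1)" if \<tau>: "\<tau> \<in> X" for \<tau> i j
  proof -
    have "Ck_on k {y. (\<tau>, y) \<in> Q} (\<lambda>y. (\<tau>, y))" and o': "open {y. (\<tau>, y) \<in> Q}" for k
    proof -
      show o': "open {y. (\<tau>, y) \<in> Q}"
        using open_vimage[OF Q, of "\<lambda>y. (\<tau>, y)"] by (simp add: vimage_def continuous_intros)
      show "Ck_on k {y. (\<tau>, y) \<in> Q} (\<lambda>y. (\<tau>, y))"
        using o' by (intro Ck_on_Pair Ck_on_const Ck_on_bounded_linear bounded_linear_ident)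
    qed
    from Ck_on_compose[OF o' _ this(1) CF]
    have "Ck_on 2 {y. (\<tau>, y) \<in> Q} (\<lambda>y. ln (det (?G (\<tau>, y))))" by auto
    from iddbar_eq_levi[OF o' this, of z i j] inQ[OF \<tau>] show ?thesis
      unfolding ricci_form_def G by (simp add: hess2_slice[OF Q CF inQ[OF \<tau>]])
  qed
  have "continuous_on X (\<lambda>\<tau>. levi (\<lambda>a b. ?H \<tau> (0, a) (0, b)) a b)" for a b
    unfolding levi_def by (intro continuous_intros cH) simp
  then have cR: "continuous_on X (\<lambda>\<tau>. ricci_form (\<lambda>z. g z - \<tau> *\<^sub>R curv z) z $ i $ j)" for i j
    by (simp add: ric continuous_intros cong: continuous_on_cong)
  have cI: "continuous_on X (\<lambda>\<tau>. matrix_inv (g z - \<tau> *\<^sub>R curv z) $ i $ j)" for i j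
    by (rule continuous_on_matrix_inv[OF _ hermitian_pos_invertible[OF pos]])
      (auto simp: G intro!: continuous_intros)
  show ?thesis
    unfolding scal_def form_endo_def trace_transpose
    by (simp add: trace_def matrix_matrix_mult_def) (intro continuous_intros cR cI)
qed

end

section \<open>Spectrum and scalar curvature in terms of the polynomial Q\<close>

lemma charpoly_transpose: "charpoly (transpose E) = charpoly (E :: complex^'n::finite^'n)"
proof -
  have "(\<chi> i j. (if i = j then [:0, 1:] else 0) - [:transpose E $ i $ j:])
      = transpose (\<chi> i j. (if i = j then [:0, 1:] else 0) - [:E $ i $ j:])"
    by (auto simp: vec_eq_iff transpose_def)
  then show ?thesis by (simp add: charpoly_def)
qed

text \<open>With \<open>N = B G^(-1)\<close>, \<open>det (G - a B)\<close> is
  \<open>det (a (1/a - N)) det G\<close>: up to \<open>det G\<close>, the pencil is the reversed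
  characteristic polynomial. \<open>form_endo G B\<close> is the transpose of
  \<open>N\<close>.\<close>

lemma poly_det_pencil_charpoly:
  fixes G B :: "complex^'n::finite^'n"
  assumes "invertible G" "a \<noteq> 0"
  shows "poly (det_pencil G B) a = det G * a ^ CARD('n) * poly (charpoly (form_endo G B)) (1 / a)"
proof -
  let ?N = "B ** matrix_inv G"
  have NG: "?N ** G = B"
    by (simp only: matrix_mul_assoc[symmetric] matrix_inv_inverse[OF assms(1)] matrix_mul_rid)
  have "(\<chi> i. a *s (mat (1 / a) - ?N) $ i) ** G = (\<chi> i j. G $ i $ j - a * (?N ** G) $ i $ j)"
  proof -
    have "(\<chi> i. a *s (mat (1 / a) - N) $ i) ** G = (\<chi> i j. G $ i $ j - a * (N ** G) $ i $ j)" for N :: "complex^'n^'n"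
      using assms(2) by (simp add: vec_eq_iff matrix_matrix_mult_def mat_def left_diff_distrib right_diff_distrib
          sum_subtractf sum_distrib_left if_distrib[of "\<lambda>x. x * _"] if_distrib[of "\<lambda>x. _ * x"] mult.assoc cong: if_cong)
    then show ?thesis .
  qed
  then have "poly (det_pencil G B) a = det ((\<chi> i. a *s (mat (1 / a) - ?N) $ i) ** G)"
    unfolding NG poly_det_pencil by (rule sym[OF arg_cong])
  also have "\<dots> = a ^ CARD('n) * det (\<chi> i. (mat (1 / a) - ?N) $ i) * det G"
    using det_rows_mul[of "\<lambda>_. a" "\<lambda>i. (mat (1 / a) - ?N) $ i"] by (simp add: det_mul)
  also have "det (\<chi> i. (mat (1 / a) - ?N) $ i) = poly (charpoly (form_endo G B)) (1 / a)"
    by (simp only: form_endo_def charpoly_transpose poly_charpoly vec_lambda_eta)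
  finally show ?thesis by simp
qed

text \<open>The polynomial \<open>Q\<close> at the point \<open>x\<close>.\<close>

definition norm_pencil ::
    "('a, 'n::finite) kaehler_data \<Rightarrow> ('a, 'l) line_bundle_data \<Rightarrow> ('a, 'n) chart \<Rightarrow> ('a, 'l) triv \<Rightarrow> 'a \<Rightarrow> complex poly" where
  "norm_pencil M L c T x = smult (inverse (det (metric M c (snd c x))))
     (det_pencil (metric M c (snd c x)) (curv_form L c T (snd c x)))"

context horizontal_chart
begin

lemma hermitian_pos_at:
  assumes "x \<in> fst c \<inter> fst T" "\<tau> \<in> I"
  shows "hermitian_pos (metric_at M L \<tau> c T (snd c x))"
  using metric_pos[of \<tau> "snd c x"] assms by (simp add: metric_at_def curv_eq chart_dom_def)

lemma norm_pencil_properties: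
  assumes x: "x \<in> fst c \<inter> fst T" and I: "0 \<in> I"
  shows "det_pencil (metric M c (snd c x)) (curv_form L c T (snd c x))
      = smult (det (metric M c (snd c x))) (norm_pencil M L c T x)"
    and "det (metric M c (snd c x)) \<noteq> 0"
    and "poly (norm_pencil M L c T x) 0 = 1"
    and "\<tau> \<in> I \<Longrightarrow> poly (norm_pencil M L c T x) (of_real \<tau>) \<in> \<real> - {0}"
proof -
  let ?G = "metric M c (snd c x)"
  let ?P = "det_pencil ?G (curv_form L c T (snd c x))"
  have P: "poly ?P (of_real \<tau>) = det (metric_at M L \<tau> c T (snd c x))" for \<tau>
    unfolding poly_det_pencil metric_at_def
    by (rule arg_cong[where f = det]) (simp add: vec_eq_iff, simp add: scaleR_conv_of_real)
  have pos: "poly ?P (of_real \<tau>) \<in> \<real> - {0}" if "\<tau> \<in> I" for \<tau>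
    unfolding P using det_hermitian_pos[OF hermitian_pos_at[OF x that]] by auto
  have G: "det ?G = poly ?P 0" by (simp add: poly_det_pencil)
  show 0: "det ?G \<noteq> 0" using pos[OF I] by (simp add: G)
  then show "?P = smult (det ?G) (norm_pencil M L c T x)" by (simp add: norm_pencil_def)
  show "poly (norm_pencil M L c T x) 0 = 1" using 0 by (simp add: norm_pencil_def G)
  show "poly (norm_pencil M L c T x) (of_real \<tau>) \<in> \<real> - {0}" if "\<tau> \<in> I"
    using pos[OF that] pos[OF I] by (simp add: norm_pencil_def G Reals_mult Reals_inverse)
qed

lemma eigenvalues_determined_by_norm_pencil:
  assumes x: "x \<in> fst c \<inter> fst T" and I: "0 \<in> I" and a: "a \<noteq> 0"
  shows "poly (charpoly (form_endo (metric M c (snd c x)) (curv_form L c T (snd c x)))) a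
     = a ^ CARD('n) * poly (norm_pencil M L c T x) (1 / a)"
proof -
  have "invertible (metric M c (snd c x))"
    using norm_pencil_properties(2)[OF x I] by (simp add: invertible_det_nz)
  from poly_det_pencil_charpoly[OF this, of "1 / a" "curv_form L c T (snd c x)"] a show ?thesis
    unfolding norm_pencil_properties(1)[OF x I] using norm_pencil_properties(2)[OF x I]
    by (simp add: power_one_over field_simps)
qed

lemma continuous_on_scal_metric_at:
  assumes x: "x \<in> fst c \<inter> fst T"
  shows "continuous_on I (\<lambda>\<tau>. scal (metric_at M L \<tau> c T) (snd c x))"
proof -
  have z: "snd c x \<in> chart_dom c T" using x by (simp add: chart_dom_def)
  from continuous_on_scal[OF metric_smooth z metric_pos] z
  show ?thesis unfolding metric_at_def[abs_def] curv_eq by blast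
qed

end

text \<open>The fraction in \<open>scal_induced\<close> is homogeneous of degree 0 in the pencil, so
  the factor \<open>det g\<close>, which varies with chart and point, cancels and the normalised
  polynomial may be inserted.\<close>

lemma scal_metric_at:
  fixes M :: "('a, 'n::finite) kaehler_data" and L :: "('a, 'l) line_bundle_data"
  assumes "0 < \<epsilon>" and hd: "horizontal_data M L {0..<\<epsilon>}" and "\<tau>0 \<in> {0<..<\<epsilon>}"
    and "momentum_profile {0..<\<epsilon>} \<phi>" and "induces_constant_scal M L {0..<\<epsilon>} \<tau>0 \<phi> s"
    and c: "c \<in> atlas M" and T: "T \<in> trivs L" and x: "x \<in> fst c \<inter> fst T" and \<tau>: "\<tau> \<in> {0<..<\<epsilon>}"
  defines "p \<equiv> norm_pencil M L c T x"
  shows "scal (metric_at M L \<tau> c T) (snd c x) = of_real s +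
    (of_real (deriv (deriv \<phi>) \<tau>) * poly p (of_real \<tau>) + 2 * of_real (deriv \<phi> \<tau>) * poly (pderiv p) (of_real \<tau>)
      + of_real (\<phi> \<tau>) * poly (pderiv (pderiv p)) (of_real \<tau>)) / (2 * poly p (of_real \<tau>))"
proof -
  interpret horizontal_chart M L "{0..<\<epsilon>}" c T using hd c T by unfold_locales
  have I: "0 \<in> {0..<\<epsilon>}" "\<tau> \<in> {0..<\<epsilon>}" using assms(1) \<tau> by auto
  note np = norm_pencil_properties[OF x I(1), folded p_def]
  have cancel: "(a * (d * u) + 2 * b * (d * v) + e * (d * w)) / (2 * (d * u)) = (a * u + 2 * b * v + e * w) / (2 * u)"
    if "d \<noteq> 0" for a b e d u v w :: complex
  proof -
    have "(a * (d * u) + 2 * b * (d * v) + e * (d * w)) / (2 * (d * u)) = (d * (a * u + 2 * b * v + e * w)) / (d * (2 * u))"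
      by (simp add: algebra_simps)
    then show ?thesis using that by simp
  qed
  show ?thesis
    using scal_induced[OF assms(1-9)] unfolding np(1) pderiv_smult poly_smult cancel[OF np(2)] by simp
qed

lemma deriv_eq_on_open:
  fixes f g :: "real \<Rightarrow> real"
  assumes "open S" "\<And>x. x \<in> S \<Longrightarrow> f x = g x" "x \<in> S"
  shows "deriv f x = deriv g x"
  using assms by (intro deriv_cong_ev) (auto simp: eventually_nhds)

theorem corollary5p1:
  fixes M :: "('a, 'n::finite) kaehler_data"
    and L :: "('a, 'l) line_bundle_data"
    and \<epsilon> \<tau>0 c1 c2 :: real
    and \<phi>1 \<phi>2 :: "real \<Rightarrow> real"
  assumes "0 < \<epsilon>"
    and "horizontal_data M L {0..<\<epsilon>}"
    and "\<tau>0 \<in> {0<..<\<epsilon>}"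
    and "momentum_profile {0..<\<epsilon>} \<phi>1"
    and "momentum_profile {0..<\<epsilon>} \<phi>2"
    and "\<exists>x\<in>closure {0..<\<epsilon>}. \<phi>1 x \<noteq> \<phi>2 x"
    and "\<phi>1 0 = \<phi>2 0"
    and "induces_constant_scal M L {0..<\<epsilon>} \<tau>0 \<phi>1 c1"
    and "induces_constant_scal M L {0..<\<epsilon>} \<tau>0 \<phi>2 c2"
  shows "sigma_constant M L {0..<\<epsilon>}"
proof -
  let ?I = "{0..<\<epsilon>}" and ?J = "{0<..<\<epsilon>}"
  have \<epsilon>: "0 < \<epsilon>" and I0: "0 \<in> ?I" using assms(1) by auto
  \<comment> \<open>The uniqueness lemma uses two-sided derivatives at 0, where a profile itself has
    arbitrary values to the left; hence the smooth extensions.\<close>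
  obtain U1 \<psi>1 where U1: "open U1" "{0..\<epsilon>} \<subseteq> U1" "\<And>k. Ck_on k U1 \<psi>1" "\<And>x. x \<in> {0..\<epsilon>} \<Longrightarrow> \<psi>1 x = \<phi>1 x"
    using momentum_profile_extension[OF assms(4,1)] by metis
  obtain U2 \<psi>2 where U2: "open U2" "{0..\<epsilon>} \<subseteq> U2" "\<And>k. Ck_on k U2 \<psi>2" "\<And>x. x \<in> {0..\<epsilon>} \<Longrightarrow> \<psi>2 x = \<phi>2 x"
    using momentum_profile_extension[OF assms(5,1)] by metis
  define U where "U = U1 \<inter> U2"
  define \<psi> where "\<psi> = (\<lambda>x. \<psi>1 x - \<psi>2 x)"
  have U: "open U" "{0..\<epsilon>} \<subseteq> U" using U1 U2 by (auto simp: U_def)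
  have C1: "Ck_on k U \<psi>1" and C2: "Ck_on k U \<psi>2" for k
    using U1(3) U2(3) by (auto simp: U_def intro: Ck_on_subset)
  have C: "Ck_on k U \<psi>" for k unfolding \<psi>_def by (intro Ck_on_diff U C1 C2)
  have \<psi>: "\<psi> x = \<phi>1 x - \<phi>2 x" if "x \<in> {0..\<epsilon>}" for x using U1(4) U2(4) that by (simp add: \<psi>_def)
  have JU: "?J \<subseteq> U" using U(2) by auto
  have d1: "deriv \<psi> x = deriv \<phi>1 x - deriv \<phi>2 x" if "x \<in> ?J" for x
  proof -
    have "((\<lambda>x. \<psi>1 x - \<psi>2 x) has_field_derivative deriv \<psi>1 x - deriv \<psi>2 x) (at x)"
      using Ck_on_deriv(2)[OF U(1) C1[of "Suc 0"]] Ck_on_deriv(2)[OF U(1) C2[of "Suc 0"]] that JU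
      by (intro DERIV_diff) auto
    then have "deriv \<psi> x = deriv \<psi>1 x - deriv \<psi>2 x" unfolding \<psi>_def by (rule DERIV_imp_deriv)
    moreover have "deriv \<psi>1 x = deriv \<phi>1 x" "deriv \<psi>2 x = deriv \<phi>2 x"
      using U1(4) U2(4) that by (auto intro!: deriv_eq_on_open[of ?J])
    ultimately show ?thesis by simp
  qed
  have d2: "deriv (deriv \<psi>) x = deriv (deriv \<phi>1) x - deriv (deriv \<phi>2) x" if x: "x \<in> ?J" for x
  proof -
    have e: "deriv \<psi>1 y = deriv \<phi>1 y" "deriv \<psi>2 y = deriv \<phi>2 y" if "y \<in> ?J" for y
      using U1(4) U2(4) that by (auto intro!: deriv_eq_on_open[of ?J])
    have "deriv (deriv \<psi>) x = deriv (\<lambda>y. deriv \<psi>1 y - deriv \<psi>2 y) x"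
      by (rule deriv_eq_on_open[OF open_greaterThanLessThan _ x]) (simp add: d1 e)
    also have "\<dots> = deriv (deriv \<psi>1) x - deriv (deriv \<psi>2) x"
      using Ck_on_deriv(2)[OF U(1) Ck_on_deriv(1)[OF U(1) C1[of "Suc (Suc 0)"]]]
        Ck_on_deriv(2)[OF U(1) Ck_on_deriv(1)[OF U(1) C2[of "Suc (Suc 0)"]]] x JU
      by (intro DERIV_imp_deriv DERIV_diff) auto
    also have "deriv (deriv \<psi>1) x = deriv (deriv \<phi>1) x"
      by (rule deriv_eq_on_open[OF open_greaterThanLessThan _ x]) (simp add: e)
    also have "deriv (deriv \<psi>2) x = deriv (deriv \<phi>2) x"
      by (rule deriv_eq_on_open[OF open_greaterThanLessThan _ x]) (simp add: e)
    finally show ?thesis .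
  qed
  \<comment> \<open>The profiles are assumed to differ somewhere on the closure; by continuity they
    already differ in the interior.\<close>
  have nontrivial: "\<exists>x\<in>?J. \<psi> x \<noteq> 0"
  proof (rule ccontr)
    assume "\<not> ?thesis"
    then have 0: "\<psi> x = 0" if "x \<in> ?J" for x using that by blast
    have cl: "closure ?J = {0..\<epsilon>}" "closure ?I = {0..\<epsilon>}" using \<epsilon> by simp_all
    have "continuous_on (closure ?J) \<psi>"
      unfolding cl using Ck_on_continuous_on[OF C[of 0]] U(2) continuous_on_subset by blast
    from continuous_constant_on_closure[OF this 0] have "\<psi> x = 0" if "x \<in> {0..\<epsilon>}" for x
      using that unfolding cl by blast
    then show False using assms(6) \<psi> unfolding cl by force
  qed
  let ?ok = "\<lambda>c T x. c \<in> atlas M \<and> T \<in> trivs L \<and> x \<in> fst c \<inter> fst T"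
  let ?p = "norm_pencil M L"
  have chart: "horizontal_chart M L ?I c T" if "?ok c T x" for c T x
    using that assms(2) by unfold_locales auto
  have s1: "scal (metric_at M L \<tau> c T) (snd c x) = of_real c1 +
    (of_real (deriv (deriv \<phi>1) \<tau>) * poly (?p c T x) (of_real \<tau>) + 2 * of_real (deriv \<phi>1 \<tau>) * poly (pderiv (?p c T x)) (of_real \<tau>)
      + of_real (\<phi>1 \<tau>) * poly (pderiv (pderiv (?p c T x))) (of_real \<tau>)) / (2 * poly (?p c T x) (of_real \<tau>))"
    if "?ok c T x" "\<tau> \<in> ?J" for c T x \<tau>
    using scal_metric_at[OF assms(1-4,8)] that by blast
  have s2: "scal (metric_at M L \<tau> c T) (snd c x) = of_real c2 +
    (of_real (deriv (deriv \<phi>2) \<tau>) * poly (?p c T x) (of_real \<tau>) + 2 * of_real (deriv \<phi>2 \<tau>) * poly (pderiv (?p c T x)) (of_real \<tau>)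
      + of_real (\<phi>2 \<tau>) * poly (pderiv (pderiv (?p c T x))) (of_real \<tau>)) / (2 * poly (?p c T x) (of_real \<tau>))"
    if "?ok c T x" "\<tau> \<in> ?J" for c T x \<tau>
    using scal_metric_at[OF assms(1-3,5,9)] that by blast
  have real: "poly (?p c T x) (of_real \<tau>) \<in> \<real>" "poly (?p c T x) (of_real \<tau>) \<noteq> 0"
    if "?ok c T x" "\<tau> \<in> ?J" for c T x \<tau>
    using horizontal_chart.norm_pencil_properties(4)[OF chart[OF that(1)] _ I0, of x \<tau>] that by auto
  have ode: "of_real (deriv (deriv \<psi>) \<tau>) * poly (?p c T x) (of_real \<tau>)
      + 2 * of_real (deriv \<psi> \<tau>) * poly (pderiv (?p c T x)) (of_real \<tau>)
      + of_real (\<psi> \<tau>) * poly (pderiv (pderiv (?p c T x))) (of_real \<tau>)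
      = 2 * of_real (c2 - c1) * poly (?p c T x) (of_real \<tau>)" if ok: "?ok c T x" and \<tau>: "\<tau> \<in> ?J" for c T x \<tau>
  proof -
    have alg: "(a1 - a2) * u + 2 * (b1 - b2) * v + (e1 - e2) * w = 2 * (k2 - k1) * u"
      if "k1 + (a1 * u + 2 * b1 * v + e1 * w) / (2 * u) = k2 + (a2 * u + 2 * b2 * v + e2 * w) / (2 * u)" "u \<noteq> 0"
      for a1 a2 b1 b2 e1 e2 k1 k2 u v w :: complex
    proof -
      have "2 * u * (k + n / (2 * u)) = 2 * u * k + n" for k n
        using that(2) by (simp add: distrib_left)
      then have "2 * u * k1 + (a1 * u + 2 * b1 * v + e1 * w) = 2 * u * k2 + (a2 * u + 2 * b2 * v + e2 * w)"
        using that(1) by metis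
      then show ?thesis by algebra
    qed
    have "\<tau> \<in> {0..\<epsilon>}" using \<tau> by auto
    then show ?thesis
      using alg[OF trans[OF s1[OF ok \<tau>, symmetric] s2[OF ok \<tau>]] real(2)[OF ok \<tau>]]
      by (simp only: d1[OF \<tau>] d2[OF \<tau>] \<psi> of_real_diff)
  qed
  \<comment> \<open>The two points are arbitrary, possibly in different charts or components:
    neither the equation nor the value 1 at 0 refers to the point.\<close>
  have unique: "?p c T x = ?p c' T' x'" if "?ok c T x" "?ok c' T' x'" for c T x c' T' x'
  proof (rule momentum_ode_unique[OF \<epsilon> U C])
    show "\<psi> 0 = 0" using \<psi>[of 0] assms(7) \<epsilon> by simp
    show "of_real (deriv (deriv \<psi>) \<tau>) * poly r (of_real \<tau>) + 2 * of_real (deriv \<psi> \<tau>) * poly (pderiv r) (of_real \<tau>)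
          + of_real (\<psi> \<tau>) * poly (pderiv (pderiv r)) (of_real \<tau>) = 2 * of_real (c2 - c1) * poly r (of_real \<tau>)"
      if "\<tau> \<in> ?J" "r \<in> {?p c T x, ?p c' T' x'}" for \<tau> r
      using that ode[OF \<open>?ok c T x\<close>] ode[OF \<open>?ok c' T' x'\<close>] by blast
    show "poly (?p c T x) 0 = 1" "poly (?p c' T' x') 0 = 1"
      using that horizontal_chart.norm_pencil_properties(3)[OF chart _ I0] by blast+
  qed (use real(2)[OF that(1)] nontrivial in auto)
  show ?thesis
  \<comment> \<open>If no point lies in a chart and a trivialization, there is no reference value to
    compare with, and the claim is vacuous.\<close>
  proof (cases "\<exists>c T x. ?ok c T x")
    case False
    then show ?thesis unfolding sigma_constant_def by blast
  next
    case True
    then obtain c0 T0 x0 where ok0: "?ok c0 T0 x0" by blast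
    let ?\<Lambda> = "\<lambda>c T x. form_endo (metric M c (snd c x)) (curv_form L c T (snd c x))"
    let ?\<sigma> = "\<lambda>c T x \<tau>. scal (metric_at M L \<tau> c T) (snd c x)"
    have "eigenvalues (?\<Lambda> c T x) = eigenvalues (?\<Lambda> c0 T0 x0)" if ok: "?ok c T x" for c T x
    proof -
      have "charpoly (?\<Lambda> c T x) = charpoly (?\<Lambda> c0 T0 x0)"
      \<comment> \<open>Any interval avoiding 0 would do, since the pencil is evaluated at
        \<open>1 / a\<close>.\<close>
      proof (rule poly_eqI_interval[of 0 1])
        fix a :: real assume "a \<in> {0<..<1}"
        then have a: "complex_of_real a \<noteq> 0" by auto
        show "poly (charpoly (?\<Lambda> c T x)) (of_real a) = poly (charpoly (?\<Lambda> c0 T0 x0)) (of_real a)"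
          using horizontal_chart.eigenvalues_determined_by_norm_pencil[OF chart[OF ok] _ I0 a, of x]
            horizontal_chart.eigenvalues_determined_by_norm_pencil[OF chart[OF ok0] _ I0 a, of x0]
            unique[OF ok ok0] ok ok0 by simp
      qed simp
      then show ?thesis by (simp add: eigenvalues_def)
    qed
    moreover have "\<exists>s::real. \<forall>c\<in>atlas M. \<forall>T\<in>trivs L. \<forall>x\<in>fst c \<inter> fst T. ?\<sigma> c T x \<tau> = of_real s" if \<tau>: "\<tau> \<in> ?I" for \<tau>
    proof -
      have J: "?\<sigma> c T x \<tau> = ?\<sigma> c0 T0 x0 \<tau>" "Im (?\<sigma> c0 T0 x0 \<tau>) = 0" if "?ok c T x" "\<tau> \<in> ?J" for c T x \<tau>
      proof -
        show "?\<sigma> c T x \<tau> = ?\<sigma> c0 T0 x0 \<tau>"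
          by (simp only: s1[OF that] s1[OF ok0 that(2)] unique[OF that(1) ok0])
        note r = real(1)[OF ok0]
        have r1: "poly (pderiv (?p c0 T0 x0)) (of_real \<tau>) \<in> \<real>" if "\<tau> \<in> ?J" for \<tau>
          using poly_pderiv_real[OF r that] .
        have "?\<sigma> c0 T0 x0 \<tau> \<in> \<real>"
          unfolding s1[OF ok0 that(2)]
          by (intro Reals_add Reals_divide Reals_mult r r1 poly_pderiv_real[OF r1] Reals_of_real Reals_numeral)
            (use that(2) in simp_all)
        then show "Im (?\<sigma> c0 T0 x0 \<tau>) = 0" by (simp add: complex_is_Real_iff)
      qed
      \<comment> \<open>The formula from the profiles covers only interior \<open>\<tau>\<close>;
        \<open>\<tau> = 0\<close> follows by continuity. Halving \<open>\<epsilon>\<close> keeps the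
        closure inside the interval on which the metrics are positive.\<close>
      have cl: "closure {0<..<\<epsilon>/2} = {0..\<epsilon>/2}" using \<epsilon> by simp
      have sub: "closure {0<..<\<epsilon>/2} \<subseteq> ?I" unfolding cl using \<epsilon> by auto
      have z: "0 \<in> closure {0<..<\<epsilon>/2}" unfolding cl using \<epsilon> by auto
      have cont: "continuous_on (closure {0<..<\<epsilon>/2}) (?\<sigma> c T x)" if "?ok c T x" for c T x
        using continuous_on_subset[OF horizontal_chart.continuous_on_scal_metric_at[OF chart[OF that]] sub] that by blast
      have Z: "?\<sigma> c T x 0 = ?\<sigma> c0 T0 x0 0" "Im (?\<sigma> c0 T0 x0 0) = 0" if ok: "?ok c T x" for c T x
      proof -
        have "?\<sigma> c T x 0 - ?\<sigma> c0 T0 x0 0 = 0"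
          by (rule continuous_constant_on_closure[OF continuous_on_diff[OF cont[OF ok] cont[OF ok0]] _ z])
            (use J[OF ok] in auto)
        then show "?\<sigma> c T x 0 = ?\<sigma> c0 T0 x0 0" by simp
        show "Im (?\<sigma> c0 T0 x0 0) = 0"
          by (rule continuous_constant_on_closure[OF continuous_on_Im[OF cont[OF ok0]] _ z])
            (use J[OF ok] in auto)
      qed
      have "\<tau> = 0 \<or> \<tau> \<in> ?J" using \<tau> by auto
      then have "?\<sigma> c T x \<tau> = of_real (Re (?\<sigma> c0 T0 x0 \<tau>))" if "?ok c T x" for c T x
        using J[OF that, of \<tau>] Z[OF that] by (auto simp: complex_eq_iff)
      then show ?thesis by blast
    qed
    ultimately show ?thesis unfolding sigma_constant_def by blast
  qed
qed

end
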